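(* Let $q$ be a prime power, let $V_2\subset\mathbb{P}^3$ be a non-degenerate Hermitian surface defined over $\mathbb{F}_{q^2}$, and let $F\in\mathbb{F}_{q^2}[x_0,x_1,x_2,x_3]$ be a nonzero homogeneous polynomial of degree $d$ with $1\le d\le q$. Then $$|(V(F)\cap V_2)(\mathbb{F}_{q^2})|\le d(q^3+q^2-q)+q+1.$$ Moreover, equality holds if and only if $V(F)$ is the union of $d$ (distinct) tangent planes of $V_2$ that all contain a common secant line.
   Context: $\mathbb{P}^3$ is projective 3-space over the algebraic closure $\overline{\mathbb{F}}_q$; for a homogeneous polynomial $F$, $V(F)$ is its zero set in $\mathbb{P}^3$; for a variety $Y\subset\mathbb{P}^3$, $Y(\mathbb{F}_{q^2})$ is the set of its $\mathbb{F}_{q^2}$-rational points. A Hermitian matrix is a nonzero $4\times4$ matrix $A=(a_{ij})$ over $\mathbb{F}_{q^2}$ with $A^T=A^{(q)}$, where $A^{(q)}=(a_{ij}^q)$. The Hermitian surface given by $A$ is the zero set in $\mathbb{P}^3$ of $x^TAx^{(q)}$, where $x=(x_0,x_1,x_2,x_3)^T$ and $x^{(q)}=(x_0^q,x_1^q,x_2^q,x_3^q)^T$; it is non-degenerate if $\operatorname{rank}A=4$. A tangent plane of $V_2$ is a plane of $\mathbb{P}^3$ defined over $\mathbb{F}_{q^2}$ that is the tangent plane to $V_2$ at some point of $V_2$. A secant line is a line of $\mathbb{P}^3$ defined over $\mathbb{F}_{q^2}$ that meets $V_2$ in exactly $q+1$ points. *)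

theory Defs
  imports
    "HOL-Analysis.Analysis"
    "HOL-Algebra.Algebraic_Closure_Type"
    "HOL-Library.Poly_Mapping"
    "HOL-Number_Theory.Prime_Powers"
begin

text \<open>
  Throughout, \<open>'a\<close> is the ground field, \<open>'a alg_closure\<close> its algebraic closure and
  \<open>'n\<close> the finite type indexing the homogeneous coordinates; projective 3-space is the
  case \<open>'n = 4\<close>.
\<close>

type_synonym ('n, 'a) mpoly = "('n \<Rightarrow>\<^sub>0 nat) \<Rightarrow>\<^sub>0 'a"

definition homogeneous :: "nat \<Rightarrow> ('n::finite, 'a::zero) mpoly \<Rightarrow> bool" where
  "homogeneous d F \<longleftrightarrow>
     (\<forall>m \<in> Poly_Mapping.keys F. (\<Sum>i\<in>UNIV. Poly_Mapping.lookup m i) = d)"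

definition eval_mpoly ::
    "('n::finite, 'a::field) mpoly \<Rightarrow> 'a alg_closure ^ 'n \<Rightarrow> 'a alg_closure" where
  "eval_mpoly F x =
     (\<Sum>m \<in> Poly_Mapping.keys F.
        to_ac (Poly_Mapping.lookup F m) * (\<Prod>i\<in>UNIV. (x $ i) ^ Poly_Mapping.lookup m i))"

text \<open>
  Formal partial derivative. The truncated subtraction of exponents only matters for monomials
  in which the variable \<open>i\<close> does not occur, and these have coefficient 0 in the result.
\<close>

definition partial_deriv ::
    "'n::finite \<Rightarrow> ('n, 'a::field) mpoly \<Rightarrow> ('n, 'a) mpoly" where
  "partial_deriv i F =
     (\<Sum>m \<in> Poly_Mapping.keys F.
        Poly_Mapping.single (m - Poly_Mapping.single i 1)
          (of_nat (Poly_Mapping.lookup m i) * Poly_Mapping.lookup F m))"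

text \<open>
  A point of projective space over the algebraic closure is a one-dimensional linear subspace
  of the coordinate space, so \<open>x \<in> p\<close> with \<open>x \<noteq> 0\<close> says that \<open>x\<close> is a vector of homogeneous
  coordinates of \<open>p\<close>.
\<close>

definition proj_space :: "('a::field alg_closure ^ 'n::finite) set set" where
  "proj_space = {p. vec.subspace p \<and> vec.dim p = 1}"

text \<open>
  The zero vector lies in every point, but for homogeneous \<open>F\<close> it does not affect the
  condition below.
\<close>

definition proj_zeros ::
    "('n::finite, 'a::field) mpoly \<Rightarrow> ('a alg_closure ^ 'n) set set" where
  "proj_zeros F = {p \<in> proj_space. \<forall>x\<in>p. eval_mpoly F x = 0}"

text \<open>The points that have homogeneous coordinates in the ground field.\<close>

definition rational_points ::
    "('a::field alg_closure ^ 'n::finite) set set \<Rightarrow> ('a alg_closure ^ 'n) set set" where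
  "rational_points Y = {p \<in> Y. \<exists>v :: 'a ^ 'n. v \<noteq> 0 \<and> p = vec.span {\<chi> i. to_ac (v $ i)}}"

text \<open>
  The projective linear subspaces of vector-space dimension \<open>k\<close> (lines for \<open>k = 2\<close>, planes for
  \<open>k = 3\<close>), as sets of points, that are defined over the ground field, i.e. are cut out by
  linear forms with coefficients in the ground field.
\<close>

definition rational_proj_subspace ::
    "nat \<Rightarrow> ('a::field alg_closure ^ 'n::finite) set set \<Rightarrow> bool" where
  "rational_proj_subspace k Y \<longleftrightarrow>
     (\<exists>E :: ('a ^ 'n) set. \<exists>W.
        W = {x. \<forall>l\<in>E. (\<Sum>i\<in>UNIV. to_ac (l $ i) * x $ i) = 0} \<and>
        vec.dim W = k \<and> Y = {p \<in> proj_space. p \<subseteq> W})"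

text \<open>
  The projective tangent space at a point \<open>p\<close> of the hypersurface with equation \<open>G\<close>. It is the
  whole space if \<open>p\<close> is a singular point of the equation.
\<close>

definition tangent_space ::
    "('n::finite, 'a::field) mpoly \<Rightarrow> ('a alg_closure ^ 'n) set \<Rightarrow> ('a alg_closure ^ 'n) set set"
  where
  "tangent_space G p =
     {r \<in> proj_space. \<forall>x\<in>p. \<forall>y\<in>r. (\<Sum>i\<in>UNIV. eval_mpoly (partial_deriv i G) x * y $ i) = 0}"

definition tangent_plane ::
    "('n::finite, 'a::field) mpoly \<Rightarrow> ('a alg_closure ^ 'n) set set \<Rightarrow> bool" where
  "tangent_plane G H \<longleftrightarrow>
     rational_proj_subspace 3 H \<and> (\<exists>p \<in> proj_zeros G. H = tangent_space G p)"

definition secant_line ::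
    "nat \<Rightarrow> ('n::finite, 'a::field) mpoly \<Rightarrow> ('a alg_closure ^ 'n) set set \<Rightarrow> bool" where
  "secant_line q G L \<longleftrightarrow>
     rational_proj_subspace 2 L \<and> card (L \<inter> proj_zeros G) = q + 1"

definition hermitian_matrix :: "nat \<Rightarrow> 'a::field ^ 'n ^ 'n::finite \<Rightarrow> bool" where
  "hermitian_matrix q A \<longleftrightarrow> A \<noteq> 0 \<and> transpose A = (\<chi> i j. (A $ i $ j) ^ q)"

text \<open>The polynomial \<open>x\<^sup>T A x\<^sup>(\<^sup>q\<^sup>)\<close>, i.e. the sum of the monomials \<open>a\<^sub>i\<^sub>j x\<^sub>i x\<^sub>j\<^sup>q\<close>.\<close>

definition hermitian_poly :: "nat \<Rightarrow> 'a::field ^ 'n ^ 'n::finite \<Rightarrow> ('n, 'a) mpoly" where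
  "hermitian_poly q A =
     (\<Sum>i\<in>UNIV. \<Sum>j\<in>UNIV.
        Poly_Mapping.single (Poly_Mapping.single i 1 + Poly_Mapping.single j q) (A $ i $ j))"

lemma eval_mpoly_superset:
  assumes "finite S" "Poly_Mapping.keys F \<subseteq> S"
  shows "eval_mpoly F x =
    (\<Sum>m\<in>S. to_ac (Poly_Mapping.lookup F m) * (\<Prod>i\<in>UNIV. (x $ i) ^ Poly_Mapping.lookup m i))"
  unfolding eval_mpoly_def using assms
  by (intro sum.mono_neutral_left) (auto simp: in_keys_iff)

lemma eval_mpoly_add: "eval_mpoly (F + G) x = eval_mpoly F x + eval_mpoly G x"
proof -
  let ?S = "Poly_Mapping.keys F \<union> Poly_Mapping.keys G"
  have "Poly_Mapping.keys (F + G) \<subseteq> ?S"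
    by (rule Poly_Mapping.keys_add)
  then show ?thesis
    by (simp add: eval_mpoly_superset[of ?S] lookup_add distrib_right sum.distrib)
qed

lemma eval_mpoly_0: "eval_mpoly 0 x = 0"
  by (simp add: eval_mpoly_def)

lemma eval_mpoly_sum: "eval_mpoly (\<Sum>i\<in>I. F i) x = (\<Sum>i\<in>I. eval_mpoly (F i) x)"
  by (induction I rule: infinite_finite_induct) (auto simp: eval_mpoly_add eval_mpoly_0)

lemma eval_mpoly_single:
  "eval_mpoly (Poly_Mapping.single m c) x =
     to_ac c * (\<Prod>i\<in>UNIV. (x $ i) ^ Poly_Mapping.lookup m i)"
  by (simp add: eval_mpoly_superset[of "{m}"])

lemma prod_power_single:
  fixes x :: "'b::comm_semiring_1 ^ 'n::finite"
  shows "(\<Prod>k\<in>UNIV. (x $ k) ^ Poly_Mapping.lookup (Poly_Mapping.single i e) k) = (x $ i) ^ e"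
proof -
  have "(\<Prod>k\<in>UNIV. (x $ k) ^ Poly_Mapping.lookup (Poly_Mapping.single i e) k) =
        (\<Prod>k\<in>UNIV. if k = i then (x $ i) ^ e else 1)"
    by (intro prod.cong) (auto simp: lookup_single when_def)
  then show ?thesis by simp
qed

lemma eval_hermitian_poly:
  "eval_mpoly (hermitian_poly q A) x =
     (\<Sum>i\<in>UNIV. \<Sum>j\<in>UNIV. x $ i * to_ac (A $ i $ j) * (x $ j) ^ q)"
  by (simp add: hermitian_poly_def eval_mpoly_sum eval_mpoly_single lookup_add power_add
      prod.distrib prod_power_single mult_ac del: One_nat_def)

end

theory Submission
  imports Defs "HOL-Number_Theory.Residues"
begin

hide_const (open) Polynomials.degree up_ring.monom up_ring.coeff module.smult Divisibility.prime
  Coset.order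

text \<open>
  The bound can be read off from a single generator (a line on \<open>V\<^sub>2\<close> over the ground field) that is
  contained in \<open>V(F)\<close>; without such a generator the count is smaller. The planes through a generator
  \<open>\<ell>\<close> are the tangent planes at its \<open>q\<^sup>2 + 1\<close> points \<open>P\<close>, so the points of \<open>V\<^sub>2\<close> off \<open>\<ell>\<close> are
  partitioned by the \<open>q\<close> further generators through each \<open>P\<close>. Let \<open>e\<close> be the multiplicity of \<open>V(F)\<close>
  along \<open>\<ell>\<close> and let \<open>j(P)\<close> be the number of these further generators that lie in \<open>V(F)\<close>. Restricting \<open>F\<close>
  to the tangent plane at \<open>P\<close>, where it has multiplicity at least \<open>e + j(P)\<close> at \<open>P\<close>, shows that each
  of the other generators contains at most \<open>d - e - j(P)\<close> zeros apart from \<open>P\<close>. On the other hand the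
  leading form of \<open>F\<close> along \<open>\<ell>\<close>, evaluated in the direction of the tangent plane at \<open>P\<close>, is a nonzero form
  of degree \<open>d - e + q e\<close> on \<open>\<ell>\<close> that vanishes at \<open>P\<close> to order \<open>j(P)\<close>, so that
  \<open>\<Sum>\<^sub>P j(P) \<le> d - e + q e\<close>. Maximising under this constraint gives the bound.

  Equality forces \<open>e = 1\<close>, exactly one \<open>P\<close> on \<open>\<ell>\<close> with \<open>j(P) = q\<close> (its tangent plane is a component of
  \<open>V(F)\<close>) and, if \<open>d \<ge> 2\<close>, exactly one \<open>R\<close> on \<open>\<ell>\<close> with \<open>j(R) = d - 1\<close>. The \<open>d\<close> generators through \<open>R\<close>
  in \<open>V(F)\<close> yield \<open>d\<close> tangent planes through \<open>R\<close>, so these are all the components of \<open>V(F)\<close>; doing this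
  for two generators in one of the planes gives two points spanning a common secant line.
\<close>


section \<open>Finite fields of square order\<close>

text \<open>The leading form of F along the generator has degree d - e in the coordinates of the
  generator and e in the transversal ones; the direction of the tangent plane at the parameter s is
  (1, -s^q), so its evaluation has degree at most d - e + q e. A monomial with exponents a and b
  becomes s^(a + q b) with a <= d - e < q, hence nothing cancels: this is the role of d <= q. The
  counting uses an affine parameter on the generator. The point left over is chosen with j = 0,
  which the same degree bound makes possible; its other generators then carry at most q (d - e)
  further zeros, and the bound on the sum over the affine points suffices. With m = d - e, f points
  with j = q and slack t in the bound on the sum of the j(P), the claimed maximum exceeds the
  estimate by q (e - f)(q - m) + q (e - 1)(m + q - 1) + (q^2 - q) t + D, where D is the sum of j (m
  - j) over the other points. Every summand is nonnegative, and each condition for equality is the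
  vanishing of one of them.\<close>

lemma card_eq_card_kernel_mult_range:
  fixes f :: "'b::finite \<Rightarrow> 'c"
  assumes "\<And>x. card {y. f y = f x} = k"
  shows "CARD('b) = k * card (range f)"
proof -
  have "CARD('b) = (\<Sum>z\<in>range f. card {y \<in> UNIV. f y = z})"
    using sum.group[of UNIV "range f" f "\<lambda>_. 1::nat"] by simp
  also have "\<dots> = (\<Sum>z\<in>range f. k)"
    using assms by (intro sum.cong) auto
  finally show ?thesis by simp
qed

lemma card_poly_zeros_le:
  fixes p :: "'b::idom poly"
  assumes "p \<noteq> 0" "\<And>x. x \<in> M \<Longrightarrow> poly p x = 0"
  shows "card M \<le> degree p"
proof -
  have "card M \<le> card {x. poly p x = 0}"
    using assms by (intro card_mono poly_roots_finite) auto
  also have "\<dots> \<le> degree p"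
    using assms by (intro card_poly_roots_bound) auto
  finally show ?thesis .
qed

locale hermitian_field =
  fixes q :: nat and ground :: "'a::{field,finite} itself"
  assumes primepow_q: "primepow q" and card_field: "CARD('a) = q ^ 2"
begin

lemma q_ge_2: "q \<ge> 2"
  using primepow_gt_Suc_0[OF primepow_q] by simp

lemma prime_CHAR: "prime CHAR('a)"
  using prime_CHAR_semidom[where ?'a = 'a] finite_imp_CHAR_pos[where ?'a = 'a] by simp

lemma q_eq_CHAR_power: "\<exists>k>0. q = CHAR('a) ^ k"
proof -
  obtain p k where pk: "prime p" "k > 0" "q = p ^ k"
    using primepow_q unfolding primepow_def by blast
  have "CHAR('a) dvd q ^ 2"
    using CHAR_dvd_CARD[where ?'a = 'a] card_field by simp
  hence "CHAR('a) dvd p"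
    using pk prime_CHAR by (metis prime_dvd_power_nat)
  hence "CHAR('a) = p"
    using pk prime_CHAR by (simp add: primes_dvd_imp_eq)
  thus ?thesis using pk by blast
qed

text \<open>Like its companions below it is stated for any ring of the same characteristic, since
  the q-power map is also needed on polynomials over the field and on its algebraic closure.\<close>

lemma add_power_q:
  fixes x y :: "'b::comm_semiring_1"
  assumes "CHAR('b) = CHAR('a)"
  shows "(x + y) ^ q = x ^ q + y ^ q"
  using q_eq_CHAR_power prime_CHAR freshmans_dream'[where ?'a = 'b] assms by metis

lemma diff_power_q:
  fixes x y :: "'b::comm_ring_1"
  assumes "CHAR('b) = CHAR('a)"
  shows "(x - y) ^ q = x ^ q - y ^ q"
  using add_power_q[OF assms, of "x - y" y] by (simp add: algebra_simps)

lemma sum_power_q: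
  fixes f :: "'i \<Rightarrow> 'b::comm_semiring_1"
  assumes "CHAR('b) = CHAR('a)"
  shows "(\<Sum>i\<in>I. f i) ^ q = (\<Sum>i\<in>I. f i ^ q)"
  using q_eq_CHAR_power prime_CHAR freshmans_dream_sum'[where ?'a = 'b] assms by metis

lemma minus_power_q:
  fixes x :: "'b::comm_ring_1"
  assumes "CHAR('b) = CHAR('a)"
  shows "(- x) ^ q = - (x ^ q)"
  using diff_power_q[OF assms, of 0 x] q_ge_2 by (simp add: power_0_left)

lemma power_q_eq_iff:
  fixes x y :: "'b::idom"
  assumes "CHAR('b) = CHAR('a)"
  shows "x ^ q = y ^ q \<longleftrightarrow> x = y"
  using diff_power_q[OF assms, of x y] q_ge_2 by auto

lemma of_nat_q_eq_0:
  assumes "CHAR('b::semiring_1) = CHAR('a)"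
  shows "(of_nat q :: 'b) = 0"
  using q_eq_CHAR_power assms by (auto simp: of_nat_eq_0_iff_char_dvd dvd_power)

lemmas add_pow_q = add_power_q[where ?'b = 'a, OF refl]
lemmas diff_pow_q = diff_power_q[where ?'b = 'a, OF refl]
lemmas sum_pow_q = sum_power_q[where ?'b = 'a, OF refl]
lemmas minus_pow_q = minus_power_q[where ?'b = 'a, OF refl]
lemmas pow_q_eq_iff = power_q_eq_iff[where ?'b = 'a, OF refl]

text \<open>Multiplication by a nonzero x permutes the nonzero elements; comparing their products
  gives \<open>x ^ (CARD('a) - 1) = 1\<close>.\<close>

lemma power_card_field:
  fixes x :: 'a
  shows "x ^ (q ^ 2) = x"
proof (cases "x = 0")
  case False
  have "(\<Prod>y\<in>UNIV - {0}. x * y) = (\<Prod>y\<in>UNIV - {0}. y)"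
    by (rule prod.reindex_bij_witness[of _ "\<lambda>y. y / x" "\<lambda>y. x * y"]) (use False in auto)
  hence "x ^ (CARD('a) - 1) * \<Prod>(UNIV - {0}) = \<Prod>(UNIV - {0})"
    by (simp add: prod.distrib card_Diff_singleton)
  hence "x ^ (CARD('a) - 1) = 1"
    by simp
  moreover have "q ^ 2 = Suc (CARD('a) - 1)"
    using card_field q_ge_2 by simp
  ultimately show ?thesis
    by (metis mult.right_neutral power_Suc)
qed (use q_ge_2 in auto)

lemma pow_q_pow_q [simp]: "((x::'a) ^ q) ^ q = x"
  using power_card_field[of x] by (simp add: power2_eq_square power_mult)

lemma ex_power_q_eq: "\<exists>x::'a. x ^ q = y"
  by (rule exI[of _ "y ^ q"]) simp

text \<open>The kernel of the trace from F_{q^2} to F_q. Its q elements label the further generators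
  through each point of the chosen generator.\<close>

definition W :: "'a set" where "W = {w. w ^ q + w = 0}"

lemma W_iff: "w \<in> W \<longleftrightarrow> w ^ q = - w"
  unfolding W_def by (simp add: eq_neg_iff_add_eq_0)

text \<open>General in the ring so that it also applies in the algebraic closure, where it shows
  that \<open>t ^ q + t\<close> has no roots beyond \<open>W\<close>.\<close>

lemma W_root_bound:
  fixes M :: "'b::idom set"
  assumes "\<And>w. w \<in> M \<Longrightarrow> w ^ q + w = 0"
  shows "card M \<le> q"
proof -
  let ?p = "monom 1 q + monom 1 1 :: 'b poly"
  have deg: "degree ?p = q"
    using q_ge_2 by (subst degree_add_eq_left) (auto simp: degree_monom_eq)
  hence "?p \<noteq> 0"
    using q_ge_2 by auto
  hence "card M \<le> degree ?p"
    by (rule card_poly_zeros_le) (use assms in \<open>auto simp: poly_monom\<close>)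
  with deg show ?thesis by simp
qed

lemma subfield_card_le: "card {y::'a. y ^ q = y} \<le> q"
proof -
  let ?p = "monom 1 q + monom (- 1) 1 :: 'a poly"
  have deg: "degree ?p = q"
    using q_ge_2 by (subst degree_add_eq_left) (auto simp: degree_monom_eq)
  hence "?p \<noteq> 0"
    using q_ge_2 by auto
  hence "card {y::'a. y ^ q = y} \<le> degree ?p"
    by (rule card_poly_zeros_le) (auto simp: poly_monom)
  with deg show ?thesis by simp
qed

text \<open>The trace is additive, so its fibres are translates of \<open>W\<close>.\<close>

lemma trace_kernel_range: "q ^ 2 = card W * card (range (\<lambda>x::'a. x ^ q + x))"
proof -
  have "card {y. y ^ q + y = x ^ q + x} = card W" for x :: 'a
    by (rule bij_betw_same_card[of "\<lambda>y. y - x"],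
        rule bij_betwI[where g = "\<lambda>w. w + x"])
       (auto simp: W_def diff_pow_q add_pow_q algebra_simps)
  from card_eq_card_kernel_mult_range[of "\<lambda>x::'a. x ^ q + x", OF this]
  show ?thesis by (simp add: card_field)
qed

lemma range_trace_subset: "range (\<lambda>x::'a. x ^ q + x) \<subseteq> {y. y ^ q = y}"
  by (auto simp: add_pow_q add_ac)

lemma card_range_trace_le: "card (range (\<lambda>x::'a. x ^ q + x)) \<le> q"
  using card_mono[OF _ range_trace_subset] subfield_card_le by (meson finite le_trans)

text \<open>Root counting allows at most q elements for both the kernel and the image of the trace,
  and the product of the two sizes is q^2.\<close>

lemma card_W: "card W = q"
proof (rule antisym)
  show "card W \<le> q"
    by (rule W_root_bound) (simp add: W_def)
  have "q * q \<le> card W * q"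
    using trace_kernel_range mult_le_mono2[OF card_range_trace_le, of "card W"]
    by (simp add: power2_eq_square)
  thus "q \<le> card W"
    using q_ge_2 by simp
qed

text \<open>The image of the trace has q^2 / q elements, already the largest possible size of the
  fixed field of the q-power map.\<close>

lemma ex_trace:
  assumes "y ^ q = (y::'a)"
  shows "\<exists>x. x ^ q + x = y"
proof -
  have "card (range (\<lambda>x::'a. x ^ q + x)) = q"
    using trace_kernel_range q_ge_2 by (simp add: card_W power2_eq_square)
  hence "card (range (\<lambda>x::'a. x ^ q + x)) = card {y::'a. y ^ q = y}"
    using subfield_card_le card_mono[OF _ range_trace_subset] by (intro antisym) auto
  hence "range (\<lambda>x::'a. x ^ q + x) = {y. y ^ q = y}"
    by (intro card_subset_eq range_trace_subset) auto
  hence "y \<in> range (\<lambda>x::'a. x ^ q + x)"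
    using assms by (simp only: mem_Collect_eq)
  thus ?thesis
    by auto
qed

text \<open>The multiplicative analogue: the nonzero fibres of the norm are cosets of its kernel
  \<open>U\<close>, and \<open>card U <= q + 1\<close> leaves at least q - 1 nonzero norms, which
  together with 0 exhaust the fixed field.\<close>

lemma ex_norm:
  assumes "y ^ q = (y::'a)"
  shows "\<exists>x. x * x ^ q = y"
proof -
  let ?N = "\<lambda>x::'a. x * x ^ q"
  define U where "U = {x::'a. ?N x = 1}"
  have sub: "range ?N \<subseteq> {y. y ^ q = y}"
    by (auto simp: power_mult_distrib mult_ac)
  have U: "card U \<le> q + 1"
  proof -
    let ?p = "monom 1 (q + 1) + monom (- 1) 0 :: 'a poly"
    have deg: "degree ?p = q + 1"
      by (subst degree_add_eq_left) (auto simp: degree_monom_eq)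
    hence "?p \<noteq> 0" by auto
    hence "card U \<le> degree ?p"
      by (rule card_poly_zeros_le) (auto simp: poly_monom U_def)
    with deg show ?thesis by simp
  qed
  have N0: "?N x = 0 \<longleftrightarrow> x = 0" for x
    using q_ge_2 by auto
  have fibre: "card {y. ?N y = ?N x} = card U" if "x \<noteq> 0" for x
  proof (rule bij_betw_same_card[of "\<lambda>y. y / x"], rule bij_betwI[where g = "\<lambda>w. w * x"])
    have "?N (w * x) = ?N w * ?N x" for w
      by (simp add: power_mult_distrib)
    thus "(\<lambda>w. w * x) \<in> U \<rightarrow> {y. ?N y = ?N x}"
      by (simp only: U_def Pi_def mem_Collect_eq) simp
    have "?N (y / x) = ?N y / ?N x" for y
      by (simp add: power_divide)
    thus "(\<lambda>y. y / x) \<in> {y. ?N y = ?N x} \<rightarrow> U"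
      using that N0[of x] by (simp only: U_def Pi_def mem_Collect_eq) simp
  qed (use that in auto)
  have zero: "0 \<in> range ?N"
    by (rule image_eqI[of _ _ 0]) auto
  have "q ^ 2 = (\<Sum>z\<in>range ?N. card {y \<in> UNIV. ?N y = z})"
    using sum.group[of UNIV "range ?N" ?N "\<lambda>_. 1::nat"] card_field by simp
  also have "\<dots> = card {y \<in> UNIV. ?N y = 0} + (\<Sum>z\<in>range ?N - {0}. card {y \<in> UNIV. ?N y = z})"
    by (rule sum.remove[OF _ zero]) simp
  also have "card {y \<in> UNIV. ?N y = 0} = 1"
    by (simp only: N0) simp
  also have "(\<Sum>z\<in>range ?N - {0}. card {y \<in> UNIV. ?N y = z}) = (\<Sum>z\<in>range ?N - {0}. card U)"
  proof (rule sum.cong)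
    fix z assume "z \<in> range ?N - {0}"
    then obtain x where "z = ?N x" "x \<noteq> 0"
      using N0 by auto
    thus "card {y \<in> UNIV. ?N y = z} = card U"
      using fibre by simp
  qed simp
  finally have 1: "q ^ 2 = 1 + card (range ?N - {0}) * card U"
    by simp
  have "(q - 1) * (q + 1) = q ^ 2 - 1"
    by (simp add: algebra_simps power2_eq_square)
  hence "(q - 1) * (q + 1) \<le> card (range ?N - {0}) * (q + 1)"
    using 1 mult_le_mono2[OF U, of "card (range ?N - {0})"] by simp
  hence "q - 1 \<le> card (range ?N - {0})"
    by (rule mult_right_le_imp_le) simp
  moreover have "card (range ?N - {0}) = card (range ?N) - 1"
    using zero by (rule card_Diff_singleton)
  moreover have "card (range ?N) > 0"
    by (simp add: card_gt_0_iff)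
  ultimately have "q \<le> card (range ?N)"
    by simp
  hence "card (range ?N) = card {y::'a. y ^ q = y}"
    using subfield_card_le card_mono[OF _ sub] by (intro antisym) auto
  hence "range ?N = {y. y ^ q = y}"
    by (intro card_subset_eq sub) auto
  hence "y \<in> range ?N"
    using assms by (simp only: mem_Collect_eq)
  thus ?thesis
    by (auto)
qed

end

section \<open>Quaternary forms on a Hermitian surface in normal form\<close>

lemma sum_order_le_degree:
  fixes p :: "'b::{idom,finite} poly"
  assumes "p \<noteq> 0"
  shows "(\<Sum>x\<in>UNIV. order x p) \<le> degree p"
proof -
  have "(\<Sum>x\<in>UNIV. order x p) = (\<Sum>x\<in>set_mset (proots p). count (proots p) x)"
    using assms by (intro sum.mono_neutral_cong_right) (simp_all add: order_0I)
  also have "\<dots> = size (proots p)"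
    by (simp add: size_multiset_overloaded_eq)
  also have "\<dots> \<le> degree p"
    by (rule size_proots_le)
  finally show ?thesis .
qed

lemma pcompose_monom_1:
  fixes p :: "'b::comm_semiring_1 poly"
  shows "pcompose (monom 1 n) p = p ^ n"
  by (induction n) (simp_all add: monom_0 monom_Suc pcompose_pCons pcompose_1)

text \<open>The form is an abstract family of monomials, which keeps the counting independent of the
  encoding of multivariate polynomials. Injectivity of the exponent vector excludes cancellation
  between members of the family.\<close>

locale quaternary_form = hermitian_field q ground
  for q and ground :: "'a::{field,finite} itself" +
  fixes d :: nat and S :: "'k set" and k1 k2 k3 k4 :: "'k \<Rightarrow> nat" and co :: "'k \<Rightarrow> 'a"
  assumes finite_S: "finite S" and S_nonempty: "S \<noteq> {}"
    and inj_exponents: "inj_on (\<lambda>\<kappa>. (k1 \<kappa>, k2 \<kappa>, k3 \<kappa>, k4 \<kappa>)) S"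
    and degree_S: "\<And>\<kappa>. \<kappa> \<in> S \<Longrightarrow> k1 \<kappa> + k2 \<kappa> + k3 \<kappa> + k4 \<kappa> = d"
    and co_nonzero: "\<And>\<kappa>. \<kappa> \<in> S \<Longrightarrow> co \<kappa> \<noteq> 0"
    and d_le_q: "d \<le> q"
begin

definition g :: "'a \<Rightarrow> 'a \<Rightarrow> 'a \<Rightarrow> 'a \<Rightarrow> 'a" where
  "g y1 y2 y3 y4 = (\<Sum>\<kappa>\<in>S. co \<kappa> * y1 ^ k1 \<kappa> * y2 ^ k2 \<kappa> * y3 ^ k3 \<kappa> * y4 ^ k4 \<kappa>)"

text \<open>\<open>e\<close> is the multiplicity of the surface \<open>g = 0\<close> along the line \<open>y3 = y4 = 0\<close>. Besides this line,
  the generators through \<open>(s, 1, 0, 0)\<close> of the Hermitian surface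
  \<open>y1 y3\<^sup>q + y3 y1\<^sup>q + y2 y4\<^sup>q + y4 y2\<^sup>q = 0\<close> are those through \<open>(w, 0, 1, - s\<^sup>q)\<close> with \<open>w \<in> W\<close>, and
  those through \<open>(1, 0, 0, 0)\<close> are the ones through \<open>(0, w, 0, 1)\<close>. Both kinds are parametrised by
  \<open>r\<close>, leaving out the point on the line.\<close>

definition e :: nat where "e = Min ((\<lambda>\<kappa>. k3 \<kappa> + k4 \<kappa>) ` S)"

text \<open>The leading form along the line has bidegree \<open>(m, e)\<close>: \<open>m\<close> in
  the coordinates of the line, \<open>e\<close> in the transversal ones.\<close>

definition m :: nat where "m = d - e"

definition gen_zeros :: "'a \<Rightarrow> 'a \<Rightarrow> 'a set" where
  "gen_zeros s w = {r. g (w + r * s) r 1 (- (s ^ q)) = 0}"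

definition inf_zeros :: "'a \<Rightarrow> 'a set" where
  "inf_zeros w = {r. g r w 0 1 = 0}"

text \<open>The further generators through \<open>(s, 1, 0, 0)\<close> on which the form vanishes;
  \<open>card (J s)\<close> is the j(P) of the overview.\<close>

definition J :: "'a \<Rightarrow> 'a set" where
  "J s = {w \<in> W. gen_zeros s w = UNIV}"

lemma e_le: "\<kappa> \<in> S \<Longrightarrow> e \<le> k3 \<kappa> + k4 \<kappa>"
  unfolding e_def using finite_S by (intro Min_le) auto

lemma e_attained: "\<exists>\<kappa>\<in>S. k3 \<kappa> + k4 \<kappa> = e"
proof -
  have "e \<in> (\<lambda>\<kappa>. k3 \<kappa> + k4 \<kappa>) ` S"
    unfolding e_def using finite_S S_nonempty by (intro Min_in) auto
  thus ?thesis by auto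
qed

lemma e_le_d: "e \<le> d"
  using e_attained degree_S by fastforce

lemma m_less: "m < q ^ 2"
  using d_le_q q_ge_2 by (simp add: m_def power2_eq_square)
    (metis One_nat_def Suc_1 Suc_le_lessD diff_le_self le_trans less_le_trans nat_mult_1 
      mult_less_mono1 not_le order.strict_trans1 zero_less_Suc)

text \<open>On the generator given by \<open>s\<close> and \<open>w\<close>, the coefficient of \<open>r ^ (m - k)\<close> in \<open>g\<close> is a polynomial
  \<open>\<beta> s k\<close> in \<open>w\<close> of degree at most \<open>k\<close>. Hence it is zero as soon as more than \<open>k\<close> of these
  generators lie on the surface.\<close>

definition \<beta>_term :: "'a \<Rightarrow> 'k \<Rightarrow> nat \<Rightarrow> 'a poly" where
  "\<beta>_term s \<kappa> k = (let n = k3 \<kappa> + k4 \<kappa> - e in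
     if n \<le> k then monom (co \<kappa> * (- (s ^ q)) ^ k4 \<kappa> * of_nat (k1 \<kappa> choose (k - n)) * s ^ (k1 \<kappa> - (k - n))) (k - n)
     else 0)"

definition \<beta> :: "'a \<Rightarrow> nat \<Rightarrow> 'a poly" where
  "\<beta> s k = (\<Sum>\<kappa>\<in>S. \<beta>_term s \<kappa> k)"

text \<open>Let n be the excess of \<open>k3 \<kappa> + k4 \<kappa>\<close> over \<open>e\<close>.
  In the binomial expansion of \<open>(w + r * s) ^ k1 \<kappa>\<close> the term with w^i carries r
  to the power k1 + k2 - i = m - (n + i), so it belongs to the index k = n + i.\<close>

lemma \<beta>_term_expansion:
  assumes "\<kappa> \<in> S"
  shows "co \<kappa> * (w + r * s) ^ k1 \<kappa> * r ^ k2 \<kappa> * 1 ^ k3 \<kappa> * (- (s ^ q)) ^ k4 \<kappa> =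
    (\<Sum>k\<le>m. poly (\<beta>_term s \<kappa> k) w * r ^ (m - k))"
proof -
  define n where "n = k3 \<kappa> + k4 \<kappa> - e"
  let ?C = "co \<kappa> * (- (s ^ q)) ^ k4 \<kappa>"
  have m: "m = n + k1 \<kappa> + k2 \<kappa>"
    using e_le[OF assms] degree_S[OF assms] by (simp add: m_def n_def)
  have "(\<Sum>k\<le>m. poly (\<beta>_term s \<kappa> k) w * r ^ (m - k)) =
        (\<Sum>k\<in>(\<lambda>i. n + i) ` {..k1 \<kappa>}. poly (\<beta>_term s \<kappa> k) w * r ^ (m - k))"
  proof (rule sum.mono_neutral_right)
    show "\<forall>k\<in>{..m} - (\<lambda>i. n + i) ` {..k1 \<kappa>}. poly (\<beta>_term s \<kappa> k) w * r ^ (m - k) = 0"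
    proof
      fix k assume k: "k \<in> {..m} - (\<lambda>i. n + i) ` {..k1 \<kappa>}"
      have "k - n > k1 \<kappa>" if "n \<le> k"
      proof (rule ccontr)
        assume "\<not> k - n > k1 \<kappa>"
        hence "k \<in> (\<lambda>i. n + i) ` {..k1 \<kappa>}"
          using that by (intro image_eqI[of _ _ "k - n"]) auto
        with k show False by simp
      qed
      thus "poly (\<beta>_term s \<kappa> k) w * r ^ (m - k) = 0"
        by (auto simp: \<beta>_term_def n_def [symmetric] binomial_eq_0 poly_monom)
    qed
  qed (auto simp: m)
  also have "\<dots> = (\<Sum>i\<le>k1 \<kappa>. poly (\<beta>_term s \<kappa> (n + i)) w * r ^ (m - (n + i)))"
    by (subst sum.reindex) auto
  also have "\<dots> = (\<Sum>i\<le>k1 \<kappa>. ?C * r ^ k2 \<kappa> * (of_nat (k1 \<kappa> choose i) * w ^ i * (r * s) ^ (k1 \<kappa> - i)))"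
  proof (rule sum.cong)
    fix i assume "i \<in> {..k1 \<kappa>}"
    hence "m - (n + i) = (k1 \<kappa> - i) + k2 \<kappa>"
      by (simp add: m)
    thus "poly (\<beta>_term s \<kappa> (n + i)) w * r ^ (m - (n + i)) =
      ?C * r ^ k2 \<kappa> * (of_nat (k1 \<kappa> choose i) * w ^ i * (r * s) ^ (k1 \<kappa> - i))"
      by (simp add: \<beta>_term_def n_def [symmetric] poly_monom power_add power_mult_distrib mult_ac)
  qed simp
  also have "\<dots> = ?C * r ^ k2 \<kappa> * (w + r * s) ^ k1 \<kappa>"
    by (simp add: binomial_ring sum_distrib_left)
  finally show ?thesis by (simp add: mult_ac)
qed

lemma g_on_generator: "g (w + r * s) r 1 (- (s ^ q)) = (\<Sum>k\<le>m. poly (\<beta> s k) w * r ^ (m - k))"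
  unfolding g_def \<beta>_def poly_sum sum_distrib_right
  by (subst sum.swap) (simp only: \<beta>_term_expansion cong: sum.cong)

lemma degree_\<beta>: "degree (\<beta> s k) \<le> k"
  unfolding \<beta>_def
proof (rule degree_sum_le[OF finite_S])
  fix \<kappa>
  show "degree (\<beta>_term s \<kappa> k) \<le> k"
    by (auto simp: \<beta>_term_def Let_def intro: order.trans[OF degree_monom_le])
qed

text \<open>The degree in r is at most \<open>m\<close> and not merely \<open>d\<close>: the omitted
  point of the generator, at r = infinity, lies on the line and absorbs multiplicity
  \<open>e\<close>.\<close>

definition gen_poly :: "'a \<Rightarrow> 'a \<Rightarrow> 'a poly" where
  "gen_poly s w = (\<Sum>k\<le>m. monom (poly (\<beta> s k) w) (m - k))"

lemma poly_gen_poly: "poly (gen_poly s w) r = g (w + r * s) r 1 (- (s ^ q))"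
  by (simp add: gen_poly_def poly_sum poly_monom g_on_generator)

lemma coeff_gen_poly:
  assumes "k \<le> m"
  shows "coeff (gen_poly s w) (m - k) = poly (\<beta> s k) w"
proof -
  have "coeff (gen_poly s w) (m - k) = (\<Sum>i\<le>m. if i = k then poly (\<beta> s i) w else 0)"
    unfolding gen_poly_def coeff_sum using assms
    by (intro sum.cong) (auto simp: coeff_monom)
  thus ?thesis using assms by simp
qed

lemma degree_gen_poly_le:
  assumes "\<And>k. k \<le> m \<Longrightarrow> k < j \<Longrightarrow> poly (\<beta> s k) w = 0"
  shows "degree (gen_poly s w) \<le> m - j"
  unfolding gen_poly_def
proof (rule degree_sum_le)
  fix k assume k: "k \<in> {..m}"
  show "degree (monom (poly (\<beta> s k) w) (m - k)) \<le> m - j"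
  proof (cases "k < j")
    case True
    with k assms show ?thesis by simp
  next
    case False
    with k show ?thesis
      by (intro order.trans[OF degree_monom_le]) auto
  qed
qed simp

text \<open>A polynomial of degree at most m < q^2 that vanishes on the whole field is zero.\<close>

lemma gen_zeros_UNIV_iff: "gen_zeros s w = UNIV \<longleftrightarrow> (\<forall>k\<le>m. poly (\<beta> s k) w = 0)"
proof
  assume "\<forall>k\<le>m. poly (\<beta> s k) w = 0"
  thus "gen_zeros s w = UNIV"
    by (simp add: gen_zeros_def g_on_generator)
next
  assume full: "gen_zeros s w = UNIV"
  have "gen_poly s w = 0"
  proof (rule ccontr)
    assume "gen_poly s w \<noteq> 0"
    hence "card (UNIV :: 'a set) \<le> degree (gen_poly s w)"
      by (rule card_poly_zeros_le) (use full in \<open>auto simp: poly_gen_poly gen_zeros_def\<close>)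
    also have "\<dots> \<le> m"
      using degree_gen_poly_le[of 0 s w] by simp
    finally show False
      using m_less card_field by simp
  qed
  thus "\<forall>k\<le>m. poly (\<beta> s k) w = 0"
    using coeff_gen_poly[of _ s w] by simp
qed

lemma \<beta>_eq_0:
  assumes "k \<le> m" "k < card (J s)"
  shows "\<beta> s k = 0"
proof (rule ccontr)
  assume "\<beta> s k \<noteq> 0"
  hence "card (J s) \<le> degree (\<beta> s k)"
    by (rule card_poly_zeros_le) (use assms in \<open>auto simp: J_def gen_zeros_UNIV_iff\<close>)
  with degree_\<beta>[of s k] assms show False by simp
qed

lemma J_subset: "J s \<subseteq> W"
  by (auto simp: J_def)

lemma card_J_le_q: "card (J s) \<le> q"
  using card_mono[OF _ J_subset] card_W by (metis finite)

text \<open>More than \<open>m\<close> generators make every coefficient \<open>\<beta> s k\<close>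
  vanish identically in w, and then all generators through the point lie on the surface.\<close>

lemma card_J_le_m:
  assumes "J s \<noteq> W"
  shows "card (J s) \<le> m"
proof (rule ccontr)
  assume "\<not> card (J s) \<le> m"
  hence "\<forall>k\<le>m. \<beta> s k = 0"
    using \<beta>_eq_0 by auto
  hence "J s = W"
    by (auto simp: J_def gen_zeros_UNIV_iff)
  with assms show False ..
qed

text \<open>The generators in \<open>J s\<close> kill the top \<open>card (J s)\<close> coefficients
  for every w at once, so the degree drops on the remaining generators as well.\<close>

lemma card_gen_zeros_le:
  assumes "w \<in> W - J s"
  shows "card (gen_zeros s w) \<le> m - card (J s)"
proof -
  have "gen_poly s w \<noteq> 0"
  proof
    assume "gen_poly s w = 0"
    hence "gen_zeros s w = UNIV"
      using poly_gen_poly[of s w] by (auto simp: gen_zeros_def)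
    with assms show False by (auto simp: J_def)
  qed
  hence "card (gen_zeros s w) \<le> degree (gen_poly s w)"
    by (rule card_poly_zeros_le) (auto simp: poly_gen_poly gen_zeros_def)
  also have "\<dots> \<le> m - card (J s)"
    by (rule degree_gen_poly_le) (simp add: \<beta>_eq_0)
  finally show ?thesis .
qed

text \<open>On the generators through \<open>(1, 0, 0, 0)\<close> the exponent of r is
  \<open>k1 \<kappa>\<close> alone, which is at most \<open>m\<close> because
  \<open>k3 \<kappa> + k4 \<kappa>\<close> is at least \<open>e\<close>.\<close>

lemma card_inf_zeros_le:
  assumes "inf_zeros w \<noteq> UNIV"
  shows "card (inf_zeros w) \<le> m"
proof -
  define p where "p = (\<Sum>\<kappa>\<in>S. monom (co \<kappa> * w ^ k2 \<kappa> * 0 ^ k3 \<kappa>) (k1 \<kappa>))"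
  have p: "poly p r = g r w 0 1" for r
    by (simp add: p_def poly_sum poly_monom g_def mult_ac)
  have "p \<noteq> 0"
    using assms p by (auto simp: inf_zeros_def)
  hence "card (inf_zeros w) \<le> degree p"
    by (rule card_poly_zeros_le) (auto simp: p inf_zeros_def)
  also have "\<dots> \<le> m"
    unfolding p_def
  proof (rule degree_sum_le[OF finite_S])
    fix \<kappa> assume "\<kappa> \<in> S"
    hence "k1 \<kappa> \<le> m"
      using e_le[of \<kappa>] degree_S[of \<kappa>] by (simp add: m_def)
    thus "degree (monom (co \<kappa> * w ^ k2 \<kappa> * 0 ^ k3 \<kappa>) (k1 \<kappa>)) \<le> m"
      by (intro order.trans[OF degree_monom_le])
  qed
  finally show ?thesis .
qed

text \<open>The leading form of \<open>g\<close> along the line, evaluated in the direction \<open>(1, - s\<^sup>q)\<close> of the tangent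
  plane of the Hermitian surface at \<open>(s, 1, 0, 0)\<close>. This direction is constant up to order \<open>q\<close> in
  \<open>s\<close>, which is why the vanishing of the \<open>\<beta> s k\<close> at a fixed \<open>s\<close> bounds the order of the zero.\<close>

definition S0 :: "'k set" where "S0 = {\<kappa>\<in>S. k3 \<kappa> + k4 \<kappa> = e}"

definition tangency_poly :: "'a poly" where
  "tangency_poly = (\<Sum>\<kappa>\<in>S0. smult (co \<kappa>)
     (monom 1 (k1 \<kappa>) * (- monom 1 q) ^ k4 \<kappa>))"

lemma tangency_term:
  "smult (co \<kappa>) (monom 1 (k1 \<kappa>) * (- monom 1 q) ^ k4 \<kappa>) =
   monom (co \<kappa> * (- 1) ^ k4 \<kappa>) (k1 \<kappa> + q * k4 \<kappa>)"
proof -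
  have "(- monom (1::'a) q) ^ k4 \<kappa> = monom ((- 1) ^ k4 \<kappa>) (q * k4 \<kappa>)"
    by (simp add: minus_monom monom_power mult_ac)
  thus ?thesis
    by (simp add: mult_monom smult_monom)
qed

lemma degree_tangency_poly: "degree tangency_poly \<le> m + q * e"
  unfolding tangency_poly_def
proof (rule degree_sum_le)
  fix \<kappa> assume "\<kappa> \<in> S0"
  hence "k1 \<kappa> \<le> m" "k4 \<kappa> \<le> e"
    using degree_S[of \<kappa>] by (auto simp: S0_def m_def)
  thus "degree (smult (co \<kappa>) (monom 1 (k1 \<kappa>) * (- monom 1 q) ^ k4 \<kappa>)) \<le> m + q * e"
    unfolding tangency_term by (intro order.trans[OF degree_monom_le] add_mono) auto
qed (simp add: S0_def finite_S)

text \<open>On \<open>S0\<close> the exponents k1 are at most m, and m < q by e >= 1 and d <= q. So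
  k1 is the lowest base-q digit of k1 + q * k4, and distinct monomials of the leading form remain
  distinct.\<close>

lemma tangency_poly_nonzero:
  assumes "e \<ge> 1"
  shows "tangency_poly \<noteq> 0"
proof -
  have mq: "m < q"
    using assms d_le_q q_ge_2 by (simp add: m_def)
  obtain \<kappa>0 where \<kappa>0: "\<kappa>0 \<in> S0"
    using e_attained by (auto simp: S0_def)
  have uniq: "\<kappa> = \<kappa>0" if "\<kappa> \<in> S0" "k1 \<kappa> + q * k4 \<kappa> = k1 \<kappa>0 + q * k4 \<kappa>0" for \<kappa>
  proof -
    have lt: "k1 \<kappa> < q" "k1 \<kappa>0 < q"
      using that(1) \<kappa>0 degree_S[of \<kappa>] degree_S[of \<kappa>0] mq by (auto simp: S0_def m_def)
    have "(k1 \<kappa> + q * k4 \<kappa>) mod q = (k1 \<kappa>0 + q * k4 \<kappa>0) mod q"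
      using that by simp
    hence "k1 \<kappa> = k1 \<kappa>0"
      using lt by simp
    moreover from this have "k4 \<kappa> = k4 \<kappa>0"
      using that q_ge_2 by simp
    ultimately have "(k1 \<kappa>, k2 \<kappa>, k3 \<kappa>, k4 \<kappa>) = (k1 \<kappa>0, k2 \<kappa>0, k3 \<kappa>0, k4 \<kappa>0)"
      using that(1) \<kappa>0 degree_S[of \<kappa>] degree_S[of \<kappa>0] by (auto simp: S0_def)
    thus ?thesis
      using inj_onD[OF inj_exponents] that(1) \<kappa>0 by (auto simp: S0_def)
  qed
  have "coeff tangency_poly (k1 \<kappa>0 + q * k4 \<kappa>0) =
        (\<Sum>\<kappa>\<in>S0. if \<kappa> = \<kappa>0 then co \<kappa> * (- 1) ^ k4 \<kappa> else 0)"
    unfolding tangency_poly_def tangency_term coeff_sum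
    using uniq by (intro sum.cong) (auto simp: coeff_monom)
  also have "\<dots> = co \<kappa>0 * (- 1) ^ k4 \<kappa>0"
    using \<kappa>0 finite_S by (simp add: S0_def)
  also have "\<dots> \<noteq> 0"
    using \<kappa>0 co_nonzero by (simp add: S0_def)
  finally show ?thesis by auto
qed

lemma root_power_dvd_tangency_poly:
  assumes "e \<ge> 1"
  shows "[:- s, 1:] ^ card (J s) dvd tangency_poly"
proof -
  define j where "j = card (J s)"
  \<comment> \<open>The leading form with the direction frozen at its value for the fixed s.\<close>
  define b where "b = (\<Sum>\<kappa>\<in>S0. smult (co \<kappa> * (- (s ^ q)) ^ k4 \<kappa>) (monom 1 (k1 \<kappa>)))"
  have j: "j \<le> q"
    using card_J_le_q by (simp add: j_def)
  have fin: "finite S0"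
    by (simp add: S0_def finite_S)
  \<comment> \<open>The k-th Taylor coefficient of \<open>b\<close> at s is the coefficient of w^k
    in \<open>\<beta> s k\<close>: the monomials outside \<open>S0\<close> contribute only lower
    powers of w there.\<close>
  have coeff0: "coeff (pcompose b [:s, 1:]) k = 0" if "k < j" for k
  proof (cases "k \<le> m")
    case True
    have other_terms: "coeff (\<beta>_term s \<kappa> k) k = 0" if "\<kappa> \<in> S - S0" for \<kappa>
      using that e_le[of \<kappa>] by (auto simp: \<beta>_term_def S0_def Let_def coeff_monom)
    have "coeff (pcompose b [:s, 1:]) k =
          (\<Sum>\<kappa>\<in>S0. co \<kappa> * (- (s ^ q)) ^ k4 \<kappa> * coeff ([:s, 1:] ^ k1 \<kappa>) k)"
      by (simp add: b_def pcompose_sum pcompose_smult pcompose_monom_1 coeff_sum)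
    also have "\<dots> = (\<Sum>\<kappa>\<in>S0. coeff (\<beta>_term s \<kappa> k) k)"
    proof (rule sum.cong)
      fix \<kappa> assume \<kappa>: "\<kappa> \<in> S0"
      have "coeff ([:s, 1:] ^ k1 \<kappa>) k = of_nat (k1 \<kappa> choose k) * s ^ (k1 \<kappa> - k)"
      proof (cases "k \<le> k1 \<kappa>")
        case True
        thus ?thesis by (simp add: coeff_linear_poly_power)
      next
        case False
        have "degree ([:s, 1:] ^ k1 \<kappa>) \<le> k1 \<kappa>"
          by (rule order.trans[OF degree_power_le]) simp
        with False show ?thesis by (simp add: coeff_eq_0 binomial_eq_0)
      qed
      thus "co \<kappa> * (- (s ^ q)) ^ k4 \<kappa> * coeff ([:s, 1:] ^ k1 \<kappa>) k = coeff (\<beta>_term s \<kappa> k) k"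
        using \<kappa> by (simp add: \<beta>_term_def S0_def Let_def mult_ac)
    qed simp
    also have "\<dots> = coeff (\<beta> s k) k"
      unfolding \<beta>_def coeff_sum using other_terms finite_S
      by (intro sum.mono_neutral_left) (auto simp: S0_def)
    also have "\<dots> = 0"
      using \<beta>_eq_0[OF True] that by (simp add: j_def)
    finally show ?thesis .
  next
    case False
    have "degree (pcompose b [:s, 1:]) \<le> m"
      unfolding degree_pcompose b_def
    proof (simp, rule degree_sum_le[OF fin])
      fix \<kappa> assume "\<kappa> \<in> S0"
      hence "k1 \<kappa> \<le> m"
        using degree_S[of \<kappa>] by (auto simp: S0_def m_def)
      thus "degree (smult (co \<kappa> * (- (s ^ q)) ^ k4 \<kappa>) (monom 1 (k1 \<kappa>))) \<le> m"
        by (intro order.trans[OF degree_smult_le] order.trans[OF degree_monom_le])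
    qed
    with False show ?thesis by (simp add: coeff_eq_0)
  qed
  have "monom 1 j dvd pcompose b [:s, 1:]"
    using coeff0 by (simp add: monom_1_dvd_iff')
  then obtain h where h: "pcompose b [:s, 1:] = monom 1 j * h"
    by (elim dvdE)
  have "b = pcompose (pcompose b [:s, 1:]) [:- s, 1:]"
    by (simp add: pcompose_assoc [symmetric] pcompose_pCons)
  also have "\<dots> = [:- s, 1:] ^ j * pcompose h [:- s, 1:]"
    unfolding h pcompose_mult by (simp add: pcompose_monom_1)
  finally have b_dvd: "[:- s, 1:] ^ j dvd b"
    by (metis dvd_triv_left)
  have "[:- s, 1:] ^ q = (monom 1 1 - [:s:]) ^ q"
    by (simp add: monom_altdef)
  also have "\<dots> = monom 1 q - [:s ^ q:]"
    by (subst diff_power_q) (simp_all add: monom_power poly_const_pow)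
  finally have lin: "[:- s, 1:] ^ q = monom 1 q - [:s ^ q:]" .
  have "tangency_poly - b = (\<Sum>\<kappa>\<in>S0. smult (co \<kappa>) (monom 1 (k1 \<kappa>) *
      ((- monom 1 q) ^ k4 \<kappa> - [:- (s ^ q):] ^ k4 \<kappa>)))"
    unfolding tangency_poly_def b_def sum_subtractf [symmetric]
    by (intro sum.cong refl) (simp add: algebra_simps poly_const_pow smult_diff_right)
  also have "[:- s, 1:] ^ j dvd \<dots>"
  proof (rule dvd_sum)
    fix \<kappa>
    have "[:- s, 1:] ^ j dvd [:- s, 1:] ^ q"
      using j by (rule le_imp_power_dvd)
    also have "[:- s, 1:] ^ q dvd (- monom 1 q - [:- (s ^ q):])"
      unfolding lin by (rule dvdI[of _ _ "- 1"]) simp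
    also have "\<dots> dvd (- monom 1 q) ^ k4 \<kappa> - [:- (s ^ q):] ^ k4 \<kappa>"
      by (subst power_diff_sumr2) (rule dvd_triv_left)
    finally show "[:- s, 1:] ^ j dvd smult (co \<kappa>) (monom 1 (k1 \<kappa>) *
      ((- monom 1 q) ^ k4 \<kappa> - [:- (s ^ q):] ^ k4 \<kappa>))"
      by (intro dvd_smult dvd_mult)
  qed
  finally have "[:- s, 1:] ^ j dvd (tangency_poly - b) + b"
    using b_dvd by (rule dvd_add)
  thus ?thesis by (simp add: j_def)
qed

lemma sum_card_J_le:
  assumes "e \<ge> 1"
  shows "(\<Sum>s\<in>UNIV. card (J s)) \<le> m + q * e"
proof -
  have "(\<Sum>s\<in>UNIV. card (J s)) \<le> (\<Sum>s\<in>UNIV. order s tangency_poly)"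
    using root_power_dvd_tangency_poly[OF assms] tangency_poly_nonzero[OF assms]
    by (intro sum_mono) (simp add: order_divides)
  also have "\<dots> \<le> degree tangency_poly"
    by (rule sum_order_le_degree[OF tangency_poly_nonzero[OF assms]])
  also have "\<dots> \<le> m + q * e"
    by (rule degree_tangency_poly)
  finally show ?thesis .
qed

end

section \<open>Counting along the planes through a generator\<close>

text \<open>The purely numerical part: \<open>j s\<close> stands for the number of further
  generators through s inside V(F), \<open>ct s\<close> for the zeros on all further generators
  through s, q^2 + 1 for the points of the line and q * m for the zeros on the generators at
  infinity.\<close>

lemma pencil_count:
  fixes q m e :: int and j ct :: "'s::finite \<Rightarrow> int"
  assumes q: "q \<ge> 2" and m: "0 \<le> m" "m < q" and e: "e \<ge> 1" and card: "int CARD('s) = q\<^sup>2"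
    and j0: "\<And>s. 0 \<le> j s"
    and full: "\<And>s. j s = q \<Longrightarrow> ct s = q ^ 3"
    and notfull: "\<And>s. j s \<noteq> q \<Longrightarrow> j s \<le> m \<and> ct s \<le> (q - j s) * (m - j s) + j s * q\<^sup>2"
    and sum_j: "(\<Sum>s\<in>UNIV. j s) \<le> m + q * e"
  shows "q\<^sup>2 + 1 + q * m + (\<Sum>s\<in>UNIV. ct s) \<le> (m + e) * (q ^ 3 + q\<^sup>2 - q) + q + 1"
    and "q\<^sup>2 + 1 + q * m + (\<Sum>s\<in>UNIV. ct s) = (m + e) * (q ^ 3 + q\<^sup>2 - q) + q + 1 \<Longrightarrow>
      e = 1 \<and> card {s. j s = q} = 1 \<and> (\<Sum>s | j s \<noteq> q. j s) = m \<and> (\<forall>s. j s \<noteq> q \<longrightarrow> j s = 0 \<or> j s = m)"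
proof -
  define A where "A = {s. j s = q}"
  define B where "B = {s. j s \<noteq> q}"
  define f where "f = int (card A)"
  define \<sigma> where "\<sigma> = (\<Sum>s\<in>B. j s)"
  define \<delta> where "\<delta> = (\<Sum>s\<in>B. j s * (m - j s))"
  have split: "(\<Sum>s\<in>UNIV. h s) = (\<Sum>s\<in>A. h s) + (\<Sum>s\<in>B. h s)" for h :: "'s \<Rightarrow> int"
  proof -
    have "UNIV = A \<union> B" "A \<inter> B = {}"
      by (auto simp: A_def B_def)
    thus ?thesis
      by (metis finite sum.union_disjoint)
  qed
  have cardB: "int (card B) = q\<^sup>2 - f"
    using split[of "\<lambda>_. 1"] card by (simp add: f_def)
  have sA: "(\<Sum>s\<in>A. j s) = q * f"
    by (simp add: A_def f_def)
  have cA: "(\<Sum>s\<in>A. ct s) = q ^ 3 * f"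
    using full by (simp add: A_def f_def)
  define \<tau> where "\<tau> = m + q * e - q * f - \<sigma>"
  have \<tau>: "\<tau> \<ge> 0"
    using sum_j split[of j] sA by (simp add: \<tau>_def \<sigma>_def)
  have \<sigma>0: "\<sigma> \<ge> 0"
    unfolding \<sigma>_def by (intro sum_nonneg j0)
  have prod0: "j s * (m - j s) \<ge> 0" if "s \<in> B" for s
    using that notfull[of s] j0[of s] by (simp add: B_def)
  hence \<delta>0: "\<delta> \<ge> 0"
    unfolding \<delta>_def by (rule sum_nonneg)
  \<comment> \<open>If f were at least e + 1, the bound on the sum would give q * (e + 1) <= m + q *
    e, against m < q.\<close>
  have fe: "f \<le> e"
  proof (rule ccontr)
    assume "\<not> f \<le> e"
    hence "q * (e + 1) \<le> q * f"
      using q by (intro mult_left_mono) auto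
    with \<tau> \<sigma>0 m show False
      by (simp add: \<tau>_def algebra_simps)
  qed
  have "(\<Sum>s\<in>B. ct s) \<le> (\<Sum>s\<in>B. q * m + (q\<^sup>2 - q) * j s - j s * (m - j s))"
  proof (rule sum_mono)
    fix s assume "s \<in> B"
    hence "ct s \<le> (q - j s) * (m - j s) + j s * q\<^sup>2"
      using notfull[of s] by (simp add: B_def)
    also have "\<dots> = q * m + (q\<^sup>2 - q) * j s - j s * (m - j s)"
      by (simp add: algebra_simps)
    finally show "ct s \<le> q * m + (q\<^sup>2 - q) * j s - j s * (m - j s)" .
  qed
  also have "\<dots> = q * m * (q\<^sup>2 - f) + (q\<^sup>2 - q) * \<sigma> - \<delta>"
    by (simp add: sum.distrib sum_subtractf \<sigma>_def \<delta>_def cardB flip: sum_distrib_left)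
  finally have cB: "(\<Sum>s\<in>B. ct s) \<le> q * m * (q\<^sup>2 - f) + (q\<^sup>2 - q) * \<sigma> - \<delta>" .
  have \<sigma>: "\<sigma> = m + q * e - q * f - \<tau>"
    by (simp add: \<tau>_def)
  \<comment> \<open>Obtained by eliminating \<open>\<sigma>\<close> through the slack
    \<open>\<tau>\<close> from maximum minus estimate and collecting terms that have a definite
    sign.\<close>
  define gap where "gap = q * ((e - f) * (q - m)) + q * ((e - 1) * (m + q - 1)) + (q\<^sup>2 - q) * \<tau> + \<delta>"
  have ident: "q\<^sup>2 + 1 + q * m + (q ^ 3 * f + (q * m * (q\<^sup>2 - f) + (q\<^sup>2 - q) * \<sigma> - \<delta>)) + gap =
    (m + e) * (q ^ 3 + q\<^sup>2 - q) + q + 1"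
    unfolding gap_def \<sigma> by (simp add: algebra_simps power2_eq_square power3_eq_cube)
  have qq: "q\<^sup>2 - q > 0"
    using q by (simp add: power2_eq_square)
  have g1: "q * ((e - f) * (q - m)) \<ge> 0"
    using q fe m by (intro mult_nonneg_nonneg) auto
  have g2: "q * ((e - 1) * (m + q - 1)) \<ge> 0"
    using q e m by (intro mult_nonneg_nonneg) auto
  have g3: "(q\<^sup>2 - q) * \<tau> \<ge> 0"
    using qq \<tau> by (intro mult_nonneg_nonneg) auto
  have gap0: "gap \<ge> 0"
    unfolding gap_def using g1 g2 g3 \<delta>0 by linarith
  have le: "q\<^sup>2 + 1 + q * m + (\<Sum>s\<in>UNIV. ct s) + gap \<le> (m + e) * (q ^ 3 + q\<^sup>2 - q) + q + 1"
    unfolding split[of ct] cA using cB ident by linarith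
  show "q\<^sup>2 + 1 + q * m + (\<Sum>s\<in>UNIV. ct s) \<le> (m + e) * (q ^ 3 + q\<^sup>2 - q) + q + 1"
    using le gap0 by linarith
  assume "q\<^sup>2 + 1 + q * m + (\<Sum>s\<in>UNIV. ct s) = (m + e) * (q ^ 3 + q\<^sup>2 - q) + q + 1"
  hence "gap = 0"
    using le gap0 by linarith
  hence z: "q * ((e - f) * (q - m)) = 0" "q * ((e - 1) * (m + q - 1)) = 0" "(q\<^sup>2 - q) * \<tau> = 0" "\<delta> = 0"
    unfolding gap_def using g1 g2 g3 \<delta>0 by linarith+
  have "e = 1"
    using z(2) q m by simp
  moreover have "f = e"
    using z(1) q m by simp
  moreover have "\<tau> = 0"
    using z(3) qq by simp
  moreover have "\<forall>s\<in>B. j s * (m - j s) = 0"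
    using z(4) prod0 unfolding \<delta>_def by (subst (asm) sum_nonneg_eq_0_iff) auto
  ultimately show "e = 1 \<and> card {s. j s = q} = 1 \<and> (\<Sum>s | j s \<noteq> q. j s) = m \<and>
      (\<forall>s. j s \<noteq> q \<longrightarrow> j s = 0 \<or> j s = m)"
    using \<sigma> by (auto simp: f_def A_def B_def \<sigma>_def)
qed

context quaternary_form
begin

definition line_count :: nat where
  "line_count = card {s. g s 1 0 0 = 0} + (if g 1 0 0 0 = 0 then 1 else 0)"

definition total_count :: nat where
  "total_count = line_count + (\<Sum>w\<in>W. card (inf_zeros w)) + (\<Sum>s\<in>UNIV. \<Sum>w\<in>W. card (gen_zeros s w))"

definition line_poly :: "'a poly" where
  "line_poly = (\<Sum>\<kappa>\<in>{\<kappa>\<in>S. k3 \<kappa> = 0 \<and> k4 \<kappa> = 0}. monom (co \<kappa>) (k1 \<kappa>))"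

lemma poly_line_poly: "poly line_poly s = g s 1 0 0"
proof -
  have "g s 1 0 0 = (\<Sum>\<kappa>\<in>{\<kappa>\<in>S. k3 \<kappa> = 0 \<and> k4 \<kappa> = 0}. co \<kappa> * s ^ k1 \<kappa>)"
    unfolding g_def using finite_S
    by (intro sum.mono_neutral_cong_right) (auto simp: power_0_left)
  thus ?thesis by (simp add: line_poly_def poly_sum poly_monom)
qed

lemma coeff_line_poly:
  "coeff line_poly n =
   (\<Sum>\<kappa>\<in>{\<kappa>\<in>S. k3 \<kappa> = 0 \<and> k4 \<kappa> = 0 \<and> k1 \<kappa> = n}. co \<kappa>)"
proof -
  have "coeff line_poly n = (\<Sum>\<kappa>\<in>{\<kappa>\<in>S. k3 \<kappa> = 0 \<and> k4 \<kappa> = 0}. if k1 \<kappa> = n then co \<kappa> else 0)"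
    by (simp add: line_poly_def coeff_sum coeff_monom)
  also have "\<dots> = (\<Sum>\<kappa>\<in>{\<kappa>\<in>S. k3 \<kappa> = 0 \<and> k4 \<kappa> = 0 \<and> k1 \<kappa> = n}. co \<kappa>)"
    using finite_S by (intro sum.mono_neutral_cong_right) auto
  finally show ?thesis .
qed

lemma coeff_line_poly_d: "coeff line_poly d = g 1 0 0 0"
proof -
  have "g 1 0 0 0 = (\<Sum>\<kappa>\<in>{\<kappa>\<in>S. k3 \<kappa> = 0 \<and> k4 \<kappa> = 0 \<and> k1 \<kappa> = d}. co \<kappa>)"
    unfolding g_def
  proof (rule sum.mono_neutral_cong_right[OF finite_S])
    show "\<forall>\<kappa>\<in>S - {\<kappa>\<in>S. k3 \<kappa> = 0 \<and> k4 \<kappa> = 0 \<and> k1 \<kappa> = d}.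
        co \<kappa> * 1 ^ k1 \<kappa> * 0 ^ k2 \<kappa> * 0 ^ k3 \<kappa> * 0 ^ k4 \<kappa> = 0"
    proof
      fix \<kappa> assume "\<kappa> \<in> S - {\<kappa>\<in>S. k3 \<kappa> = 0 \<and> k4 \<kappa> = 0 \<and> k1 \<kappa> = d}"
      hence "k2 \<kappa> > 0 \<or> k3 \<kappa> > 0 \<or> k4 \<kappa> > 0"
        using degree_S[of \<kappa>] by auto
      thus "co \<kappa> * 1 ^ k1 \<kappa> * 0 ^ k2 \<kappa> * 0 ^ k3 \<kappa> * 0 ^ k4 \<kappa> = 0"
        by auto
    qed
    fix \<kappa> assume "\<kappa> \<in> {\<kappa>\<in>S. k3 \<kappa> = 0 \<and> k4 \<kappa> = 0 \<and> k1 \<kappa> = d}"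
    thus "co \<kappa> * 1 ^ k1 \<kappa> * 0 ^ k2 \<kappa> * 0 ^ k3 \<kappa> * 0 ^ k4 \<kappa> = co \<kappa>"
      using degree_S[of \<kappa>] by simp
  qed auto
  thus ?thesis by (simp add: coeff_line_poly)
qed

lemma degree_line_poly: "degree line_poly \<le> d"
  unfolding line_poly_def
proof (rule degree_sum_le)
  fix \<kappa> assume "\<kappa> \<in> {\<kappa>\<in>S. k3 \<kappa> = 0 \<and> k4 \<kappa> = 0}"
  thus "degree (monom (co \<kappa>) (k1 \<kappa>)) \<le> d"
    using degree_S[of \<kappa>] by (intro order.trans[OF degree_monom_le]) auto
qed (simp add: finite_S)

text \<open>A zero at infinity is a vanishing coefficient of s^d, so it costs one degree and both
  kinds of zeros together number at most d.\<close>

lemma line_count_le: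
  assumes "d \<ge> 1" "\<not> ((\<forall>s. g s 1 0 0 = 0) \<and> g 1 0 0 0 = 0)"
  shows "line_count \<le> d"
proof -
  have nz: "line_poly \<noteq> 0"
    using assms(2) poly_line_poly coeff_line_poly_d by (metis coeff_0 poly_0)
  hence le: "card {s. g s 1 0 0 = 0} \<le> degree line_poly"
    by (rule card_poly_zeros_le) (simp add: poly_line_poly)
  show ?thesis
  proof (cases "g 1 0 0 0 = 0")
    case True
    hence "degree line_poly \<noteq> d"
      using coeff_line_poly_d nz by (metis leading_coeff_0_iff)
    with le degree_line_poly assms(1) True show ?thesis
      by (simp add: line_count_def)
  next
    case False
    with le degree_line_poly show ?thesis
      by (simp add: line_count_def)
  qed
qed

lemma line_count_le_card: "line_count \<le> q ^ 2 + 1"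
  using card_mono[of UNIV "{s. g s 1 0 0 = 0}"] card_field by (simp add: line_count_def)

text \<open>The restriction to the line has degree at most d <= q < q^2, so it vanishes as a
  polynomial, whereas a monomial with k3 = k4 = 0 would survive in it.\<close>

lemma e_ge_1:
  assumes "\<forall>s. g s 1 0 0 = 0"
  shows "e \<ge> 1"
proof (rule ccontr)
  assume "\<not> e \<ge> 1"
  then obtain \<kappa> where \<kappa>: "\<kappa> \<in> S" "k3 \<kappa> = 0" "k4 \<kappa> = 0"
    using e_attained by auto
  have "{\<kappa>'\<in>S. k3 \<kappa>' = 0 \<and> k4 \<kappa>' = 0 \<and> k1 \<kappa>' = k1 \<kappa>} = {\<kappa>}"
  proof safe
    fix \<kappa>' assume \<kappa>': "\<kappa>' \<in> S" "k3 \<kappa>' = 0" "k4 \<kappa>' = 0" "k1 \<kappa>' = k1 \<kappa>"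
    hence "k2 \<kappa>' = k2 \<kappa>"
      using \<kappa> degree_S[of \<kappa>] degree_S[of \<kappa>'] by simp
    with \<kappa>' \<kappa> show "\<kappa>' = \<kappa>"
      by (intro inj_onD[OF inj_exponents]) simp_all
  qed (use \<kappa> in simp_all)
  hence "coeff line_poly (k1 \<kappa>) = co \<kappa>"
    by (simp add: coeff_line_poly)
  hence "line_poly \<noteq> 0"
    using co_nonzero[OF \<kappa>(1)] by auto
  hence "card (UNIV :: 'a set) \<le> degree line_poly"
    by (rule card_poly_zeros_le) (use assms in \<open>simp add: poly_line_poly\<close>)
  also have "\<dots> \<le> d" by (rule degree_line_poly)
  also have "d \<le> q" by (rule d_le_q)
  also have "q < q ^ 2" using q_ge_2 by (simp add: power2_eq_square)
  finally show False using card_field by simp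
qed

text \<open>The line and each of the q + q^3 generators then carry at most d of the counted zeros,
  which gives d (1 + q + q^3) altogether.\<close>

lemma total_count_no_generator:
  assumes "d \<ge> 1" "\<not> ((\<forall>s. g s 1 0 0 = 0) \<and> g 1 0 0 0 = 0)"
    and "\<And>w. w \<in> W \<Longrightarrow> inf_zeros w \<noteq> UNIV" and "\<And>s. J s = {}"
  shows "total_count < d * (q ^ 3 + q ^ 2 - q) + q + 1"
proof -
  have md: "m \<le> d" by (simp add: m_def)
  have 1: "(\<Sum>w\<in>W. card (inf_zeros w)) \<le> q * d"
    using sum_bounded_above[of W "\<lambda>w. card (inf_zeros w)" d]
      order.trans[OF card_inf_zeros_le[OF assms(3)] md] card_W by simp
  have "(\<Sum>w\<in>W. card (gen_zeros s w)) \<le> q * d" for s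
    using sum_bounded_above[of W "\<lambda>w. card (gen_zeros s w)" d] card_gen_zeros_le[of _ s] assms(4) md card_W
    by (simp add: order.trans[OF _ md])
  hence 2: "(\<Sum>s\<in>UNIV. \<Sum>w\<in>W. card (gen_zeros s w)) \<le> q ^ 2 * (q * d)"
    using sum_bounded_above[of "UNIV :: 'a set" "\<lambda>s. \<Sum>w\<in>W. card (gen_zeros s w)" "q * d"] card_field by simp
  have t: "total_count \<le> d + q * d + q ^ 2 * (q * d)"
    unfolding total_count_def using line_count_le[OF assms(1,2)] 1 2 by linarith
  \<comment> \<open>Writing q = a + 2 removes the truncated subtraction. The margin is d (q^2 - 2 q
    - 1) + q + 1; for q = 2 it is 3 - d, positive because d <= q.\<close>
  define a where "a = q - 2"
  have q: "q = a + 2" using q_ge_2 by (simp add: a_def)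
  have qq: "q ^ 2 - q = a * a + 3 * a + 2"
    unfolding q by (simp add: power2_eq_square algebra_simps)
  have "d + q * d < d * (q ^ 2 - q) + q + 1"
    unfolding qq using d_le_q unfolding q by (simp add: algebra_simps)
  moreover have "d * (q ^ 3 + q ^ 2 - q) = q ^ 2 * (q * d) + d * (q ^ 2 - q)"
  proof -
    have "q ^ 3 + q ^ 2 - q = q ^ 3 + (q ^ 2 - q)"
      using q_ge_2 by (simp add: power2_eq_square)
    thus ?thesis by (simp add: algebra_simps power2_eq_square power3_eq_cube)
  qed
  ultimately show ?thesis using t by linarith
qed

lemma sum_gen_zeros_full:
  assumes "J s = W"
  shows "(\<Sum>w\<in>W. card (gen_zeros s w)) = q ^ 3"
proof -
  have "(\<Sum>w\<in>W. card (gen_zeros s w)) = (\<Sum>w\<in>W. q ^ 2)"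
  proof (rule sum.cong)
    fix w assume "w \<in> W"
    hence "w \<in> J s" using assms by simp
    thus "card (gen_zeros s w) = q ^ 2"
      by (simp add: J_def card_field)
  qed simp
  thus ?thesis by (simp add: card_W power2_eq_square power3_eq_cube)
qed

lemma sum_gen_zeros_le:
  assumes "J s \<noteq> W"
  shows "int (\<Sum>w\<in>W. card (gen_zeros s w)) \<le>
    (int q - int (card (J s))) * (int m - int (card (J s))) + int (card (J s)) * (int q)\<^sup>2"
proof -
  have "(\<Sum>w\<in>W. card (gen_zeros s w)) = (\<Sum>w\<in>J s. card (gen_zeros s w)) + (\<Sum>w\<in>W - J s. card (gen_zeros s w))"
    using sum.subset_diff[OF J_subset, of "\<lambda>w. card (gen_zeros s w)" s] by simp
  moreover have "(\<Sum>w\<in>J s. card (gen_zeros s w)) = card (J s) * q ^ 2"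
    using card_field by (simp add: J_def)
  moreover have "(\<Sum>w\<in>W - J s. card (gen_zeros s w)) \<le> card (W - J s) * (m - card (J s))"
    using sum_bounded_above[of "W - J s" "\<lambda>w. card (gen_zeros s w)"] card_gen_zeros_le by simp
  moreover have "card (W - J s) = q - card (J s)"
    by (simp add: card_Diff_subset J_subset card_W)
  ultimately have "(\<Sum>w\<in>W. card (gen_zeros s w)) \<le> card (J s) * q ^ 2 + (q - card (J s)) * (m - card (J s))"
    by simp
  hence "int (\<Sum>w\<in>W. card (gen_zeros s w)) \<le> int (card (J s) * q ^ 2 + (q - card (J s)) * (m - card (J s)))"
    by (simp only: of_nat_le_iff)
  also have "\<dots> = (int q - int (card (J s))) * (int m - int (card (J s))) + int (card (J s)) * (int q)\<^sup>2"
    by (simp only: of_nat_add of_nat_mult of_nat_power of_nat_diff[OF card_J_le_q]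
        of_nat_diff[OF card_J_le_m[OF assms]] add.commute)
  finally show ?thesis .
qed

lemma card_J_eq_q_iff: "card (J s) = q \<longleftrightarrow> J s = W"
  using card_W card_subset_eq[OF _ J_subset] by (metis finite)

text \<open>In the case of equality e = 1, hence m = d - 1. The values of \<open>card (J s)\<close>
  other than q are 0 or m and add up to m, so for d >= 2 one of them equals d - 1.\<close>

lemma total_count_generator:
  assumes "\<forall>s. g s 1 0 0 = 0" and "\<And>w. w \<in> W \<Longrightarrow> inf_zeros w \<noteq> UNIV"
  shows "total_count \<le> d * (q ^ 3 + q ^ 2 - q) + q + 1"
    and "total_count = d * (q ^ 3 + q ^ 2 - q) + q + 1 \<Longrightarrow>
      (\<exists>s. J s = W) \<and> (d \<ge> 2 \<longrightarrow> (\<exists>s. card (J s) = d - 1))"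
proof -
  note e1 = e_ge_1[OF assms(1)]
  let ?ct = "\<lambda>s. int (\<Sum>w\<in>W. card (gen_zeros s w))"
  let ?j = "\<lambda>s. int (card (J s))"
  have mq: "m < q"
    using e1 d_le_q q_ge_2 by (simp add: m_def)
  have card: "int CARD('a) = (int q)\<^sup>2"
    using card_field by simp
  have full: "?ct s = int q ^ 3" if "?j s = int q" for s
    using that sum_gen_zeros_full[of s] card_J_eq_q_iff[of s] by simp
  have notfull: "?j s \<le> int m \<and> ?ct s \<le> (int q - ?j s) * (int m - ?j s) + ?j s * (int q)\<^sup>2"
    if "?j s \<noteq> int q" for s
    using that sum_gen_zeros_le[of s] card_J_le_m[of s] card_J_eq_q_iff[of s] by auto
  have sumj: "(\<Sum>s\<in>UNIV. ?j s) \<le> int m + int q * int e"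
    using sum_card_J_le[OF e1] by (metis of_nat_add of_nat_le_iff of_nat_mult of_nat_sum)
  note count = pencil_count[of "int q" "int m" "int e" ?j ?ct, OF _ _ _ _ card _ full notfull sumj]
  have d: "int m + int e = int d"
    using e_le_d by (simp add: m_def)
  have bound: "int (d * (q ^ 3 + q ^ 2 - q) + q + 1) =
    (int m + int e) * (int q ^ 3 + (int q)\<^sup>2 - int q) + int q + 1"
  proof -
    have "q \<le> q ^ 3 + q ^ 2"
      using self_le_power[of q 2] q_ge_2 by simp
    thus ?thesis unfolding d by (simp add: of_nat_diff)
  qed
  have inf: "(\<Sum>w\<in>W. card (inf_zeros w)) \<le> q * m"
    using sum_bounded_above[of W "\<lambda>w. card (inf_zeros w)" m] card_inf_zeros_le assms(2) card_W by simp
  have "total_count \<le> q ^ 2 + 1 + q * m + (\<Sum>s\<in>UNIV. \<Sum>w\<in>W. card (gen_zeros s w))"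
    unfolding total_count_def using line_count_le_card inf by linarith
  hence "int total_count \<le> int (q ^ 2 + 1 + q * m + (\<Sum>s\<in>UNIV. \<Sum>w\<in>W. card (gen_zeros s w)))"
    by (simp only: of_nat_le_iff)
  hence tc: "int total_count \<le> (int q)\<^sup>2 + 1 + int q * int m + (\<Sum>s\<in>UNIV. ?ct s)"
    by simp
  have le: "(int q)\<^sup>2 + 1 + int q * int m + (\<Sum>s\<in>UNIV. ?ct s) \<le>
    (int m + int e) * (int q ^ 3 + (int q)\<^sup>2 - int q) + int q + 1"
    by (rule count(1)) (use q_ge_2 mq e1 in auto)
  have "int total_count \<le> int (d * (q ^ 3 + q ^ 2 - q) + q + 1)"
    unfolding bound using tc le by linarith
  thus "total_count \<le> d * (q ^ 3 + q ^ 2 - q) + q + 1"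
    by (simp only: of_nat_le_iff)
  assume "total_count = d * (q ^ 3 + q ^ 2 - q) + q + 1"
  hence "int total_count = (int m + int e) * (int q ^ 3 + (int q)\<^sup>2 - int q) + int q + 1"
    using bound by simp
  hence eq: "(int q)\<^sup>2 + 1 + int q * int m + (\<Sum>s\<in>UNIV. ?ct s) =
    (int m + int e) * (int q ^ 3 + (int q)\<^sup>2 - int q) + int q + 1"
    using tc le by linarith
  have "int e = 1 \<and> card {s. ?j s = int q} = 1 \<and> (\<Sum>s | ?j s \<noteq> int q. ?j s) = int m \<and>
      (\<forall>s. ?j s \<noteq> int q \<longrightarrow> ?j s = 0 \<or> ?j s = int m)"
    by (rule count(2)) (use q_ge_2 mq e1 eq in auto)
  hence e: "e = 1" and f: "card {s. card (J s) = q} = 1" and sm: "(\<Sum>s | ?j s \<noteq> int q. ?j s) = int m"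
    and alt: "\<And>s. card (J s) \<noteq> q \<Longrightarrow> card (J s) = 0 \<or> card (J s) = m"
    by auto
  have md: "m = d - 1" using e by (simp add: m_def)
  have "\<exists>s. J s = W"
    using f card_J_eq_q_iff by (metis (mono_tags, lifting) card_1_singletonE mem_Collect_eq singletonI)
  moreover have "\<exists>s. card (J s) = d - 1" if "d \<ge> 2"
  proof (rule ccontr)
    assume "\<not> (\<exists>s. card (J s) = d - 1)"
    hence "(\<Sum>s | ?j s \<noteq> int q. ?j s) = (\<Sum>s | ?j s \<noteq> int q. 0)"
      using alt md by (intro sum.cong) auto
    with sm md that show False by simp
  qed
  ultimately show "(\<exists>s. J s = W) \<and> (d \<ge> 2 \<longrightarrow> (\<exists>s. card (J s) = d - 1))"
    by blast
qed

text \<open>If every \<open>J s\<close> were nonempty, the degree bound on the tangency orders would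
  give q^2 <= m + q * e.\<close>

lemma ex_J_empty:
  assumes "\<forall>s. g s 1 0 0 = 0"
  shows "\<exists>s. J s = {}"
proof (rule ccontr)
  note e1 = e_ge_1[OF assms]
  assume "\<not> (\<exists>s. J s = {})"
  hence pos: "card (J s) \<ge> 1" for s
    by (simp add: Suc_le_eq card_gt_0_iff)
  have "(\<Sum>s\<in>(UNIV::'a set). 1) \<le> (\<Sum>s\<in>UNIV. card (J s))"
    by (rule sum_mono) (rule pos)
  hence le: "q ^ 2 \<le> m + q * e"
    using sum_card_J_le[OF e1] card_field by simp
  show False
  \<comment> \<open>For m = 0 the value e = q is possible and q^2 <= q * e is no contradiction; but
    then every nonempty \<open>J s\<close> is all of \<open>W\<close>, which raises the left side to
    q^3.\<close>
  proof (cases "m = 0")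
    case True
    have full: "card (J s) = q" for s
      using pos[of s] card_J_le_m[of s] True card_J_eq_q_iff by fastforce
    hence "q ^ 2 * q \<le> q * e"
      using sum_card_J_le[OF e1] card_field True by simp
    hence "q ^ 2 \<le> e" using q_ge_2 by simp
    also have "e \<le> q" using e_le_d d_le_q by simp
    finally show False using q_ge_2 by (simp add: power2_eq_square)
  next
    case False
    hence "m + e \<le> q"
      using e_le_d d_le_q by (auto simp: m_def)
    hence "e + 1 \<le> q"
      using False by simp
    then obtain a where a: "q = e + 1 + a"
      using le_Suc_ex by blast
    have "m \<le> 1 + a" using \<open>m + e \<le> q\<close> a by simp
    moreover have "q ^ 2 = q * e + q + q * a"
      unfolding a by (simp add: power2_eq_square algebra_simps)
    ultimately have "q + q * a \<le> 1 + a" using le by linarith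
    thus False using q_ge_2 a e1 by (simp add: algebra_simps)
  qed
qed

end

section \<open>Evaluation and divisibility of multivariate polynomials\<close>

abbreviation (input) "lookup \<equiv> Poly_Mapping.lookup"

abbreviation (input) "keys \<equiv> Poly_Mapping.keys"

definition ac_vec :: "'a::field ^ 'n \<Rightarrow> 'a alg_closure ^ 'n::finite" where
  "ac_vec v = (\<chi> i. to_ac (v $ i))"

lemma ac_vec_nth [simp]: "ac_vec v $ i = to_ac (v $ i)"
  by (simp add: ac_vec_def)

definition ground_eval :: "('n::finite, 'a::field) mpoly \<Rightarrow> 'a ^ 'n \<Rightarrow> 'a" where
  "ground_eval F v = (\<Sum>\<kappa>\<in>keys F.
     lookup F \<kappa> * (\<Prod>i\<in>UNIV. (v $ i) ^ lookup \<kappa> i))"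

lemma eval_mpoly_ac_vec: "eval_mpoly F (ac_vec v) = to_ac (ground_eval F v)"
  by (simp add: eval_mpoly_def ground_eval_def to_ac_sum to_ac_prod)

lemma mpoly_sum_monomials:
  "(\<Sum>\<kappa>\<in>keys F. Poly_Mapping.single \<kappa> (lookup F \<kappa>)) = F"
proof (rule poly_mapping_eqI)
  fix \<kappa>
  have "lookup (\<Sum>\<kappa>\<in>keys F. Poly_Mapping.single \<kappa> (lookup F \<kappa>)) \<kappa> =
        (\<Sum>\<kappa>'\<in>keys F. if \<kappa>' = \<kappa> then lookup F \<kappa> else 0)"
    unfolding lookup_sum by (intro sum.cong) (auto simp: lookup_single when_def)
  also have "\<dots> = lookup F \<kappa>"
    by (simp add: in_keys_iff)
  finally show "lookup (\<Sum>\<kappa>\<in>keys F. Poly_Mapping.single \<kappa> (lookup F \<kappa>)) \<kappa> =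
    lookup F \<kappa>" .
qed

lemma eval_mpoly_mult: "eval_mpoly (F * G) x = eval_mpoly F x * eval_mpoly G x"
proof -
  have "F * G = (\<Sum>\<kappa>\<in>keys F. \<Sum>\<mu>\<in>keys G.
      Poly_Mapping.single (\<kappa> + \<mu>) (lookup F \<kappa> * lookup G \<mu>))"
    by (subst (1) mpoly_sum_monomials [of F, symmetric], subst (1) mpoly_sum_monomials [of G, symmetric])
       (simp add: sum_product mult_single)
  also have "eval_mpoly \<dots> x = eval_mpoly F x * eval_mpoly G x"
    unfolding eval_mpoly_sum eval_mpoly_single
    by (simp add: eval_mpoly_def sum_product lookup_add power_add prod.distrib mult_ac)
  finally show ?thesis .
qed

lemma homogeneous_mult:
  assumes "homogeneous a F" "homogeneous b G"
  shows "homogeneous (a + b) (F * G)"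
  unfolding homogeneous_def
proof
  fix \<kappa> assume "\<kappa> \<in> keys (F * G)"
  then obtain u v where "\<kappa> = u + v" "u \<in> keys F" "v \<in> keys G"
    using keys_mult[of F G] by auto
  with assms show "(\<Sum>i\<in>UNIV. lookup \<kappa> i) = a + b"
    by (simp add: homogeneous_def lookup_add sum.distrib)
qed

lemma homogeneous_sum:
  assumes "\<And>i. i \<in> I \<Longrightarrow> homogeneous a (F i)"
  shows "homogeneous a (\<Sum>i\<in>I. F i)"
  using assms keys_sum[of F I] unfolding homogeneous_def by blast

lemma homogeneous_single:
  "(\<Sum>i\<in>UNIV. lookup \<kappa> i) = a \<Longrightarrow> homogeneous a (Poly_Mapping.single \<kappa> c)"
  by (auto simp: homogeneous_def split: if_splits)

lemma homogeneous_power: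
  assumes "homogeneous a F"
  shows "homogeneous (a * n) (F ^ n)"
proof (induction n)
  case 0
  show ?case by (simp add: homogeneous_def)
next
  case (Suc n)
  show ?case using homogeneous_mult[OF assms Suc] by simp
qed

lemma homogeneous_prod:
  fixes F :: "'i \<Rightarrow> ('n::finite, 'a::field) mpoly"
  assumes "\<And>i. i \<in> I \<Longrightarrow> homogeneous (a i) (F i)"
  shows "homogeneous (\<Sum>i\<in>I. a i) (\<Prod>i\<in>I. F i)"
proof -
  have "homogeneous 0 (1 :: ('n, 'a) mpoly)"
    by (simp add: homogeneous_def)
  thus ?thesis using assms
    by (induction I rule: infinite_finite_induct) (simp_all add: homogeneous_mult)
qed

lemma eval_mpoly_1: "eval_mpoly 1 x = 1"
  using eval_mpoly_single[of 0 1 x] by simp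

lemma eval_mpoly_power: "eval_mpoly (F ^ n) x = eval_mpoly F x ^ n"
  by (induction n) (simp_all add: eval_mpoly_1 eval_mpoly_mult)

lemma eval_mpoly_prod: "eval_mpoly (\<Prod>i\<in>I. F i) x = (\<Prod>i\<in>I. eval_mpoly (F i) x)"
  by (induction I rule: infinite_finite_induct) (simp_all add: eval_mpoly_1 eval_mpoly_mult)

section \<open>Linear forms and linear substitutions\<close>

definition linear_mpoly :: "'a::field ^ 'n \<Rightarrow> ('n::finite, 'a) mpoly" where
  "linear_mpoly l = (\<Sum>i\<in>UNIV. Poly_Mapping.single (Poly_Mapping.single i 1) (l $ i))"

lemma eval_linear_mpoly: "eval_mpoly (linear_mpoly l) x = (\<Sum>i\<in>UNIV. to_ac (l $ i) * x $ i)"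
  by (simp add: linear_mpoly_def eval_mpoly_sum eval_mpoly_single prod_power_single del: One_nat_def)

lemma sum_lookup_single: "(\<Sum>j\<in>(UNIV::'n::finite set). lookup (Poly_Mapping.single i (n::nat)) j) = n"
  by (simp add: lookup_single when_def)

lemma homogeneous_linear_mpoly: "homogeneous 1 (linear_mpoly l)"
  unfolding linear_mpoly_def by (intro homogeneous_sum homogeneous_single) (rule sum_lookup_single)

definition ac_mat :: "'a::field ^ 'n ^ 'm \<Rightarrow> 'a alg_closure ^ 'n ^ 'm" where
  "ac_mat M = (\<chi> i j. to_ac (M $ i $ j))"

definition subst_mpoly :: "'a::field ^ 'n ^ 'n \<Rightarrow> ('n::finite, 'a) mpoly \<Rightarrow> ('n, 'a) mpoly" where
  "subst_mpoly M F = (\<Sum>\<kappa>\<in>keys F. Poly_Mapping.single 0 (lookup F \<kappa>) *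
     (\<Prod>i\<in>UNIV. linear_mpoly (M $ i) ^ lookup \<kappa> i))"

lemma eval_subst_mpoly: "eval_mpoly (subst_mpoly M F) x = eval_mpoly F (ac_mat M *v x)"
  unfolding subst_mpoly_def eval_mpoly_sum eval_mpoly_mult eval_mpoly_single eval_mpoly_prod
    eval_mpoly_power eval_linear_mpoly
  by (simp add: eval_mpoly_def[of F] matrix_vector_mult_def ac_mat_def)

lemma homogeneous_subst_mpoly:
  assumes "homogeneous d F"
  shows "homogeneous d (subst_mpoly M F)"
  unfolding subst_mpoly_def
proof (rule homogeneous_sum)
  fix \<kappa> assume "\<kappa> \<in> keys F"
  hence d: "d = 0 + (\<Sum>i\<in>UNIV. 1 * lookup \<kappa> i)"
    using assms by (simp add: homogeneous_def)
  show "homogeneous d (Poly_Mapping.single 0 (lookup F \<kappa>) *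
     (\<Prod>i\<in>UNIV. linear_mpoly (M $ i) ^ lookup \<kappa> i))"
    unfolding d
    by (intro homogeneous_mult homogeneous_prod homogeneous_power homogeneous_linear_mpoly homogeneous_single)
       simp
qed

lemma ac_mat_vec: "ac_mat M *v ac_vec v = ac_vec (M *v v)"
  by (simp add: vec_eq_iff matrix_vector_mult_def ac_mat_def to_ac_sum)

lemma ac_mat_mult: "ac_mat (M ** N) = ac_mat M ** ac_mat N"
  by (simp add: vec_eq_iff matrix_matrix_mult_def ac_mat_def to_ac_sum)

lemma ac_mat_1: "ac_mat (mat 1) = mat 1"
  by (simp add: vec_eq_iff ac_mat_def mat_def)

lemma ground_eval_subst: "ground_eval (subst_mpoly M F) v = ground_eval F (M *v v)"
proof -
  have "to_ac (ground_eval (subst_mpoly M F) v) = to_ac (ground_eval F (M *v v))"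
    unfolding eval_mpoly_ac_vec [symmetric] eval_subst_mpoly ac_mat_vec ..
  thus ?thesis by simp
qed

lemma eval_mpoly_scale:
  assumes "homogeneous d F"
  shows "eval_mpoly F (k *s x) = k ^ d * eval_mpoly F x"
proof -
  have "(\<Prod>i\<in>UNIV. (k *s x) $ i ^ lookup \<kappa> i) =
        k ^ d * (\<Prod>i\<in>UNIV. x $ i ^ lookup \<kappa> i)" if "\<kappa> \<in> keys F" for \<kappa>
    using that assms by (simp add: power_mult_distrib prod.distrib homogeneous_def flip: power_sum)
  thus ?thesis
    unfolding eval_mpoly_def sum_distrib_left by (intro sum.cong) simp_all
qed

lemma ground_eval_scale:
  assumes "homogeneous d F"
  shows "ground_eval F (k *s v) = k ^ d * ground_eval F v"
proof -
  have "ac_vec (k *s v) = to_ac k *s ac_vec v"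
    by (simp add: vec_eq_iff)
  hence "to_ac (ground_eval F (k *s v)) = to_ac (k ^ d * ground_eval F v)"
    unfolding eval_mpoly_ac_vec [symmetric] using eval_mpoly_scale[OF assms]
    by (simp add: eval_mpoly_ac_vec)
  thus ?thesis by (simp only: to_ac_eq_iff)
qed

text \<open>Separating the exponents by their values on \<open>I\<close> lets the induction remove one variable at a
  time.\<close>
lemma monomials_independent:
  fixes c :: "('n::finite \<Rightarrow>\<^sub>0 nat) \<Rightarrow> 'a::{field,finite}"
  assumes "finite S"
    and "\<And>\<kappa> \<mu>. \<kappa> \<in> S \<Longrightarrow> \<mu> \<in> S \<Longrightarrow> (\<And>i. i \<in> I \<Longrightarrow> lookup \<kappa> i = lookup \<mu> i) \<Longrightarrow> \<kappa> = \<mu>"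
    and "\<And>\<kappa> i. \<kappa> \<in> S \<Longrightarrow> i \<in> I \<Longrightarrow> lookup \<kappa> i < CARD('a)"
    and "\<And>v :: 'n \<Rightarrow> 'a. (\<Sum>\<kappa>\<in>S. c \<kappa> * (\<Prod>i\<in>I. v i ^ lookup \<kappa> i)) = 0"
  shows "\<forall>\<kappa>\<in>S. c \<kappa> = 0"
proof -
  have "finite I" by simp
  thus ?thesis using assms
  proof (induction I arbitrary: S rule: finite_induct)
    case empty
    show ?case
    proof
      fix \<kappa> assume "\<kappa> \<in> S"
      hence "S = {\<kappa>}" using empty.prems(2) by blast
      thus "c \<kappa> = 0" using empty.prems(4)[of undefined] by simp
    qed
  next
    case (insert j I)
    note sep = insert.prems(2) and lt = insert.prems(3) and zero = insert.prems(4)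
    show ?case
    proof
      fix \<mu> assume \<mu>: "\<mu> \<in> S"
      define n where "n = lookup \<mu> j"
      define Sn where "Sn = {\<kappa>\<in>S. lookup \<kappa> j = n}"
      have "\<forall>\<kappa>\<in>Sn. c \<kappa> = 0"
      proof (rule insert.IH)
        show "finite Sn" using insert.prems(1) by (simp add: Sn_def)
        show "\<kappa> = \<mu>" if "\<kappa> \<in> Sn" "\<mu> \<in> Sn"
          "\<And>i. i \<in> I \<Longrightarrow> lookup \<kappa> i = lookup \<mu> i" for \<kappa> \<mu>
          using that by (intro sep) (auto simp: Sn_def)
        show "lookup \<kappa> i < CARD('a)" if "\<kappa> \<in> Sn" "i \<in> I" for \<kappa> i
          using that lt[of \<kappa> i] by (simp add: Sn_def)
        fix v :: "'n \<Rightarrow> 'a"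
        let ?a = "\<lambda>\<kappa>. c \<kappa> * (\<Prod>i\<in>I. v i ^ lookup \<kappa> i)"
        \<comment> \<open>With the other variables fixed the sum is a polynomial in the j-th
          variable, of degree below \<open>CARD('a)\<close> and zero everywhere; its n-th
          coefficient collects exactly the exponents in \<open>Sn\<close>.\<close>
        define p where "p = (\<Sum>\<kappa>\<in>S. monom (?a \<kappa>) (lookup \<kappa> j))"
        have "poly p t = 0" for t
        proof -
          have "(\<Prod>i\<in>I. (v(j := t)) i ^ lookup \<kappa> i) = (\<Prod>i\<in>I. v i ^ lookup \<kappa> i)" for \<kappa>
            using insert.hyps(2) by (intro prod.cong) auto
          hence "poly p t = (\<Sum>\<kappa>\<in>S. c \<kappa> * (\<Prod>i\<in>insert j I. (v(j := t)) i ^ lookup \<kappa> i))"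
            using insert.hyps by (simp add: p_def poly_sum poly_monom mult_ac)
          thus ?thesis using zero by simp
        qed
        moreover have "degree p \<le> CARD('a) - 1"
          unfolding p_def
        proof (rule degree_sum_le[OF insert.prems(1)])
          fix \<kappa> assume "\<kappa> \<in> S"
          hence "lookup \<kappa> j \<le> CARD('a) - 1" using lt[of \<kappa> j] by simp
          thus "degree (monom (?a \<kappa>) (lookup \<kappa> j)) \<le> CARD('a) - 1"
            by (intro order.trans[OF degree_monom_le])
        qed
        ultimately have "p = 0"
          using card_poly_zeros_le[of p UNIV] finite_UNIV_card_ge_0[where ?'a = 'a] by fastforce
        hence "coeff p n = 0" by simp
        moreover have "coeff p n = (\<Sum>\<kappa>\<in>Sn. ?a \<kappa>)"
          unfolding p_def coeff_sum Sn_def using insert.prems(1)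
          by (intro sum.mono_neutral_cong_right) (auto simp: coeff_monom)
        ultimately show "(\<Sum>\<kappa>\<in>Sn. ?a \<kappa>) = 0" by simp
      qed
      thus "c \<mu> = 0" using \<mu> by (simp add: Sn_def n_def)
    qed
  qed
qed

lemma homogeneous_lookup_le:
  fixes F :: "('n::finite, 'a::zero) mpoly"
  assumes "homogeneous d F" "\<kappa> \<in> keys F"
  shows "lookup \<kappa> i \<le> d"
  using assms member_le_sum[of i UNIV "lookup \<kappa>"] by (simp add: homogeneous_def)

lemma ex_ground_eval_nonzero:
  fixes F :: "('n::finite, 'a::{field,finite}) mpoly"
  assumes "F \<noteq> 0" "homogeneous d F" "d < CARD('a)"
  shows "\<exists>v. ground_eval F v \<noteq> 0"
proof (rule ccontr)
  assume no: "\<not> (\<exists>v. ground_eval F v \<noteq> 0)"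
  have "\<forall>\<kappa>\<in>keys F. lookup F \<kappa> = 0"
  proof (rule monomials_independent[where I = UNIV])
    show "lookup \<kappa> i < CARD('a)" if "\<kappa> \<in> keys F" for \<kappa> i
      using homogeneous_lookup_le[OF assms(2) that] assms(3) by (rule le_less_trans)
    fix v :: "'n \<Rightarrow> 'a"
    show "(\<Sum>\<kappa>\<in>keys F. lookup F \<kappa> * (\<Prod>i\<in>UNIV. v i ^ lookup \<kappa> i)) = 0"
      using no by (auto simp: ground_eval_def dest: spec[of _ "\<chi> i. v i"])
  qed (auto intro: poly_mapping_eqI)
  hence "F = 0"
    by (intro poly_mapping_eqI) (auto simp: in_keys_iff)
  with assms(1) show False ..
qed

text \<open>Setting the variable to 0 leaves the monomials that do not contain it, and independence
  on rational vectors kills their coefficients. Hence rational zeros already yield a factorisation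
  over the algebraic closure.\<close>

lemma eval_mpoly_divide_variable:
  fixes F :: "('n::finite, 'a::{field,finite}) mpoly"
  assumes "homogeneous d F" "d < CARD('a)" and zero: "\<And>v. v $ i = 0 \<Longrightarrow> ground_eval F v = 0"
  shows "\<exists>G. homogeneous (d - 1) G \<and> (\<forall>x. eval_mpoly F x = x $ i * eval_mpoly G x)"
proof -
  have "\<forall>\<kappa>\<in>{\<kappa>\<in>keys F. lookup \<kappa> i = 0}. lookup F \<kappa> = 0"
  proof (rule monomials_independent[where I = "UNIV - {i}"])
    show "\<kappa> = \<mu>" if "\<kappa> \<in> {\<kappa>\<in>keys F. lookup \<kappa> i = 0}"
      "\<mu> \<in> {\<kappa>\<in>keys F. lookup \<kappa> i = 0}"
      "\<And>j. j \<in> UNIV - {i} \<Longrightarrow> lookup \<kappa> j = lookup \<mu> j" for \<kappa> \<mu>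
      using that by (intro poly_mapping_eqI) (metis (mono_tags, lifting) DiffI UNIV_I mem_Collect_eq singletonD)
    show "lookup \<kappa> j < CARD('a)"
      if "\<kappa> \<in> {\<kappa>\<in>keys F. lookup \<kappa> i = 0}" for \<kappa> j
      using homogeneous_lookup_le[OF assms(1), of \<kappa> j] that assms(2) by simp
    fix v :: "'n \<Rightarrow> 'a"
    let ?v = "\<chi> j. if j = i then 0 else v j"
    have p: "(\<Prod>j\<in>UNIV. ?v $ j ^ lookup \<kappa> j) =
        0 ^ lookup \<kappa> i * (\<Prod>j\<in>UNIV - {i}. v j ^ lookup \<kappa> j)" for \<kappa>
      by (subst prod.remove[of _ i]) (auto intro!: prod.cong)
    have "ground_eval F ?v = (\<Sum>\<kappa>\<in>{\<kappa>\<in>keys F. lookup \<kappa> i = 0}.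
      lookup F \<kappa> * (\<Prod>j\<in>UNIV - {i}. v j ^ lookup \<kappa> j))"
      unfolding ground_eval_def p by (intro sum.mono_neutral_cong_right) (auto simp: power_0_left)
    thus "(\<Sum>\<kappa>\<in>{\<kappa>\<in>keys F. lookup \<kappa> i = 0}.
      lookup F \<kappa> * (\<Prod>j\<in>UNIV - {i}. v j ^ lookup \<kappa> j)) = 0"
      using zero[of ?v] by simp
  qed simp
  hence pos: "lookup \<kappa> i \<ge> 1" if "\<kappa> \<in> keys F" for \<kappa>
    using that by (cases "lookup \<kappa> i") (auto simp: in_keys_iff)
  define G where "G = (\<Sum>\<kappa>\<in>keys F.
    Poly_Mapping.single (\<kappa> - Poly_Mapping.single i 1) (lookup F \<kappa>))"
  have shift: "\<kappa> = Poly_Mapping.single i 1 + (\<kappa> - Poly_Mapping.single i 1)"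
    if "\<kappa> \<in> keys F" for \<kappa>
    using pos[OF that] by (intro poly_mapping_eqI) (auto simp: lookup_add lookup_minus lookup_single when_def)
  have "homogeneous (d - 1) G"
    unfolding G_def
  proof (intro homogeneous_sum homogeneous_single)
    fix \<kappa> assume \<kappa>: "\<kappa> \<in> keys F"
    have "d = (\<Sum>j\<in>UNIV. lookup \<kappa> j)"
      using assms(1) \<kappa> by (simp add: homogeneous_def)
    also have "\<dots> = 1 + (\<Sum>j\<in>UNIV. lookup (\<kappa> - Poly_Mapping.single i 1) j)"
    proof -
      have "lookup \<kappa> j = lookup (Poly_Mapping.single i 1) j +
          lookup (\<kappa> - Poly_Mapping.single i 1) j" for j
        using arg_cong[OF shift[OF \<kappa>], of "\<lambda>\<mu>. lookup \<mu> j"] by (simp only: lookup_add)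
      hence "(\<Sum>j\<in>UNIV. lookup \<kappa> j) = (\<Sum>j\<in>UNIV. lookup (Poly_Mapping.single i 1) j +
          lookup (\<kappa> - Poly_Mapping.single i 1) j)"
        by (rule sum.cong[OF refl])
      thus ?thesis by (simp only: sum.distrib sum_lookup_single)
    qed
    finally show "(\<Sum>j\<in>UNIV. lookup (\<kappa> - Poly_Mapping.single i 1) j) = d - 1"
      by simp
  qed
  moreover have "eval_mpoly F x = x $ i * eval_mpoly G x" for x
  proof -
    have "(\<Prod>j\<in>UNIV. x $ j ^ lookup \<kappa> j) =
      x $ i * (\<Prod>j\<in>UNIV. x $ j ^ lookup (\<kappa> - Poly_Mapping.single i 1) j)"
      if "\<kappa> \<in> keys F" for \<kappa>
      by (subst shift[OF that])
         (simp only: lookup_add power_add prod.distrib prod_power_single power_one_right)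
    thus ?thesis
      unfolding G_def eval_mpoly_sum eval_mpoly_single unfolding eval_mpoly_def sum_distrib_left
      by (intro sum.cong) (simp_all add: mult_ac)
  qed
  ultimately show ?thesis by blast
qed

section \<open>Hermitian forms and hyperbolic bases\<close>

definition vec4 :: "'b \<Rightarrow> 'b \<Rightarrow> 'b \<Rightarrow> 'b \<Rightarrow> 'b ^ 4" where
  "vec4 a b c d = (\<chi> i. if i = 1 then a else if i = 2 then b else if i = 3 then c else d)"

lemma vec4_nth [simp]:
  "vec4 a b c d $ 1 = a" "vec4 a b c d $ 2 = b" "vec4 a b c d $ 3 = c" "vec4 a b c d $ 4 = d"
  by (simp_all add: vec4_def)

definition comb :: "'b::semiring_1 ^ 'n \<Rightarrow> 'b ^ 'n \<Rightarrow> 'b ^ 'n \<Rightarrow> 'b ^ 'n \<Rightarrow> 'b \<Rightarrow> 'b \<Rightarrow> 'b \<Rightarrow> 'b \<Rightarrow> 'b ^ 'n::finite" where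
  "comb u1 u2 u3 u4 a b c d = a *s u1 + b *s u2 + c *s u3 + d *s u4"

lemma scale_comb:
  fixes u1 u2 u3 u4 :: "'b::comm_ring_1 ^ 'n"
  shows "k *s comb u1 u2 u3 u4 a b c d = comb u1 u2 u3 u4 (k * a) (k * b) (k * c) (k * d)"
  by (simp add: comb_def vec_eq_iff algebra_simps)

lemma add_comb:
  fixes u1 u2 u3 u4 :: "'b::comm_ring_1 ^ 'n"
  shows "comb u1 u2 u3 u4 a b c d + comb u1 u2 u3 u4 a' b' c' d' =
    comb u1 u2 u3 u4 (a + a') (b + b') (c + c') (d + d')"
  by (simp add: comb_def vec_eq_iff algebra_simps)

definition basis_mat :: "'b ^ 4 \<Rightarrow> 'b ^ 4 \<Rightarrow> 'b ^ 4 \<Rightarrow> 'b ^ 4 \<Rightarrow> 'b ^ 4 ^ 4" where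
  "basis_mat u1 u2 u3 u4 = (\<chi> i. vec4 (u1 $ i) (u2 $ i) (u3 $ i) (u4 $ i))"

lemma basis_mat_mult:
  fixes u1 u2 u3 u4 :: "'b::comm_semiring_1 ^ 4"
  shows "basis_mat u1 u2 u3 u4 *v x = comb u1 u2 u3 u4 (x $ 1) (x $ 2) (x $ 3) (x $ 4)"
  by (simp add: vec_eq_iff basis_mat_def matrix_vector_mult_def comb_def sum_4 mult_ac)

locale hermitian_surface = hermitian_field q ground
  for q and ground :: "'a::{field,finite} itself" +
  fixes A :: "'a ^ 4 ^ 4"
  assumes hermitian_A: "hermitian_matrix q A" and rank_A: "rank A = 4"
begin

text \<open>The Hermitian form of \<open>A\<close>: linear in the first argument, q-semilinear in
  the second.\<close>

definition bf :: "'a ^ 4 \<Rightarrow> 'a ^ 4 \<Rightarrow> 'a" where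
  "bf x y = (\<Sum>i\<in>UNIV. \<Sum>j\<in>UNIV. x $ i * A $ i $ j * (y $ j) ^ q)"

lemma A_pow_q: "(A $ i $ j) ^ q = A $ j $ i"
proof -
  have "transpose A $ i $ j = (\<chi> i j. (A $ i $ j) ^ q) $ i $ j"
    using hermitian_A by (simp add: hermitian_matrix_def)
  thus ?thesis by (simp add: transpose_def)
qed

lemma bf_add_left: "bf (x + y) z = bf x z + bf y z"
  by (simp add: bf_def algebra_simps sum.distrib)

lemma bf_add_right: "bf x (y + z) = bf x y + bf x z"
  by (simp add: bf_def add_pow_q algebra_simps sum.distrib)

lemma bf_scale_left: "bf (k *s x) y = k * bf x y"
  by (simp add: bf_def sum_distrib_left mult_ac)

lemma bf_scale_right: "bf x (k *s y) = k ^ q * bf x y"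
  by (simp add: bf_def sum_distrib_left power_mult_distrib mult_ac)

lemma bf_diff_left: "bf (x - y) z = bf x z - bf y z"
  using bf_add_left[of "x - y" y z] by simp

lemma bf_diff_right: "bf x (y - z) = bf x y - bf x z"
  using bf_add_right[of x "y - z" z] by simp

lemma bf_0_left [simp]: "bf 0 y = 0"
  by (simp add: bf_def)

lemma bf_0_right [simp]: "bf x 0 = 0"
  using q_ge_2 by (simp add: bf_def power_0_left)

lemma bf_commute: "bf y x = bf x y ^ q"
proof -
  have "bf x y ^ q = (\<Sum>i\<in>UNIV. \<Sum>j\<in>UNIV. (x $ i) ^ q * A $ j $ i * y $ j)"
    by (simp add: bf_def sum_pow_q power_mult_distrib A_pow_q)
  also have "\<dots> = bf y x"
    unfolding bf_def by (subst sum.swap) (simp add: mult_ac)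
  finally show ?thesis ..
qed

lemma bf_eq_0_commute: "bf y x = 0 \<longleftrightarrow> bf x y = 0"
  using q_ge_2 by (simp add: bf_commute[of y x])

lemma bf_eq_1_commute: "bf x y = 1 \<Longrightarrow> bf y x = 1"
  by (simp add: bf_commute[of y x])

lemma bf_self_pow_q: "bf x x ^ q = bf x x"
  using bf_commute[of x x] by simp

lemmas bf_simps = bf_add_left bf_add_right bf_diff_left bf_diff_right bf_scale_left bf_scale_right

lemma ex_right_inverse_A: "\<exists>B. A ** B = mat 1"
proof -
  have "vec.dim (rows A) = CARD(4)"
    using rank_A by (simp add: row_rank_def_gen)
  hence "vec.span (rows A) = UNIV"
    using vec_dim_card[where ?'n = 4 and ?'a = 'a]
    by (intro vec.dim_eq_full[THEN iffD1]) (simp add: vec.dimension_def)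
  thus ?thesis
    using matrix_left_invertible_span_rows_gen[of A] matrix_left_right_inverse by blast
qed

lemma bf_nondegenerate:
  assumes "\<And>y. bf x y = 0"
  shows "x = 0"
proof -
  obtain B where B: "A ** B = mat 1"
    using ex_right_inverse_A by blast
  have "(x v* A) $ j = bf x (axis j 1)" for j
  proof -
    have "bf x (axis j 1) = (\<Sum>i\<in>UNIV. \<Sum>k\<in>UNIV. if k = j then x $ i * A $ i $ j else 0)"
      unfolding bf_def using q_ge_2 by (intro sum.cong refl) (auto simp: axis_def power_0_left)
    thus ?thesis by (simp add: vector_matrix_mult_def mult_ac)
  qed
  hence "x v* A = 0"
    using assms by (simp add: vec_eq_iff)
  hence "x v* (A ** B) = 0"
    by (metis vector_matrix_mul_assoc vector_matrix_mult_0)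
  thus ?thesis using B by simp
qed

lemma ex_bf_eq_1:
  assumes "x \<noteq> 0"
  shows "\<exists>y. bf x y = 1"
proof -
  obtain y where y: "bf x y \<noteq> 0"
    using assms bf_nondegenerate by blast
  obtain k where k: "k ^ q = 1 / bf x y"
    using ex_power_q_eq by blast
  have "bf x (k *s y) = 1"
    using y by (simp add: bf_scale_right k)
  thus ?thesis ..
qed

text \<open>Adding \<open>s *s u\<close> to z adds the trace \<open>s ^ q + s\<close> to
  \<open>bf z z\<close>, and \<open>- bf z z\<close> is a trace because it is fixed by the q-power
  map.\<close>

lemma ex_isotropic_shift:
  assumes "bf u u = 0" "bf u z = 1"
  shows "\<exists>s. bf (z + s *s u) (z + s *s u) = 0 \<and> bf u (z + s *s u) = 1"
proof -
  obtain s where s: "s ^ q + s = - bf z z"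
    using ex_trace[of "- bf z z"] by (auto simp: minus_pow_q bf_self_pow_q)
  have "bf z u = 1"
    using assms bf_eq_1_commute by blast
  hence "bf (z + s *s u) (z + s *s u) = bf z z + (s ^ q + s)"
    using assms by (simp add: bf_simps algebra_simps)
  thus ?thesis
    using s assms by (intro exI[of _ s]) (simp add: bf_simps)
qed

text \<open>Every line over the ground field meets the surface: after orthogonalising,
  \<open>x + t *s z\<close> has value \<open>bf x x + (t * t ^ q) * bf z z\<close>, and surjectivity
  of the norm onto F_q provides t.\<close>

lemma ex_isotropic_in_span:
  assumes "x \<noteq> 0" "\<And>k. y \<noteq> k *s x"
  shows "\<exists>a b. a *s x + b *s y \<noteq> 0 \<and> bf (a *s x + b *s y) (a *s x + b *s y) = 0"
proof (cases "bf x x = 0")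
  case True
  with assms(1) show ?thesis
    by (intro exI[of _ 1] exI[of _ 0]) simp
next
  case False
  define c where "c = bf y x / bf x x"
  define z where "z = y - c *s x"
  have zx: "bf z x = 0"
    using False by (simp add: z_def bf_simps c_def)
  hence xz: "bf x z = 0"
    by (simp add: bf_eq_0_commute)
  have z: "z = (- c) *s x + 1 *s y"
    by (simp add: z_def vec_eq_iff)
  show ?thesis
  proof (cases "bf z z = 0")
    case True
    moreover have "z \<noteq> 0"
      using assms(2)[of c] by (simp add: z_def)
    ultimately show ?thesis
      unfolding z by blast
  next
    case False2: False
    obtain t where t: "t * t ^ q = - bf x x / bf z z"
      using ex_norm[of "- bf x x / bf z z"] by (auto simp: minus_pow_q power_divide bf_self_pow_q)
    define v where "v = x + t *s z"
    have "bf v v = bf x x + (t * t ^ q) * bf z z"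
      by (simp add: v_def bf_simps zx xz mult_ac)
    hence "bf v v = 0"
      using False2 by (simp add: t)
    moreover have "bf v x = bf x x"
      by (simp add: v_def bf_simps zx)
    hence "v \<noteq> 0"
      using False by auto
    moreover have "v = (1 - t * c) *s x + t *s y"
      by (simp add: v_def z_def vec_eq_iff algebra_simps)
    ultimately show ?thesis
      by metis
  qed
qed

text \<open>Two mutually orthogonal hyperbolic pairs, \<open>(u1, u3)\<close> and
  \<open>(u2, u4)\<close>. The span of \<open>u1\<close> and \<open>u2\<close> is a generator, and
  each vector has its dual in the other half of the basis.\<close>

definition hyperbolic :: "'a ^ 4 \<Rightarrow> 'a ^ 4 \<Rightarrow> 'a ^ 4 \<Rightarrow> 'a ^ 4 \<Rightarrow> bool" where
  "hyperbolic u1 u2 u3 u4 \<longleftrightarrow>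
     bf u1 u1 = 0 \<and> bf u2 u2 = 0 \<and> bf u3 u3 = 0 \<and> bf u4 u4 = 0 \<and>
     bf u1 u2 = 0 \<and> bf u1 u4 = 0 \<and> bf u2 u3 = 0 \<and> bf u3 u4 = 0 \<and> bf u1 u3 = 1 \<and> bf u2 u4 = 1"

lemma hyperbolicD:
  assumes "hyperbolic u1 u2 u3 u4"
  shows "bf u1 u1 = 0" "bf u2 u2 = 0" "bf u3 u3 = 0" "bf u4 u4 = 0"
    "bf u1 u2 = 0" "bf u1 u4 = 0" "bf u2 u3 = 0" "bf u3 u4 = 0" "bf u1 u3 = 1" "bf u2 u4 = 1"
    "bf u2 u1 = 0" "bf u4 u1 = 0" "bf u3 u2 = 0" "bf u4 u3 = 0" "bf u3 u1 = 1" "bf u4 u2 = 1"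
  using assms bf_eq_0_commute bf_eq_1_commute unfolding hyperbolic_def by blast+

lemma bf_comb:
  assumes "hyperbolic u1 u2 u3 u4"
  shows "bf (comb u1 u2 u3 u4 a b c d) (comb u1 u2 u3 u4 a' b' c' d') =
    a * c' ^ q + b * d' ^ q + c * a' ^ q + d * b' ^ q"
  by (simp add: comb_def bf_simps hyperbolicD[OF assms] algebra_simps)

lemma bf_comb_basis:
  assumes "hyperbolic u1 u2 u3 u4"
  shows "bf (comb u1 u2 u3 u4 a b c d) u1 = c" "bf (comb u1 u2 u3 u4 a b c d) u2 = d"
    "bf (comb u1 u2 u3 u4 a b c d) u3 = a" "bf (comb u1 u2 u3 u4 a b c d) u4 = b"
  by (simp_all add: comb_def bf_simps hyperbolicD[OF assms] algebra_simps)

lemma comb_eq_iff: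
  assumes "hyperbolic u1 u2 u3 u4"
  shows "comb u1 u2 u3 u4 a b c d = comb u1 u2 u3 u4 a' b' c' d' \<longleftrightarrow>
    a = a' \<and> b = b' \<and> c = c' \<and> d = d'"
  using bf_comb_basis[OF assms] by metis

lemma comb_eq_0_iff:
  assumes "hyperbolic u1 u2 u3 u4"
  shows "comb u1 u2 u3 u4 a b c d = 0 \<longleftrightarrow> a = 0 \<and> b = 0 \<and> c = 0 \<and> d = 0"
  using comb_eq_iff[OF assms, of a b c d 0 0 0 0] by (simp add: comb_def)

lemma ex_comb:
  assumes "hyperbolic u1 u2 u3 u4"
  shows "\<exists>a b c d. v = comb u1 u2 u3 u4 a b c d"
proof -
  have "inj (\<lambda>x. basis_mat u1 u2 u3 u4 *v x)"
    by (rule injI) (simp only: basis_mat_mult comb_eq_iff[OF assms], simp add: vec_eq_iff forall_4)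
  hence "surj (\<lambda>x. basis_mat u1 u2 u3 u4 *v x)"
    by (rule finite_UNIV_inj_surj[OF finite])
  then obtain x where "v = basis_mat u1 u2 u3 u4 *v x"
    by (metis surjE)
  thus ?thesis unfolding basis_mat_mult by blast
qed

lemma basis_mat_inverse:
  assumes "hyperbolic u1 u2 u3 u4"
  shows "\<exists>N. basis_mat u1 u2 u3 u4 ** N = mat 1 \<and> N ** basis_mat u1 u2 u3 u4 = mat 1"
proof -
  have "inj (\<lambda>x. basis_mat u1 u2 u3 u4 *v x)"
    by (rule injI) (simp only: basis_mat_mult comb_eq_iff[OF assms], simp add: vec_eq_iff forall_4)
  thus ?thesis
    by (metis matrix_left_invertible_injective matrix_left_right_inverse)
qed

text \<open>A vector v outside the span of x, u1 and u3 exists for dimension reasons; its projection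
  to the complement of the pair is the witness. With x = 0 and then with the x found, this gives two
  independent vectors in that complement.\<close>

lemma ex_orthogonal_not_multiple:
  assumes "bf u1 u1 = 0" "bf u3 u3 = 0" "bf u1 u3 = 1"
  shows "\<exists>y. bf y u1 = 0 \<and> bf y u3 = 0 \<and> (\<forall>k. y \<noteq> k *s x)"
proof -
  have "vec.dim (vec.span {x, u1, u3}) \<le> card {x, u1, u3}"
    by (simp add: vec.dim_le_card')
  also have "\<dots> \<le> 3"
    by (simp add: card_insert_if)
  finally have "vec.span {x, u1, u3} \<noteq> UNIV"
    using vec_dim_card[where ?'n = 4 and ?'a = 'a] by (auto simp del: vec.dim_span vec.dim_UNIV)
  then obtain v where v: "v \<notin> vec.span {x, u1, u3}"
    by auto
  define y where "y = v - bf v u3 *s u1 - bf v u1 *s u3"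
  have "bf u3 u1 = 1"
    using assms bf_eq_1_commute by blast
  hence "bf y u1 = 0" "bf y u3 = 0"
    using assms by (simp_all add: y_def bf_simps)
  moreover have "y \<noteq> k *s x" for k
  proof
    assume "y = k *s x"
    hence "v = k *s x + bf v u3 *s u1 + bf v u1 *s u3"
      by (simp add: y_def algebra_simps)
    also have "\<dots> \<in> vec.span {x, u1, u3}"
      by (intro vec.span_add vec.span_scale vec.span_base) auto
    finally show False using v by contradiction
  qed
  ultimately show ?thesis by blast
qed

text \<open>A vector dual to u2 is first projected to the complement of the given pair and then
  shifted along u2 to become isotropic.\<close>

lemma ex_hyperbolic_completion:
  assumes "bf u1 u1 = 0" "bf u3 u3 = 0" "bf u1 u3 = 1"
    and u2: "u2 \<noteq> 0" "bf u2 u2 = 0" "bf u2 u1 = 0" "bf u2 u3 = 0"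
  shows "\<exists>u4. hyperbolic u1 u2 u3 u4"
proof -
  have u31: "bf u3 u1 = 1"
    using assms bf_eq_1_commute by blast
  obtain z where z: "bf u2 z = 1"
    using ex_bf_eq_1 u2(1) by blast
  define y where "y = z - bf z u3 *s u1 - bf z u1 *s u3"
  have y: "bf y u1 = 0" "bf y u3 = 0" "bf u2 y = 1"
    using assms u31 z by (simp_all add: y_def bf_simps)
  obtain s where s: "bf (y + s *s u2) (y + s *s u2) = 0" "bf u2 (y + s *s u2) = 1"
    using ex_isotropic_shift[OF u2(2) y(3)] by blast
  have "bf (y + s *s u2) u1 = 0" "bf (y + s *s u2) u3 = 0"
    using y u2 by (simp_all add: bf_simps)
  hence "hyperbolic u1 u2 u3 (y + s *s u2)"
    using assms s bf_eq_0_commute unfolding hyperbolic_def by blast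
  thus ?thesis ..
qed

text \<open>The orthogonal complement of a hyperbolic pair contains a line, and every line contains
  an isotropic vector to start the second pair.\<close>

lemma ex_hyperbolic_of_pair:
  assumes "bf u1 u1 = 0" "bf u3 u3 = 0" "bf u1 u3 = 1"
  shows "\<exists>u2 u4. hyperbolic u1 u2 u3 u4"
proof -
  obtain x where x: "bf x u1 = 0" "bf x u3 = 0" "x \<noteq> 0"
    using ex_orthogonal_not_multiple[OF assms, of 0] by auto
  obtain y where y: "bf y u1 = 0" "bf y u3 = 0" "\<And>k. y \<noteq> k *s x"
    using ex_orthogonal_not_multiple[OF assms, of x] by auto
  obtain a b where ab: "a *s x + b *s y \<noteq> 0" "bf (a *s x + b *s y) (a *s x + b *s y) = 0"
    using ex_isotropic_in_span[OF x(3) y(3)] by blast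
  have "bf (a *s x + b *s y) u1 = 0" "bf (a *s x + b *s y) u3 = 0"
    using x y by (simp_all add: bf_simps)
  thus ?thesis
    using ex_hyperbolic_completion[OF assms ab] by blast
qed

lemma ex_hyperbolic_partner:
  assumes "u \<noteq> 0" "bf u u = 0"
  shows "\<exists>v. bf v v = 0 \<and> bf u v = 1"
  using ex_bf_eq_1[OF assms(1)] ex_isotropic_shift[OF assms(2)] by blast

lemma ex_hyperbolic_of_point:
  assumes "u1 \<noteq> 0" "bf u1 u1 = 0"
  shows "\<exists>u2 u3 u4. hyperbolic u1 u2 u3 u4"
  using ex_hyperbolic_partner[OF assms] ex_hyperbolic_of_pair[OF assms(2)] by blast

text \<open>Subtracting a multiple of u1 from y stays on the generator and achieves orthogonality to
  u3, which is all that the completion asks for.\<close>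

lemma ex_hyperbolic_of_generator:
  assumes "u1 \<noteq> 0" "bf u1 u1 = 0" "bf y y = 0" "bf y u1 = 0" "\<And>k. y \<noteq> k *s u1"
  shows "\<exists>a u3 u4. hyperbolic u1 (y - a *s u1) u3 u4"
proof -
  obtain u3 where u3: "bf u3 u3 = 0" "bf u1 u3 = 1"
    using ex_hyperbolic_partner[OF assms(1,2)] by blast
  let ?u2 = "y - bf y u3 *s u1"
  have "bf u1 y = 0"
    using assms(4) bf_eq_0_commute by blast
  hence "bf ?u2 ?u2 = 0" "bf ?u2 u1 = 0" "bf ?u2 u3 = 0"
    using assms u3 by (simp_all add: bf_simps)
  moreover have "?u2 \<noteq> 0"
    using assms(5)[of "bf y u3"] by simp
  ultimately show ?thesis
    using ex_hyperbolic_completion[OF assms(2) u3] by blast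
qed

lemma ex_isotropic: "\<exists>u. u \<noteq> 0 \<and> bf u u = 0"
proof -
  have "axis 2 1 \<noteq> k *s (axis 1 1 :: 'a ^ 4)" for k
    by (auto simp: vec_eq_iff axis_def forall_4)
  thus ?thesis
    using ex_isotropic_in_span[of "axis 1 1" "axis 2 1"] by (metis axis_eq_0_iff zero_neq_one)
qed

text \<open>Makes the point with parameter s of the generator the first basis vector without leaving
  the generator. The correction by \<open>s ^ q\<close> keeps the last vector orthogonal to the new
  first one.\<close>

lemma hyperbolic_change_infinity:
  assumes "hyperbolic u1 u2 u3 u4"
  shows "hyperbolic (s *s u1 + u2) u1 u4 (u3 - (s ^ q) *s u4)"
  unfolding hyperbolic_def by (simp add: bf_simps hyperbolicD[OF assms])

lemma hyperbolic_swap: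
  assumes "hyperbolic u1 u2 u3 u4"
  shows "hyperbolic u2 u1 u4 u3"
  unfolding hyperbolic_def by (simp add: hyperbolicD[OF assms])

text \<open>The ratio of the last two coordinates selects the plane through the generator. Once it
  is scaled to (1 : -s^q) or (0 : 1), the equation of the surface says that the remaining parameter
  w has trace 0.\<close>

lemma isotropic_normal_form:
  assumes h: "hyperbolic u1 u2 u3 u4" and v: "v \<noteq> 0" "bf v v = 0"
  shows "\<exists>k. k \<noteq> 0 \<and> (v = k *s comb u1 u2 u3 u4 1 0 0 0 \<or>
    (\<exists>s. v = k *s comb u1 u2 u3 u4 s 1 0 0) \<or>
    (\<exists>w\<in>W. \<exists>r. v = k *s comb u1 u2 u3 u4 r w 0 1) \<or>
    (\<exists>s. \<exists>w\<in>W. \<exists>r. v = k *s comb u1 u2 u3 u4 (w + r * s) r 1 (- (s ^ q))))"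
proof -
  obtain a b c d where vc: "v = comb u1 u2 u3 u4 a b c d"
    using ex_comb[OF h] by blast
  have eq: "a * c ^ q + b * d ^ q + c * a ^ q + d * b ^ q = 0"
    using v(2) bf_comb[OF h, of a b c d a b c d] by (simp add: vc)
  consider "c \<noteq> 0" | "c = 0" "d \<noteq> 0" | "c = 0" "d = 0" "b \<noteq> 0" | "c = 0" "d = 0" "b = 0" by blast
  thus ?thesis
  proof cases
    case 1
    obtain s where s: "s ^ q = - (d / c)"
      using ex_power_q_eq by blast
    define r where "r = b / c"
    define w where "w = a / c - r * s"
    have "s = - ((d / c) ^ q)"
      using arg_cong[OF s, of "\<lambda>x. x ^ q"] by (simp add: minus_pow_q)
    hence ds: "(d / c) ^ q = - s" by simp
    have "w ^ q + w = (a / c) ^ q + a / c + r * (d / c) ^ q + r ^ q * (d / c)"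
      by (simp add: w_def diff_pow_q power_mult_distrib s ds algebra_simps)
    also have "\<dots> = (a * c ^ q + b * d ^ q + c * a ^ q + d * b ^ q) / (c * c ^ q)"
      using 1 by (simp add: r_def power_divide field_simps)
    also have "\<dots> = 0" using eq by simp
    finally have "w \<in> W" by (simp add: W_def)
    moreover have "v = c *s comb u1 u2 u3 u4 (w + r * s) r 1 (- (s ^ q))"
      using 1 by (simp add: vc scale_comb w_def r_def s)
    ultimately show ?thesis using 1 by blast
  next
    case 2
    have "(b / d) ^ q + b / d = (a * c ^ q + b * d ^ q + c * a ^ q + d * b ^ q) / (d * d ^ q)"
      using 2 q_ge_2 by (simp add: power_divide field_simps)
    hence "b / d \<in> W" using eq by (simp add: W_def)
    moreover have "v = d *s comb u1 u2 u3 u4 (a / d) (b / d) 0 1"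
      using 2 by (simp add: vc scale_comb)
    ultimately show ?thesis using 2 by blast
  next
    case 3
    have "v = b *s comb u1 u2 u3 u4 (a / b) 1 0 0"
      using 3 by (simp add: vc scale_comb)
    thus ?thesis using 3 by blast
  next
    case 4
    have "v = a *s comb u1 u2 u3 u4 1 0 0 0"
      using 4 by (simp add: vc scale_comb)
    moreover have "a \<noteq> 0"
      using 4 v(1) by (auto simp: vc comb_def)
    ultimately show ?thesis by blast
  qed
qed

end

section \<open>The upper bound\<close>

lemma (in quaternary_form) line_zero_at_infinity:
  assumes "\<forall>s. g s 1 0 0 = 0"
  shows "g 1 0 0 0 = 0"
proof -
  have "line_poly = 0"
  proof (rule ccontr)
    assume "line_poly \<noteq> 0"
    hence "card (UNIV :: 'a set) \<le> degree line_poly"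
      by (rule card_poly_zeros_le) (use assms in \<open>simp add: poly_line_poly\<close>)
    also have "\<dots> \<le> q" using degree_line_poly d_le_q by simp
    also have "q < q ^ 2" using q_ge_2 by (simp add: power2_eq_square)
    finally show False using card_field by simp
  qed
  thus ?thesis using coeff_line_poly_d by simp
qed

section \<open>Rational points and their coordinate vectors\<close>

definition rat_point :: "'a::field ^ 'n \<Rightarrow> ('a alg_closure ^ 'n::finite) set" where
  "rat_point v = vec.span {ac_vec v}"

lemma ac_vec_scale: "ac_vec (k *s v) = to_ac k *s ac_vec v"
  by (simp add: vec_eq_iff)

lemma ac_vec_eq_0_iff [simp]: "ac_vec v = 0 \<longleftrightarrow> v = 0"
  by (simp add: vec_eq_iff)

lemma span_scale_eq:
  fixes x :: "'b::field ^ 'n"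
  assumes "k \<noteq> 0"
  shows "vec.span {k *s x} = vec.span {x}"
proof (rule subset_antisym)
  show "vec.span {k *s x} \<subseteq> vec.span {x}"
    by (intro vec.span_minimal) (auto intro: vec.span_scale vec.span_base)
  have "x = (1 / k) *s (k *s x)" using assms by simp
  hence "x \<in> vec.span {k *s x}"
    by (metis singletonI vec.span_base vec.span_scale)
  thus "vec.span {x} \<subseteq> vec.span {k *s x}"
    by (intro vec.span_minimal) auto
qed

lemma rat_point_eqI:
  assumes "k \<noteq> 0"
  shows "rat_point (k *s v) = rat_point v"
  unfolding rat_point_def ac_vec_scale by (rule span_scale_eq) (use assms in simp)

text \<open>The proportionality factor lives in the closure a priori, but it is a quotient of two
  coordinates from the ground field.\<close>

lemma rat_point_eqD:
  assumes "rat_point v = rat_point w" "w \<noteq> 0"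
  shows "\<exists>k. w = k *s v"
proof -
  have "ac_vec w \<in> rat_point v"
    using assms(1) by (simp add: rat_point_def vec.span_base)
  then obtain c where c: "ac_vec w = c *s ac_vec v"
    by (auto simp: rat_point_def vec.span_singleton)
  obtain i where i: "w $ i \<noteq> 0"
    using assms(2) by (auto simp: vec_eq_iff)
  have nth: "to_ac (w $ j) = c * to_ac (v $ j)" for j
    using c by (simp add: vec_eq_iff)
  have vi: "v $ i \<noteq> 0"
    using nth[of i] i by auto
  hence "c = to_ac (w $ i / v $ i)"
    using nth[of i] by simp
  hence "to_ac (w $ j) = to_ac (w $ i / v $ i * v $ j)" for j
    using nth[of j] by (simp only: to_ac_mult)
  hence "w $ j = (w $ i / v $ i) * v $ j" for j
    by (rule to_ac_eq_iff[THEN iffD1])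
  thus ?thesis
    unfolding vec_eq_iff vector_smult_component by blast
qed

lemma prod_4: "prod h (UNIV :: 4 set) = h 1 * (h 2 * (h 3 * h 4))"
  unfolding UNIV_4 by simp

context hermitian_surface
begin

definition zero_vectors :: "(4, 'a) mpoly \<Rightarrow> ('a ^ 4) set" where
  "zero_vectors F = {v. v \<noteq> 0 \<and> bf v v = 0 \<and> ground_eval F v = 0}"

definition point_count :: "(4, 'a) mpoly \<Rightarrow> nat" where
  "point_count F = card (rat_point ` zero_vectors F)"

definition max_count :: "nat \<Rightarrow> nat" where
  "max_count d = d * (q ^ 3 + q ^ 2 - q) + q + 1"

text \<open>The four normal forms of isotropic vectors give representatives covering all zeros; a
  covering suffices for an upper bound.\<close>

lemma point_count_le:
  assumes h: "hyperbolic u1 u2 u3 u4" and hom: "homogeneous d F"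
  defines "f \<equiv> \<lambda>a b c d. ground_eval F (comb u1 u2 u3 u4 a b c d)"
  shows "point_count F \<le> card {s. f s 1 0 0 = 0} + (if f 1 0 0 0 = 0 then 1 else 0) +
    (\<Sum>w\<in>W. card {r. f r w 0 1 = 0}) +
    (\<Sum>s\<in>UNIV. \<Sum>w\<in>W. card {r. f (w + r * s) r 1 (- (s ^ q)) = 0})"
proof -
  let ?c = "comb u1 u2 u3 u4"
  define E1 where "E1 = (if f 1 0 0 0 = 0 then {?c 1 0 0 0} else {})"
  define E2 where "E2 = (\<lambda>s. ?c s 1 0 0) ` {s. f s 1 0 0 = 0}"
  define E3 where "E3 = (\<Union>w\<in>W. (\<lambda>r. ?c r w 0 1) ` {r. f r w 0 1 = 0})"
  define E4 where "E4 = (\<Union>s\<in>UNIV. \<Union>w\<in>W. (\<lambda>r. ?c (w + r * s) r 1 (- (s ^ q))) ` {r. f (w + r * s) r 1 (- (s ^ q)) = 0})"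
  have "rat_point ` zero_vectors F \<subseteq> rat_point ` (E1 \<union> E2 \<union> E3 \<union> E4)"
  proof
    fix p assume "p \<in> rat_point ` zero_vectors F"
    then obtain v where v: "p = rat_point v" "v \<noteq> 0" "bf v v = 0" "ground_eval F v = 0"
      by (auto simp: zero_vectors_def)
    obtain k where k: "k \<noteq> 0" and alt: "v = k *s ?c 1 0 0 0 \<or>
      (\<exists>s. v = k *s ?c s 1 0 0) \<or> (\<exists>w\<in>W. \<exists>r. v = k *s ?c r w 0 1) \<or>
      (\<exists>s. \<exists>w\<in>W. \<exists>r. v = k *s ?c (w + r * s) r 1 (- (s ^ q)))"
      using isotropic_normal_form[OF h v(2,3)] by blast
    have zero: "ground_eval F v' = 0" if "v = k *s v'" for v'
      using v(4) k that ground_eval_scale[OF hom, of k v'] by simp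
    have "\<exists>v'\<in>E1 \<union> E2 \<union> E3 \<union> E4. v = k *s v'"
      using alt
    proof (elim disjE exE bexE)
      assume "v = k *s ?c 1 0 0 0"
      thus ?thesis using zero by (auto simp: E1_def f_def)
    next
      fix s assume "v = k *s ?c s 1 0 0"
      thus ?thesis using zero by (auto simp: E2_def f_def)
    next
      fix w r assume "w \<in> W" "v = k *s ?c r w 0 1"
      thus ?thesis using zero by (auto simp: E3_def f_def)
    next
      fix s w r assume *: "w \<in> W" "v = k *s ?c (w + r * s) r 1 (- (s ^ q))"
      hence "?c (w + r * s) r 1 (- (s ^ q)) \<in> E4"
        using zero by (force simp: E4_def f_def)
      thus ?thesis using * by blast
    qed
    thus "p \<in> rat_point ` (E1 \<union> E2 \<union> E3 \<union> E4)"
      using v(1) k rat_point_eqI by blast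
  qed
  hence "point_count F \<le> card (rat_point ` (E1 \<union> E2 \<union> E3 \<union> E4))"
    unfolding point_count_def by (intro card_mono) auto
  also have "\<dots> \<le> card (E1 \<union> E2 \<union> E3 \<union> E4)"
    by (rule card_image_le) simp
  also have "\<dots> \<le> card E1 + card E2 + card E3 + card E4"
    by (meson add_le_mono card_Un_le le_refl order.trans)
  also have "card E1 = (if f 1 0 0 0 = 0 then 1 else 0)"
    by (simp add: E1_def)
  finally have 0: "point_count F \<le> (if f 1 0 0 0 = 0 then 1 else 0) + card E2 + card E3 + card E4" .
  have 2: "card E2 \<le> card {s. f s 1 0 0 = 0}"
    unfolding E2_def by (rule card_image_le) simp
  have 3: "card E3 \<le> (\<Sum>w\<in>W. card {r. f r w 0 1 = 0})"
    unfolding E3_def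
    by (rule order.trans[OF card_UN_le]) (auto intro!: sum_mono card_image_le)
  have 4: "card E4 \<le> (\<Sum>s\<in>UNIV. \<Sum>w\<in>W. card {r. f (w + r * s) r 1 (- (s ^ q)) = 0})"
    unfolding E4_def
    by (rule order.trans[OF card_UN_le])
       (auto intro!: sum_mono card_image_le order.trans[OF card_UN_le])
  show ?thesis using 0 2 3 4 by linarith
qed

lemma ground_eval_basis_mat:
  "ground_eval (subst_mpoly (basis_mat u1 u2 u3 u4) F) v =
   ground_eval F (comb u1 u2 u3 u4 (v $ 1) (v $ 2) (v $ 3) (v $ 4))"
  by (simp add: ground_eval_subst basis_mat_mult)

text \<open>Transfers the counting results to F: the substituted polynomial \<open>G\<close>
  expresses F in the coordinates of the hyperbolic basis and instantiates the abstract family of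
  monomials.\<close>

lemma coordinates_count:
  assumes h: "hyperbolic u1 u2 u3 u4" and F: "F \<noteq> 0" and hom: "homogeneous d F"
    and d: "1 \<le> d" "d \<le> q"
  defines "f \<equiv> \<lambda>a b c d. ground_eval F (comb u1 u2 u3 u4 a b c d)"
  shows "\<forall>s. f s 1 0 0 = 0 \<Longrightarrow> f 1 0 0 0 = 0"
    and "\<forall>s. f s 1 0 0 = 0 \<Longrightarrow> \<exists>s. \<forall>w\<in>W. \<exists>r. f (w + r * s) r 1 (- (s ^ q)) \<noteq> 0"
    and "\<not> (\<forall>s. f s 1 0 0 = 0) \<Longrightarrow> \<forall>w\<in>W. \<exists>r. f r w 0 1 \<noteq> 0 \<Longrightarrow>
      \<forall>s. \<forall>w\<in>W. \<exists>r. f (w + r * s) r 1 (- (s ^ q)) \<noteq> 0 \<Longrightarrow> point_count F < max_count d"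
    and "\<forall>s. f s 1 0 0 = 0 \<Longrightarrow> \<forall>w\<in>W. \<exists>r. f r w 0 1 \<noteq> 0 \<Longrightarrow> point_count F \<le> max_count d"
    and "\<forall>s. f s 1 0 0 = 0 \<Longrightarrow> \<forall>w\<in>W. \<exists>r. f r w 0 1 \<noteq> 0 \<Longrightarrow> point_count F = max_count d \<Longrightarrow>
      (\<exists>s. \<forall>w\<in>W. \<forall>r. f (w + r * s) r 1 (- (s ^ q)) = 0) \<and>
      (d \<ge> 2 \<longrightarrow> (\<exists>s. card {w\<in>W. \<forall>r. f (w + r * s) r 1 (- (s ^ q)) = 0} = d - 1))"
proof -
  define G where "G = subst_mpoly (basis_mat u1 u2 u3 u4) F"
  have homG: "homogeneous d G"
    unfolding G_def by (rule homogeneous_subst_mpoly[OF hom])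
  have card_gt: "d < CARD('a)"
    using d q_ge_2 card_field by (simp add: power2_eq_square)
       (metis One_nat_def Suc_1 Suc_le_lessD le_less_trans n_less_m_mult_n less_le_trans zero_less_Suc)
  \<comment> \<open>That the substitution does not annihilate F is seen from a rational vector where
    F is nonzero, available because d < q^2.\<close>
  obtain v where "ground_eval F v \<noteq> 0"
    using ex_ground_eval_nonzero[OF F hom card_gt] by blast
  then obtain a b c e where "ground_eval F (comb u1 u2 u3 u4 a b c e) \<noteq> 0"
    using ex_comb[OF h, of v] by auto
  hence "ground_eval G (vec4 a b c e) \<noteq> 0"
    by (simp add: G_def ground_eval_basis_mat)
  hence "G \<noteq> 0"
    by (auto simp: ground_eval_def)
  let ?k = "\<lambda>i \<kappa>. lookup \<kappa> i"
  interpret Q: quaternary_form q ground d "keys G" "?k 1" "?k 2" "?k 3" "?k 4" "lookup G"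
  proof unfold_locales
    show "keys G \<noteq> {}"
      using \<open>G \<noteq> 0\<close> by simp
    show "inj_on (\<lambda>\<kappa>. (?k 1 \<kappa>, ?k 2 \<kappa>, ?k 3 \<kappa>, ?k 4 \<kappa>)) (keys G)"
    proof (rule inj_onI)
      fix \<kappa> \<mu> :: "4 \<Rightarrow>\<^sub>0 nat" assume "(?k 1 \<kappa>, ?k 2 \<kappa>, ?k 3 \<kappa>, ?k 4 \<kappa>) = (?k 1 \<mu>, ?k 2 \<mu>, ?k 3 \<mu>, ?k 4 \<mu>)"
      hence "\<forall>i. lookup \<kappa> i = lookup \<mu> i"
        by (simp add: forall_4)
      thus "\<kappa> = \<mu>"
        by (intro poly_mapping_eqI) simp
    qed
    show "?k 1 \<kappa> + ?k 2 \<kappa> + ?k 3 \<kappa> + ?k 4 \<kappa> = d" if "\<kappa> \<in> keys G" for \<kappa>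
      using homG that by (simp add: homogeneous_def sum_4)
    show "d \<le> q" by fact
  qed (auto simp: in_keys_iff)
  have g: "Q.g = f"
  proof (intro ext)
    fix y1 y2 y3 y4
    have "f y1 y2 y3 y4 = ground_eval G (vec4 y1 y2 y3 y4)"
      by (simp add: f_def G_def ground_eval_basis_mat)
    also have "\<dots> = Q.g y1 y2 y3 y4"
    proof -
      have "(\<Prod>i\<in>UNIV. vec4 y1 y2 y3 y4 $ i ^ ?k i \<kappa>) =
          y1 ^ ?k 1 \<kappa> * (y2 ^ ?k 2 \<kappa> * (y3 ^ ?k 3 \<kappa> * y4 ^ ?k 4 \<kappa>))" for \<kappa> :: "4 \<Rightarrow>\<^sub>0 nat"
        by (simp add: prod_4)
      thus ?thesis
        by (simp only: ground_eval_def Q.g_def mult.assoc)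
    qed
    finally show "Q.g y1 y2 y3 y4 = f y1 y2 y3 y4" ..
  qed
  have J: "Q.J s = {w\<in>W. \<forall>r. f (w + r * s) r 1 (- (s ^ q)) = 0}" for s
    by (auto simp: Q.J_def Q.gen_zeros_def g)
  have count: "point_count F \<le> Q.total_count"
    using point_count_le[OF h hom]
    unfolding Q.total_count_def Q.line_count_def Q.inf_zeros_def Q.gen_zeros_def g unfolding f_def .
  have inf: "(\<forall>w\<in>W. \<exists>r. f r w 0 1 \<noteq> 0) \<longleftrightarrow> (\<forall>w\<in>W. Q.inf_zeros w \<noteq> UNIV)"
    by (auto simp: Q.inf_zeros_def g)
  have J_empty: "Q.J s = {} \<longleftrightarrow> (\<forall>w\<in>W. \<exists>r. f (w + r * s) r 1 (- (s ^ q)) \<noteq> 0)" for s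
    by (auto simp: J)
  show "\<forall>s. f s 1 0 0 = 0 \<Longrightarrow> f 1 0 0 0 = 0"
    using Q.line_zero_at_infinity by (simp add: g)
  show "\<forall>s. f s 1 0 0 = 0 \<Longrightarrow> \<exists>s. \<forall>w\<in>W. \<exists>r. f (w + r * s) r 1 (- (s ^ q)) \<noteq> 0"
    using Q.ex_J_empty unfolding J_empty g .
  show "\<not> (\<forall>s. f s 1 0 0 = 0) \<Longrightarrow> \<forall>w\<in>W. \<exists>r. f r w 0 1 \<noteq> 0 \<Longrightarrow>
      \<forall>s. \<forall>w\<in>W. \<exists>r. f (w + r * s) r 1 (- (s ^ q)) \<noteq> 0 \<Longrightarrow> point_count F < max_count d"
    using Q.total_count_no_generator[OF d(1)] count unfolding inf g J_empty [symmetric] max_count_def by auto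
  show "point_count F \<le> max_count d" if "\<forall>s. f s 1 0 0 = 0" "\<forall>w\<in>W. \<exists>r. f r w 0 1 \<noteq> 0"
    using Q.total_count_generator(1) that count unfolding inf g max_count_def by fastforce
  assume *: "\<forall>s. f s 1 0 0 = 0" "\<forall>w\<in>W. \<exists>r. f r w 0 1 \<noteq> 0" "point_count F = max_count d"
  have "Q.total_count \<le> d * (q ^ 3 + q ^ 2 - q) + q + 1"
    by (rule Q.total_count_generator(1)) (use * inf in \<open>auto simp: g\<close>)
  hence "Q.total_count = d * (q ^ 3 + q ^ 2 - q) + q + 1"
    using count * by (simp add: max_count_def)
  hence "(\<exists>s. Q.J s = W) \<and> (d \<ge> 2 \<longrightarrow> (\<exists>s. card (Q.J s) = d - 1))"
    by (rule Q.total_count_generator(2)[rotated 2]) (use * inf in \<open>auto simp: g\<close>)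
  thus "(\<exists>s. \<forall>w\<in>W. \<forall>r. f (w + r * s) r 1 (- (s ^ q)) = 0) \<and>
      (d \<ge> 2 \<longrightarrow> (\<exists>s. card {w\<in>W. \<forall>r. f (w + r * s) r 1 (- (s ^ q)) = 0} = d - 1))"
    unfolding J by auto
qed

section \<open>Generators and full points in V(F)\<close>

definition generator :: "'a ^ 4 \<Rightarrow> 'a ^ 4 \<Rightarrow> bool" where
  "generator x y \<longleftrightarrow> x \<noteq> 0 \<and> bf x x = 0 \<and> bf y y = 0 \<and> bf y x = 0 \<and> (\<forall>k. y \<noteq> k *s x)"

definition contains_line :: "(4, 'a) mpoly \<Rightarrow> 'a ^ 4 \<Rightarrow> 'a ^ 4 \<Rightarrow> bool" where
  "contains_line F x y \<longleftrightarrow> (\<forall>a b. ground_eval F (a *s x + b *s y) = 0)"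

text \<open>The condition concerns only rational points of the Hermitian surface in the tangent
  plane at Q, as the counting supplies no more; that F vanishes on the rational points of the whole
  plane is derived from it later.\<close>

definition full :: "(4, 'a) mpoly \<Rightarrow> 'a ^ 4 \<Rightarrow> bool" where
  "full F Q \<longleftrightarrow> Q \<noteq> 0 \<and> bf Q Q = 0 \<and>
     (\<forall>v. bf v v = 0 \<longrightarrow> bf v Q = 0 \<longrightarrow> ground_eval F v = 0)"

lemma isotropic_generator_vector:
  assumes h: "hyperbolic u1 u2 u3 u4" and w: "w \<in> W"
  shows "bf (comb u1 u2 u3 u4 (w + r * s) r 1 (- (s ^ q))) (comb u1 u2 u3 u4 (w + r * s) r 1 (- (s ^ q))) = 0"
    and "bf (comb u1 u2 u3 u4 r w 0 1) (comb u1 u2 u3 u4 r w 0 1) = 0"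
  using w q_ge_2 unfolding bf_comb[OF h]
  by (simp_all add: W_iff add_pow_q minus_pow_q power_mult_distrib algebra_simps)

context
  fixes F :: "(4, 'a) mpoly" and d :: nat
  assumes F: "F \<noteq> 0" and hom: "homogeneous d F" and d: "1 \<le> d" "d \<le> q"
begin

text \<open>The q^2 zeros on the affine part exceed the degree, so the remaining point x is a zero
  as well.\<close>

lemma contains_lineI:
  assumes gen: "generator x y" and zero: "\<And>a. ground_eval F (a *s x + y) = 0"
  shows "contains_line F x y"
proof -
  obtain c u3 u4 where h: "hyperbolic x (y - c *s x) u3 u4"
    using ex_hyperbolic_of_generator gen unfolding generator_def by blast
  have "comb x (y - c *s x) u3 u4 s 1 0 0 = (s - c) *s x + y" for s
    by (simp add: comb_def vec_eq_iff algebra_simps)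
  hence "\<forall>s. ground_eval F (comb x (y - c *s x) u3 u4 s 1 0 0) = 0"
    using zero by (simp only:) simp
  hence "ground_eval F (comb x (y - c *s x) u3 u4 1 0 0 0) = 0"
    by (rule coordinates_count(1)[OF h F hom d])
  hence x: "ground_eval F x = 0"
    by (simp add: comb_def)
  have "ground_eval F (a *s x + b *s y) = 0" for a b
  proof (cases "b = 0")
    case True
    thus ?thesis using x ground_eval_scale[OF hom, of a x] by simp
  next
    case False
    hence "a *s x + b *s y = b *s ((a / b) *s x + y)"
      by (simp add: vec_eq_iff algebra_simps)
    thus ?thesis
      by (simp only: ground_eval_scale[OF hom] zero mult_zero_right)
  qed
  thus ?thesis by (simp add: contains_line_def)
qed

lemma point_count_less_no_generator:
  assumes no: "\<And>x y. generator x y \<Longrightarrow> \<not> contains_line F x y"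
  shows "point_count F < max_count d"
proof -
  obtain u1 where "u1 \<noteq> 0" "bf u1 u1 = 0"
    using ex_isotropic by blast
  then obtain u2 u3 u4 where h: "hyperbolic u1 u2 u3 u4"
    using ex_hyperbolic_of_point by blast
  let ?c = "comb u1 u2 u3 u4"
  have indep: "?c a b c e \<noteq> k *s ?c a' b' c' e'"
    if "\<not> (a = k * a' \<and> b = k * b' \<and> c = k * c' \<and> e = k * e')" for a b c e k a' b' c' e'
    using that by (simp add: scale_comb comb_eq_iff[OF h])
  have nonzero: "?c a b c e \<noteq> 0" if "\<not> (a = 0 \<and> b = 0 \<and> c = 0 \<and> e = 0)" for a b c e
    using that by (simp add: comb_eq_0_iff[OF h])
  have 1: "\<exists>s. ground_eval F (?c s 1 0 0) \<noteq> 0"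
  proof (rule ccontr)
    assume "\<not> ?thesis"
    moreover have "generator u1 u2"
      using indep[of 0 _ 1 1 0 0 0 0 0] nonzero[of 1 0 0 0]
      by (simp add: generator_def hyperbolicD[OF h] comb_def)
    ultimately show False
      using contains_lineI[of u1 u2] no[of u1 u2] by (simp add: comb_def)
  qed
  have 2: "\<exists>r. ground_eval F (?c r w 0 1) \<noteq> 0" if w: "w \<in> W" for w
  proof (rule ccontr)
    assume zero: "\<not> ?thesis"
    have gen: "generator (?c 1 0 0 0) (?c 0 w 0 1)"
      unfolding generator_def bf_comb[OF h]
      using indep[of 0 _ 1 w 0 0 0 1 0] nonzero[of 1 0 0 0] w q_ge_2
      by (simp add: W_iff power_0_left)
    have "a *s ?c 1 0 0 0 + ?c 0 w 0 1 = ?c a w 0 1" for a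
      by (simp add: comb_def algebra_simps)
    thus False using contains_lineI[OF gen] no[OF gen] zero by simp
  qed
  have 3: "\<exists>r. ground_eval F (?c (w + r * s) r 1 (- (s ^ q))) \<noteq> 0" if w: "w \<in> W" for w s
  proof (rule ccontr)
    assume zero: "\<not> ?thesis"
    have gen: "generator (?c s 1 0 0) (?c w 0 1 (- (s ^ q)))"
      unfolding generator_def bf_comb[OF h]
      using indep[of w _ s 0 1 1 0 "- (s ^ q)" 0] nonzero[of s 1 0 0] w q_ge_2
      by (simp add: W_iff power_0_left)
    have "a *s ?c s 1 0 0 + ?c w 0 1 (- (s ^ q)) = ?c (w + a * s) a 1 (- (s ^ q))" for a
      by (simp add: comb_def vec_eq_iff algebra_simps)
    thus False using contains_lineI[OF gen] no[OF gen] zero by simp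
  qed
  show ?thesis
    using coordinates_count(3)[OF h F hom d] 1 2 3 by blast
qed

text \<open>By the bound on the tangency orders some point of a generator in \<open>V(F)\<close> lies on no other such
  generator; it is taken as \<open>u1\<close>.\<close>
lemma ex_hyperbolic_good_infinity:
  assumes gen: "generator x y" and line: "contains_line F x y"
  shows "\<exists>u1 u2 u3 u4. hyperbolic u1 u2 u3 u4 \<and> (\<forall>a b. \<exists>a' b'. a *s u1 + b *s u2 = a' *s x + b' *s y) \<and>
    (\<forall>w\<in>W. \<exists>r. ground_eval F (comb u1 u2 u3 u4 r w 0 1) \<noteq> 0)"
proof -
  obtain c u3 u4 where h: "hyperbolic x (y - c *s x) u3 u4"
    using ex_hyperbolic_of_generator gen unfolding generator_def by blast
  let ?u2 = "y - c *s x"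
  have on_line: "a *s x + b *s ?u2 = (a - b * c) *s x + b *s y" for a b
    by (simp add: vec_eq_iff algebra_simps)
  have "comb x ?u2 u3 u4 s 1 0 0 = s *s x + 1 *s ?u2" for s
    by (simp add: comb_def)
  hence "\<forall>s. ground_eval F (comb x ?u2 u3 u4 s 1 0 0) = 0"
    using line by (simp only: on_line contains_line_def) simp
  then obtain s where s: "\<forall>w\<in>W. \<exists>r. ground_eval F (comb x ?u2 u3 u4 (w + r * s) r 1 (- (s ^ q))) \<noteq> 0"
    using coordinates_count(2)[OF h F hom d] by blast
  \<comment> \<open>In the new basis the generators at infinity are the old ones through the point
    with parameter s, none of which lies in V(F).\<close>
  have "comb (s *s x + ?u2) x u4 (u3 - (s ^ q) *s u4) r w 0 1 = comb x ?u2 u3 u4 (w + r * s) r 1 (- (s ^ q))" for r w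
    by (simp add: comb_def vec_eq_iff algebra_simps)
  moreover have "a *s (s *s x + ?u2) + b *s x = (a * s - a * c + b) *s x + a *s y" for a b
    by (simp add: vec_eq_iff algebra_simps)
  ultimately show ?thesis
    using hyperbolic_change_infinity[OF h, of s] s by metis
qed

lemma point_count_bound: "point_count F \<le> max_count d"
proof (cases "\<exists>x y. generator x y \<and> contains_line F x y")
  case True
  then obtain x y where xy: "generator x y" "contains_line F x y" by blast
  obtain u1 u2 u3 u4 where h: "hyperbolic u1 u2 u3 u4"
    and on_line: "\<forall>a b. \<exists>a' b'. a *s u1 + b *s u2 = a' *s x + b' *s y"
    and inf: "\<forall>w\<in>W. \<exists>r. ground_eval F (comb u1 u2 u3 u4 r w 0 1) \<noteq> 0"
    using ex_hyperbolic_good_infinity[OF xy] by blast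
  have "ground_eval F (comb u1 u2 u3 u4 s 1 0 0) = 0" for s
    using on_line[THEN spec, of s, THEN spec, of 1] xy(2) by (auto simp: comb_def contains_line_def)
  thus ?thesis
    using coordinates_count(4)[OF h F hom d] inf by blast
next
  case False
  thus ?thesis
    using point_count_less_no_generator by (meson less_imp_le)
qed

context
  assumes maximal: "point_count F = max_count d"
begin

lemma ex_generator: "\<exists>x y. generator x y \<and> contains_line F x y"
  using point_count_less_no_generator maximal by (metis less_irrefl)

text \<open>In the second part \<open>Y\<close> picks one point besides R on each of d generators
  through R, and its last property says that these lines meet only in R. That R is not full will
  separate R from the full points on them.\<close>

lemma generator_structure:
  assumes xy: "generator x y" "contains_line F x y"
  shows "\<exists>a b. full F (a *s x + b *s y)"
    and "d \<ge> 2 \<Longrightarrow> \<exists>a b Y. let R = a *s x + b *s y in R \<noteq> 0 \<and> bf R R = 0 \<and> \<not> full F R \<and> card Y = d \<and>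
      (\<forall>y'\<in>Y. generator R y' \<and> contains_line F R y') \<and>
      (\<forall>y'\<in>Y. \<forall>y''\<in>Y. y' \<noteq> y'' \<longrightarrow> (\<forall>a b a' b'. b \<noteq> 0 \<longrightarrow> a *s R + b *s y' \<noteq> a' *s R + b' *s y''))"
proof -
  obtain u1 u2 u3 u4 where h: "hyperbolic u1 u2 u3 u4"
    and on_line: "\<forall>a b. \<exists>a' b'. a *s u1 + b *s u2 = a' *s x + b' *s y"
    and inf: "\<forall>w\<in>W. \<exists>r. ground_eval F (comb u1 u2 u3 u4 r w 0 1) \<noteq> 0"
    using ex_hyperbolic_good_infinity[OF xy] by blast
  let ?c = "comb u1 u2 u3 u4"
  have zero_line: "ground_eval F (?c a b 0 0) = 0" for a b
    using on_line[THEN spec, of a, THEN spec, of b] xy(2) by (auto simp: comb_def contains_line_def)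
  note scale = scale_comb[of _ u1 u2 u3 u4] and c0 = comb_eq_0_iff[OF h]
  note add = add_comb[of u1 u2 u3 u4]
  define P where "P s = ?c s 1 0 0" for s
  define J where "J s = {w\<in>W. \<forall>r. ground_eval F (?c (w + r * s) r 1 (- (s ^ q))) = 0}" for s
  have P: "P s \<noteq> 0" "bf (P s) (P s) = 0" for s
    using q_ge_2 by (simp_all add: P_def c0 bf_comb[OF h] power_0_left)
  have fullI: "full F (P s)" if s: "J s = W" for s
    unfolding full_def
  proof (intro conjI allI impI P)
    fix v assume v: "bf v v = 0" "bf v (P s) = 0"
    show "ground_eval F v = 0"
    proof (cases "v = 0")
      case True
      thus ?thesis using zero_line[of 0 0] by (simp add: comb_def)
    next
      case False
      obtain k where k: "k \<noteq> 0" and alt: "v = k *s ?c 1 0 0 0 \<or>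
        (\<exists>s. v = k *s ?c s 1 0 0) \<or> (\<exists>w\<in>W. \<exists>r. v = k *s ?c r w 0 1) \<or>
        (\<exists>s. \<exists>w\<in>W. \<exists>r. v = k *s ?c (w + r * s) r 1 (- (s ^ q)))"
        using isotropic_normal_form[OF h False v(1)] by blast
      from alt show ?thesis
      proof (elim disjE exE bexE)
        fix w r assume "v = k *s ?c r w 0 1"
        hence "k = 0"
          using v(2) q_ge_2 by (simp add: P_def bf_scale_left bf_comb[OF h] power_0_left)
        with k show ?thesis by simp
      next
        fix t w r assume *: "w \<in> W" "v = k *s ?c (w + r * t) r 1 (- (t ^ q))"
        hence "s ^ q = t ^ q"
          using v(2) k q_ge_2 by (simp add: P_def bf_scale_left bf_comb[OF h] power_0_left)
        hence "t = s" by (simp add: pow_q_eq_iff)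
        with s * have "ground_eval F (?c (w + r * t) r 1 (- (t ^ q))) = 0"
          by (auto simp: J_def)
        thus ?thesis
          using * by (simp add: ground_eval_scale[OF hom])
      qed (simp_all add: scale zero_line)
    qed
  qed
  have not_full: "\<not> full F (P s)" if s: "J s \<noteq> W" for s
  proof
    assume "full F (P s)"
    obtain w r where w: "w \<in> W" "ground_eval F (?c (w + r * s) r 1 (- (s ^ q))) \<noteq> 0"
      using s by (auto simp: J_def)
    moreover have "bf (?c (w + r * s) r 1 (- (s ^ q))) (P s) = 0"
      using q_ge_2 by (simp add: P_def bf_comb[OF h] power_0_left)
    ultimately show False
      using \<open>full F (P s)\<close> isotropic_generator_vector[OF h w(1)] by (auto simp: full_def)
  qed
  have P_on: "\<exists>a b. P s = a *s x + b *s y" for s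
    using on_line[THEN spec, of s, THEN spec, of 1] by (simp add: P_def comb_def)
  have "(\<exists>s. J s = W) \<and> (d \<ge> 2 \<longrightarrow> (\<exists>s. card (J s) = d - 1))"
  proof -
    have "\<forall>s. ground_eval F (?c s 1 0 0) = 0"
      using zero_line by blast
    from coordinates_count(5)[OF h F hom d this inf maximal]
    obtain s where "\<forall>w\<in>W. \<forall>r. ground_eval F (?c (w + r * s) r 1 (- (s ^ q))) = 0"
      and 2: "d \<ge> 2 \<longrightarrow> (\<exists>s. card (J s) = d - 1)"
      unfolding J_def by blast
    hence "J s = W" by (auto simp: J_def)
    with 2 show ?thesis by blast
  qed
  hence Js: "\<exists>s. J s = W" "d \<ge> 2 \<Longrightarrow> \<exists>s. card (J s) = d - 1" by blast+
  show "\<exists>a b. full F (a *s x + b *s y)"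
    using Js(1) fullI P_on by metis
  assume "d \<ge> 2"
  then obtain s where s: "card (J s) = d - 1"
    using Js(2) by blast
  \<comment> \<open>The given generator contributes the point \<open>z0\<close>, and each of the d -
    1 generators labelled by \<open>J s\<close> its point with r = 0.\<close>
  define y' where "y' w = ?c w 0 1 (- (s ^ q))" for w
  define z0 where "z0 = ?c 1 0 0 0"
  define Y where "Y = insert z0 (y' ` J s)"
  have inj: "inj_on y' (J s)"
    by (rule inj_onI) (simp add: y'_def comb_eq_iff[OF h])
  have notin: "z0 \<notin> y' ` J s"
    by (auto simp: y'_def z0_def comb_eq_iff[OF h])
  have "card Y = d"
    using notin inj s \<open>d \<ge> 2\<close> by (simp add: Y_def card_image)
  moreover have "generator (P s) z \<and> contains_line F (P s) z" if z: "z \<in> Y" for z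
  proof (cases "z = z0")
    case True
    have "generator (P s) z"
      unfolding generator_def True using P[of s] q_ge_2
      by (auto simp: z0_def P_def scale bf_comb[OF h] comb_eq_iff[OF h] power_0_left)
    moreover have "contains_line F (P s) z"
      unfolding contains_line_def True by (simp add: z0_def P_def scale add zero_line)
    ultimately show ?thesis ..
  next
    case False
    then obtain w where w: "w \<in> J s" "z = y' w"
      using z by (auto simp: Y_def)
    have gen: "generator (P s) z"
      unfolding generator_def using P[of s] w q_ge_2
      by (simp add: P_def y'_def scale bf_comb[OF h] comb_eq_iff[OF h] power_0_left J_def W_iff)
    moreover have "contains_line F (P s) z"
      by (rule contains_lineI[OF gen]) (use w in \<open>simp add: P_def y'_def scale add add.commute J_def\<close>)
    ultimately show ?thesis ..
  qed
  moreover have "a *s P s + b *s z \<noteq> a' *s P s + b' *s z'" if zz: "z \<in> Y" "z' \<in> Y" "z \<noteq> z'" "b \<noteq> 0" for z z' a b a' b'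
  proof -
    consider "z = z0" "z' \<in> y' ` J s" | "z \<in> y' ` J s" "z' = z0" | "z \<in> y' ` J s" "z' \<in> y' ` J s"
      using zz(1-3) unfolding Y_def by blast
    thus ?thesis
      using zz(3,4) by cases (auto simp: z0_def P_def y'_def scale add comb_eq_iff[OF h])
  qed
  \<comment> \<open>Here d - 1 < q = \<open>card W\<close>, so the point is not full.\<close>
  moreover have "J s \<noteq> W"
    using s card_W d \<open>d \<ge> 2\<close> by auto
  ultimately show "\<exists>a b Y. let R = a *s x + b *s y in R \<noteq> 0 \<and> bf R R = 0 \<and> \<not> full F R \<and> card Y = d \<and>
      (\<forall>y'\<in>Y. generator R y' \<and> contains_line F R y') \<and>
      (\<forall>y'\<in>Y. \<forall>y''\<in>Y. y' \<noteq> y'' \<longrightarrow> (\<forall>a b a' b'. b \<noteq> 0 \<longrightarrow> a *s R + b *s y' \<noteq> a' *s R + b' *s y''))"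
    using P_on[of s] P[of s] not_full[of s] unfolding Let_def by metis
qed

end

end

end

section \<open>Full points and linear factors\<close>

lemma coeff_mult_top:
  fixes p r :: "'b::comm_semiring_1 poly"
  assumes "degree p \<le> m" "degree r \<le> n"
  shows "coeff (p * r) (m + n) = coeff p m * coeff r n"
proof -
  have "coeff (p * r) (m + n) = (\<Sum>i\<le>m + n. coeff p i * coeff r (m + n - i))"
    by (simp add: coeff_mult)
  also have "\<dots> = (\<Sum>i\<in>{m}. coeff p i * coeff r (m + n - i))"
  proof (rule sum.mono_neutral_right)
    show "\<forall>i\<in>{..m + n} - {m}. coeff p i * coeff r (m + n - i) = 0"
    proof
      fix i assume "i \<in> {..m + n} - {m}"
      hence "m < i \<or> n < m + n - i" by auto
      thus "coeff p i * coeff r (m + n - i) = 0"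
        using assms by (auto simp: coeff_eq_0)
    qed
  qed auto
  finally show ?thesis by simp
qed

lemma linear_power_top:
  fixes a b :: "'b::comm_semiring_1"
  shows "degree ([:a, b:] ^ n) \<le> n \<and> coeff ([:a, b:] ^ n) n = b ^ n"
proof (induction n)
  case (Suc n)
  have d: "degree [:a, b:] \<le> 1" by simp
  have "degree ([:a, b:] * [:a, b:] ^ n) \<le> 1 + n"
    using Suc d by (intro order.trans[OF degree_mult_le] add_mono) auto
  moreover have "coeff ([:a, b:] * [:a, b:] ^ n) (1 + n) = b * b ^ n"
    using Suc by (subst coeff_mult_top[OF d]) auto
  ultimately show ?case by simp
qed simp

lemma prod_top:
  fixes p :: "'i \<Rightarrow> 'b::comm_semiring_1 poly"
  assumes "\<And>i. i \<in> I \<Longrightarrow> degree (p i) \<le> n i"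
  shows "degree (\<Prod>i\<in>I. p i) \<le> (\<Sum>i\<in>I. n i) \<and>
    coeff (\<Prod>i\<in>I. p i) (\<Sum>i\<in>I. n i) = (\<Prod>i\<in>I. coeff (p i) (n i))"
  using assms
proof (induction I rule: infinite_finite_induct)
  case (insert i I)
  have d: "degree (p i) \<le> n i" "degree (prod p I) \<le> sum n I"
    using insert by auto
  have "degree (p i * prod p I) \<le> n i + sum n I"
    using d by (intro order.trans[OF degree_mult_le] add_mono) auto
  moreover have "coeff (p i * prod p I) (n i + sum n I) =
      coeff (p i) (n i) * (\<Prod>i\<in>I. coeff (p i) (n i))"
    using insert by (subst coeff_mult_top[OF d]) auto
  ultimately show ?case using insert by simp
qed auto

text \<open>The value at the point y at infinity is the coefficient of t^d, so that a zero at y can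
  be counted as a drop in degree.\<close>

lemma ground_eval_on_line:
  fixes F :: "('n::finite, 'a::field) mpoly"
  assumes hom: "homogeneous d F"
  shows "\<exists>p. degree p \<le> d \<and> coeff p d = ground_eval F y \<and>
    (\<forall>t. poly p t = ground_eval F (x + t *s y))"
proof -
  define T where "T \<kappa> = (\<Prod>i\<in>UNIV. [:x $ i, y $ i:] ^ lookup \<kappa> i)" for \<kappa>
  define p where "p = (\<Sum>\<kappa>\<in>keys F. smult (lookup F \<kappa>) (T \<kappa>))"
  have T: "degree (T \<kappa>) \<le> d \<and> coeff (T \<kappa>) d = (\<Prod>i\<in>UNIV. y $ i ^ lookup \<kappa> i)"
    if "\<kappa> \<in> keys F" for \<kappa>
  proof -
    have "d = (\<Sum>i\<in>UNIV. lookup \<kappa> i)"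
      using hom that by (simp add: homogeneous_def)
    thus ?thesis
      unfolding T_def using prod_top[of UNIV "\<lambda>i. [:x $ i, y $ i:] ^ lookup \<kappa> i" "lookup \<kappa>"]
      by (simp add: linear_power_top)
  qed
  have "degree p \<le> d"
    unfolding p_def using T by (intro degree_sum_le order.trans[OF degree_smult_le]) auto
  moreover have "coeff p d = ground_eval F y"
    by (simp add: p_def coeff_sum ground_eval_def T)
  moreover have "poly p t = ground_eval F (x + t *s y)" for t
    by (simp add: p_def poly_sum T_def poly_prod ground_eval_def)
  ultimately show ?thesis by blast
qed

lemma ground_eval_line_zeros:
  fixes F :: "('n::finite, 'a::field) mpoly"
  assumes hom: "homogeneous d F" and M: "d < card M" "\<And>t. t \<in> M \<Longrightarrow> ground_eval F (x + t *s y) = 0"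
  shows "ground_eval F (x + t *s y) = 0"
proof -
  obtain p where p: "degree p \<le> d" "\<And>t. poly p t = ground_eval F (x + t *s y)"
    using ground_eval_on_line[OF hom] by blast
  have "p = 0"
    using card_poly_zeros_le[of p M] p M by fastforce
  thus ?thesis using p(2)[of t] by simp
qed

context hermitian_surface
begin

definition tangent_coeffs :: "'a ^ 4 \<Rightarrow> 'a ^ 4" where
  "tangent_coeffs Q = (\<chi> i. \<Sum>j\<in>UNIV. A $ i $ j * (Q $ j) ^ q)"

text \<open>The extension of the linear form \<open>\<lambda>v. bf v Q\<close> to the algebraic
  closure; it cuts out the tangent plane at Q.\<close>

definition tangent_form :: "'a ^ 4 \<Rightarrow> 'a alg_closure ^ 4 \<Rightarrow> 'a alg_closure" where
  "tangent_form Q x = (\<Sum>i\<in>UNIV. to_ac (tangent_coeffs Q $ i) * x $ i)"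

lemma bf_eq_tangent_coeffs: "bf v Q = (\<Sum>i\<in>UNIV. tangent_coeffs Q $ i * v $ i)"
  by (simp add: bf_def tangent_coeffs_def sum_distrib_left sum_distrib_right mult_ac)

lemma tangent_form_ac_vec: "tangent_form Q (ac_vec v) = to_ac (bf v Q)"
  by (simp add: tangent_form_def bf_eq_tangent_coeffs to_ac_sum)

definition vanishes_on_plane :: "(4, 'a) mpoly \<Rightarrow> 'a ^ 4 \<Rightarrow> bool" where
  "vanishes_on_plane F Q \<longleftrightarrow> (\<forall>v. bf v Q = 0 \<longrightarrow> ground_eval F v = 0)"

text \<open>A line of the plane through u2 and not through Q meets the q + 1 generators through Q in
  distinct zeros: u2 itself and one for each element of \<open>W\<close>. That is more than d, so F
  vanishes on the line.\<close>

lemma full_vanishes_on_plane: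
  assumes full: "full F Q" and hom: "homogeneous d F" and d: "1 \<le> d" "d \<le> q"
  shows "vanishes_on_plane F Q"
  unfolding vanishes_on_plane_def
proof (intro allI impI)
  fix v assume v: "bf v Q = 0"
  obtain u2 u3 u4 where h: "hyperbolic Q u2 u3 u4"
    using full ex_hyperbolic_of_point unfolding full_def by blast
  let ?c = "comb Q u2 u3 u4"
  have zero: "ground_eval F (?c a b 0 e) = 0" if "bf (?c a b 0 e) (?c a b 0 e) = 0" for a b e
    using full that bf_comb_basis(1)[OF h, of a b 0 e] by (auto simp: full_def)
  have u2: "ground_eval F (?c 0 1 0 0) = 0"
    using q_ge_2 by (intro zero) (simp add: bf_comb[OF h] power_0_left)
  have one: "ground_eval F (?c r t 0 1) = 0" for r t
  proof -
    have line: "?c r t 0 1 = ?c r 0 0 1 + t *s ?c 0 1 0 0" for t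
      by (simp add: comb_def algebra_simps)
    obtain p where p: "degree p \<le> d" "coeff p d = ground_eval F (?c 0 1 0 0)"
        "\<And>t. poly p t = ground_eval F (?c r 0 0 1 + t *s ?c 0 1 0 0)"
      using ground_eval_on_line[OF hom] by blast
    have "p = 0"
    proof (rule ccontr)
      assume "p \<noteq> 0"
      hence "degree p \<noteq> d"
        using p(2) u2 by (metis leading_coeff_0_iff)
      moreover have "card W \<le> degree p"
      proof (rule card_poly_zeros_le[OF \<open>p \<noteq> 0\<close>])
        fix w assume "w \<in> W"
        hence "ground_eval F (?c r w 0 1) = 0"
          using q_ge_2 by (intro zero) (simp add: bf_comb[OF h] power_0_left W_iff)
        thus "poly p w = 0" by (simp only: p(3) line[symmetric])
      qed
      ultimately show False using p(1) d card_W by simp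
    qed
    thus ?thesis using p(3)[of t] unfolding line[of t] by simp
  qed
  obtain a b c e where vc: "v = ?c a b c e"
    using ex_comb[OF h] by blast
  hence "c = 0" using v bf_comb_basis(1)[OF h] by simp
  show "ground_eval F v = 0"
  proof (cases "e = 0")
    case True
    thus ?thesis
      using \<open>c = 0\<close> q_ge_2 unfolding vc by (simp add: zero bf_comb[OF h] power_0_left)
  next
    case False
    hence "v = e *s ?c (a / e) (b / e) 0 1"
      using \<open>c = 0\<close> by (simp add: vc comb_def vec_eq_iff algebra_simps)
    thus ?thesis by (simp only: ground_eval_scale[OF hom] one mult_zero_right)
  qed
qed

text \<open>In a hyperbolic basis starting with Q the tangent plane is given by the third
  coordinate, so the claim reduces to dividing by a variable.\<close>

lemma divide_by_tangent_form:
  assumes Q: "Q \<noteq> 0" "bf Q Q = 0" and van: "vanishes_on_plane F Q"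
    and hom: "homogeneous d F" and d: "d < CARD('a)"
  shows "\<exists>F'. homogeneous (d - 1) F' \<and> (\<forall>x. eval_mpoly F x = tangent_form Q x * eval_mpoly F' x)"
proof -
  obtain u2 u3 u4 where h: "hyperbolic Q u2 u3 u4"
    using Q ex_hyperbolic_of_point by blast
  let ?M = "basis_mat Q u2 u3 u4"
  obtain N where N: "?M ** N = mat 1"
    using basis_mat_inverse[OF h] by blast
  have "ground_eval (subst_mpoly ?M F) v = 0" if "v $ 3 = 0" for v :: "'a ^ 4"
    using van that bf_comb_basis(1)[OF h] by (simp add: ground_eval_basis_mat vanishes_on_plane_def)
  then obtain G where G: "homogeneous (d - 1) G" "\<And>x. eval_mpoly (subst_mpoly ?M F) x = x $ 3 * eval_mpoly G x"
    using eval_mpoly_divide_variable[OF homogeneous_subst_mpoly[OF hom] d, of 3 ?M] by auto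
  \<comment> \<open>The third row of the inverse basis matrix consists of the coefficients of the
    tangent form, because pairing with Q reads off the third coordinate.\<close>
  have form: "(ac_mat N *v x) $ 3 = tangent_form Q x" for x
  proof -
    have "(N *v v) $ 3 = bf v Q" for v
    proof -
      have "v = ?M *v (N *v v)"
        by (simp add: matrix_vector_mul_assoc N)
      hence "bf v Q = bf (?M *v (N *v v)) Q" by simp
      thus ?thesis
        by (simp add: basis_mat_mult bf_comb_basis(1)[OF h])
    qed
    hence "(N *v axis i 1) $ 3 = bf (axis i 1) Q" for i by blast
    hence "N $ 3 $ i = tangent_coeffs Q $ i" for i
      by (simp add: matrix_vector_mult_def bf_eq_tangent_coeffs axis_def if_distrib cong: if_cong)
    thus ?thesis
      by (simp add: matrix_vector_mult_def tangent_form_def ac_mat_def)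
  qed
  have "eval_mpoly F x = tangent_form Q x * eval_mpoly (subst_mpoly N G) x" for x
  proof -
    have "eval_mpoly F x = eval_mpoly F (ac_mat ?M *v (ac_mat N *v x))"
      by (simp add: matrix_vector_mul_assoc N ac_mat_1 flip: ac_mat_mult)
    also have "\<dots> = eval_mpoly (subst_mpoly ?M F) (ac_mat N *v x)"
      by (simp only: eval_subst_mpoly)
    also have "\<dots> = tangent_form Q x * eval_mpoly (subst_mpoly N G) x"
      by (subst G(2)) (simp only: form eval_subst_mpoly)
    finally show ?thesis .
  qed
  thus ?thesis using homogeneous_subst_mpoly[OF G(1)] by blast
qed

lemma ground_eval_factor:
  assumes "\<And>x. eval_mpoly F x = tangent_form Q x * eval_mpoly F' x"
  shows "ground_eval F v = bf v Q * ground_eval F' v"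
proof -
  have "to_ac (ground_eval F v) = to_ac (bf v Q * ground_eval F' v)"
    using assms[of "ac_vec v"] by (simp add: eval_mpoly_ac_vec tangent_form_ac_vec)
  thus ?thesis by (simp only: to_ac_eq_iff)
qed

text \<open>A point is recovered from its polar plane: orthogonality to Q', u2 and u4 removes all
  coordinates of Q except the one along Q'.\<close>

lemma rat_point_eq_of_perp_subset:
  assumes Q: "Q \<noteq> 0" and Q': "bf Q' Q' = 0" "Q' \<noteq> 0" and sub: "\<And>y. bf y Q' = 0 \<Longrightarrow> bf y Q = 0"
  shows "rat_point Q = rat_point Q'"
proof -
  obtain u2 u3 u4 where h: "hyperbolic Q' u2 u3 u4"
    using Q' ex_hyperbolic_of_point by blast
  obtain a b c e where Qc: "Q = comb Q' u2 u3 u4 a b c e"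
    using ex_comb[OF h] by blast
  have "bf Q Q' = 0" "bf Q u2 = 0" "bf Q u4 = 0"
    using sub hyperbolicD[OF h] bf_eq_0_commute by blast+
  hence "c = 0" "e = 0" "b = 0"
    using bf_comb_basis[OF h] by (simp_all add: Qc)
  hence "Q = a *s Q'" by (simp add: Qc comb_def)
  moreover from this have "a \<noteq> 0" using Q by auto
  ultimately show ?thesis using rat_point_eqI by metis
qed

text \<open>Outside the plane of Q the factor \<open>bf v Q\<close> can be cancelled. A point in
  both planes is joined to a point y of the second plane only; the q^2 - 1 other affine points of
  that line are zeros, more than the degree n.\<close>

lemma vanishes_on_plane_cofactor:
  assumes Q: "bf Q Q = 0" "Q \<noteq> 0" and Q': "bf Q' Q' = 0" "Q' \<noteq> 0" and neq: "rat_point Q \<noteq> rat_point Q'"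
    and van: "vanishes_on_plane F Q'" and hom: "homogeneous n F'" "n + 1 < CARD('a)"
    and factor: "\<And>v. ground_eval F v = bf v Q * ground_eval F' v"
  shows "vanishes_on_plane F' Q'"
proof -
  have off: "ground_eval F' v = 0" if "bf v Q' = 0" "bf v Q \<noteq> 0" for v
    using van that factor[of v] by (simp add: vanishes_on_plane_def)
  have "\<exists>y. bf y Q' = 0 \<and> bf y Q \<noteq> 0"
    using rat_point_eq_of_perp_subset[OF Q(2) Q'] neq by blast
  then obtain y where y: "bf y Q' = 0" "bf y Q \<noteq> 0" by blast
  show ?thesis
    unfolding vanishes_on_plane_def
  proof (intro allI impI)
    fix v assume v: "bf v Q' = 0"
    show "ground_eval F' v = 0"
    proof (cases "bf v Q = 0")
      case True
      have "ground_eval F' (v + 0 *s y) = 0"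
      proof (rule ground_eval_line_zeros[OF hom(1), of "UNIV - {0}"])
        show "n < card (UNIV - {0 :: 'a})"
          using hom(2) by (simp add: card_Diff_singleton)
        fix t :: 'a assume "t \<in> UNIV - {0}"
        thus "ground_eval F' (v + t *s y) = 0"
          using True v y by (intro off) (simp_all add: bf_simps)
      qed
      thus ?thesis by simp
    next
      case False
      thus ?thesis using off v by blast
    qed
  qed
qed

text \<open>The linear forms are split off one at a time, the cofactor inheriting the vanishing on
  the remaining planes. Injectivity of \<open>rat_point\<close> makes these planes distinct.\<close>

lemma factor_tangent_planes:
  assumes "finite M" "inj_on rat_point M"
    and "\<And>Q. Q \<in> M \<Longrightarrow> Q \<noteq> 0 \<and> bf Q Q = 0 \<and> vanishes_on_plane F Q"
    and "homogeneous d F" "d < CARD('a)" "\<exists>v. ground_eval F v \<noteq> 0"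
  shows "card M \<le> d \<and> (\<exists>F'. homogeneous (d - card M) F' \<and>
    (\<forall>x. eval_mpoly F x = (\<Prod>Q\<in>M. tangent_form Q x) * eval_mpoly F' x))"
  using assms
proof (induction M arbitrary: F d rule: finite_induct)
  case empty
  thus ?case by auto
next
  case (insert Q M)
  note hom = insert.prems(3) and lt = insert.prems(4)
  have Q: "Q \<noteq> 0" "bf Q Q = 0" "vanishes_on_plane F Q"
    using insert.prems(2) by auto
  obtain F' where F': "homogeneous (d - 1) F'" "\<And>x. eval_mpoly F x = tangent_form Q x * eval_mpoly F' x"
    using divide_by_tangent_form[OF Q hom lt] by blast
  have factor: "ground_eval F v = bf v Q * ground_eval F' v" for v
    using ground_eval_factor F'(2) by blast
  obtain v where v: "ground_eval F v \<noteq> 0"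
    using insert.prems(5) by blast
  have "d \<noteq> 0"
  proof
    assume "d = 0"
    hence "ground_eval F (0 *s v) = ground_eval F v"
      using ground_eval_scale[OF hom, of 0 v] by simp
    moreover have "ground_eval F (0 *s v) = 0"
      using Q(3) by (simp add: vanishes_on_plane_def)
    ultimately show False using v by simp
  qed
  have IH: "card M \<le> d - 1 \<and> (\<exists>G. homogeneous (d - 1 - card M) G \<and>
    (\<forall>x. eval_mpoly F' x = (\<Prod>Q\<in>M. tangent_form Q x) * eval_mpoly G x))"
  proof (rule insert.IH)
    show "inj_on rat_point M" using insert.prems(1) by simp
    show "homogeneous (d - 1) F'" by fact
    show "d - 1 < CARD('a)" using lt by simp
    show "\<exists>v. ground_eval F' v \<noteq> 0" using v factor[of v] by auto
    fix Q' assume Q': "Q' \<in> M"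
    hence "Q' \<noteq> 0" "bf Q' Q' = 0" "vanishes_on_plane F Q'"
      using insert.prems(2) by auto
    moreover have "rat_point Q \<noteq> rat_point Q'"
      using insert.prems(1) insert.hyps(2) Q' by (auto simp: inj_on_def)
    ultimately show "Q' \<noteq> 0 \<and> bf Q' Q' = 0 \<and> vanishes_on_plane F' Q'"
      using vanishes_on_plane_cofactor[OF Q(2,1) _ _ _ _ F'(1) _ factor] lt \<open>d \<noteq> 0\<close> by auto
  qed
  then obtain G where G: "homogeneous (d - 1 - card M) G"
    "\<And>x. eval_mpoly F' x = (\<Prod>Q\<in>M. tangent_form Q x) * eval_mpoly G x" by blast
  have "eval_mpoly F x = (\<Prod>Q\<in>insert Q M. tangent_form Q x) * eval_mpoly G x" for x
    using insert.hyps by (simp add: F'(2) G(2) mult_ac)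
  moreover have "d - card (insert Q M) = d - 1 - card M" "card (insert Q M) \<le> d"
    using insert.hyps IH \<open>d \<noteq> 0\<close> by auto
  ultimately show ?case using G(1) by metis
qed

context
  fixes F :: "(4, 'a) mpoly" and d :: nat
  assumes F: "F \<noteq> 0" and hom: "homogeneous d F" and d: "1 \<le> d" "d \<le> q"
begin

lemma degree_less_card: "d < CARD('a)"
proof -
  have "q < q ^ 2" using q_ge_2 by (simp add: power2_eq_square)
  thus ?thesis using d card_field by simp
qed

text \<open>Distinct full points give distinct linear factors of F; \<open>M\<close> chooses one
  vector for each of them.\<close>

lemma card_full_le: "card (rat_point ` {Q. full F Q}) \<le> d"
proof -
  obtain M where M: "M \<subseteq> {Q. full F Q}" "inj_on rat_point M" "rat_point ` {Q. full F Q} = rat_point ` M"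
    using subset_image_inj[of "rat_point ` {Q. full F Q}" rat_point "{Q. full F Q}"] by auto
  have "card M \<le> d"
    using factor_tangent_planes[OF finite M(2) _ hom degree_less_card ex_ground_eval_nonzero[OF F hom degree_less_card]]
      M(1) full_vanishes_on_plane[OF _ hom d] by (auto simp: full_def)
  thus ?thesis using M(2,3) by (simp add: card_image)
qed

lemma full_scale:
  assumes "full F (k *s Q)" "k \<noteq> 0"
  shows "full F Q"
  using assms q_ge_2 unfolding full_def by (auto simp: bf_simps)

context
  assumes maximal: "point_count F = max_count d"
begin

text \<open>Each of the d generators through R carries a full point, different from R since R is not
  full. These d points are distinct, so by the bound d they are all the full points, and each is
  orthogonal to R as it shares a generator with R.\<close>

lemma generator_secant_point:
  assumes xy: "generator x y" "contains_line F x y" and d2: "d \<ge> 2"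
  shows "\<exists>a b. let R = a *s x + b *s y in bf R R = 0 \<and> \<not> full F R \<and> R \<noteq> 0 \<and>
    (\<forall>Q. full F Q \<longrightarrow> bf R Q = 0) \<and> card (rat_point ` {Q. full F Q}) = d"
proof -
  obtain a b Y where *: "let R = a *s x + b *s y in R \<noteq> 0 \<and> bf R R = 0 \<and> \<not> full F R \<and> card Y = d \<and>
      (\<forall>y'\<in>Y. generator R y' \<and> contains_line F R y') \<and>
      (\<forall>y'\<in>Y. \<forall>y''\<in>Y. y' \<noteq> y'' \<longrightarrow> (\<forall>a b a' b'. b \<noteq> 0 \<longrightarrow> a *s R + b *s y' \<noteq> a' *s R + b' *s y''))"
    using generator_structure(2)[OF F hom d maximal xy d2] by blast
  define R where "R = a *s x + b *s y"
  have R: "R \<noteq> 0" "bf R R = 0" "\<not> full F R" "card Y = d"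
    and gen: "\<And>y'. y' \<in> Y \<Longrightarrow> generator R y'" "\<And>y'. y' \<in> Y \<Longrightarrow> contains_line F R y'"
    and dist: "\<And>y' y'' a b a' b'. y' \<in> Y \<Longrightarrow> y'' \<in> Y \<Longrightarrow> y' \<noteq> y'' \<Longrightarrow> b \<noteq> 0 \<Longrightarrow>
      a *s R + b *s y' \<noteq> a' *s R + b' *s y''"
    using * unfolding R_def Let_def by auto
  have "\<exists>a b. full F (a *s R + b *s y') \<and> b \<noteq> 0" if y': "y' \<in> Y" for y'
  proof -
    obtain a b where ab: "full F (a *s R + b *s y')"
      using generator_structure(1)[OF F hom d maximal gen[OF y']] by blast
    have "b \<noteq> 0"
    proof
      assume "b = 0"
      hence "full F (a *s R)" using ab by simp
      moreover from this have "a \<noteq> 0" by (auto simp: full_def)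
      ultimately show False using full_scale R(3) by blast
    qed
    with ab show ?thesis by blast
  qed
  then obtain a' b' where ab': "\<And>y'. y' \<in> Y \<Longrightarrow> full F (a' y' *s R + b' y' *s y') \<and> b' y' \<noteq> 0"
    by metis
  define Qf where "Qf y' = a' y' *s R + b' y' *s y'" for y'
  have Qf: "full F (Qf y')" "Qf y' \<noteq> 0" if "y' \<in> Y" for y'
    using ab'[OF that] by (auto simp: Qf_def full_def)
  have "inj_on (\<lambda>y'. rat_point (Qf y')) Y"
  proof (rule inj_onI, rule ccontr)
    fix y' y'' assume yy: "y' \<in> Y" "y'' \<in> Y" "rat_point (Qf y') = rat_point (Qf y'')" "y' \<noteq> y''"
    obtain k where "Qf y' = k *s Qf y''"
      using rat_point_eqD[OF yy(3)[symmetric] Qf(2)[OF yy(1)]] by blast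
    hence "a' y' *s R + b' y' *s y' = (k * a' y'') *s R + (k * b' y'') *s y''"
      by (simp add: Qf_def vec_eq_iff algebra_simps)
    thus False using dist[OF yy(1,2,4)] ab'[OF yy(1)] by blast
  qed
  hence card: "card (rat_point ` Qf ` Y) = d"
    using R(4) by (simp add: card_image image_image)
  have sub: "rat_point ` Qf ` Y \<subseteq> rat_point ` {Q. full F Q}"
    using Qf by auto
  hence eq: "rat_point ` Qf ` Y = rat_point ` {Q. full F Q}"
    using card card_full_le by (intro card_seteq) auto
  have "bf R Q = 0" if Q: "full F Q" for Q
  proof -
    have "rat_point Q \<in> rat_point ` Qf ` Y"
      unfolding eq using Q by blast
    then obtain y' where y': "y' \<in> Y" "rat_point (Qf y') = rat_point Q"
      by auto
    then obtain k where k: "Q = k *s Qf y'"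
      using rat_point_eqD Q unfolding full_def by blast
    have "bf y' R = 0"
      using gen(1)[OF y'(1)] by (simp add: generator_def)
    hence "bf R y' = 0" by (simp add: bf_eq_0_commute)
    thus ?thesis using R(2) by (simp add: k Qf_def bf_simps)
  qed
  thus ?thesis
    using R card eq unfolding R_def Let_def by metis
qed

lemma full_contains_line:
  assumes "full F Q" "bf y Q = 0" "bf y y = 0"
  shows "contains_line F Q y"
proof -
  have "bf Q y = 0" using assms(2) by (simp add: bf_eq_0_commute)
  thus ?thesis
    using assms unfolding contains_line_def full_def by (simp add: bf_simps)
qed

lemma maximal_structure:
  shows "\<exists>R R'. bf R R = 0 \<and> bf R' R' = 0 \<and> bf R R' \<noteq> 0 \<and>
    (\<forall>Q. full F Q \<longrightarrow> bf R Q = 0 \<and> bf R' Q = 0) \<and> card (rat_point ` {Q. full F Q}) = d"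
proof -
  obtain x y where "generator x y" "contains_line F x y"
    using ex_generator[OF F hom d maximal] by blast
  then obtain Q where Q: "full F Q"
    using generator_structure(1)[OF F hom d maximal] by blast
  then obtain u2 u3 u4 where h: "hyperbolic Q u2 u3 u4"
    using ex_hyperbolic_of_point unfolding full_def by blast
  have Q0: "Q \<noteq> 0" using Q by (simp add: full_def)
  show ?thesis
  proof (cases "d \<ge> 2")
    case True
    have "u2 \<noteq> k *s Q" "u4 \<noteq> k *s Q" for k
      using hyperbolicD[OF h] by (metis bf_scale_left mult_zero_right zero_neq_one, metis bf_scale_left mult_zero_right zero_neq_one)
    hence gens: "generator Q u2" "generator Q u4"
      using hyperbolicD[OF h] Q0 by (simp_all add: generator_def)
    have lines: "contains_line F Q u2" "contains_line F Q u4"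
      using full_contains_line[OF Q] hyperbolicD[OF h] by auto
    obtain a b where R: "bf (a *s Q + b *s u2) (a *s Q + b *s u2) = 0" "\<not> full F (a *s Q + b *s u2)"
        "a *s Q + b *s u2 \<noteq> 0" "\<forall>P. full F P \<longrightarrow> bf (a *s Q + b *s u2) P = 0"
        and card: "card (rat_point ` {Q. full F Q}) = d"
      using generator_secant_point[OF gens(1) lines(1) True] unfolding Let_def by blast
    obtain a' b' where R': "bf (a' *s Q + b' *s u4) (a' *s Q + b' *s u4) = 0" "\<not> full F (a' *s Q + b' *s u4)"
        "a' *s Q + b' *s u4 \<noteq> 0" "\<forall>P. full F P \<longrightarrow> bf (a' *s Q + b' *s u4) P = 0"
      using generator_secant_point[OF gens(2) lines(2) True] unfolding Let_def by blast
    have multiple: "full F (k *s Q)" if "k \<noteq> 0" for k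
      using full_scale[of "1 / k" "k *s Q"] Q that by simp
    \<comment> \<open>Neither point is Q, which is full; so both have a component outside Q, and
      their product \<open>b * b' ^ q\<close> is nonzero.\<close>
    have "b \<noteq> 0" "b' \<noteq> 0"
      using R(2,3) R'(2,3) multiple by auto
    moreover have "bf (a *s Q + b *s u2) (a' *s Q + b' *s u4) = b * b' ^ q"
      by (simp add: bf_simps hyperbolicD[OF h])
    ultimately show ?thesis
      using R R' card by (metis mult_eq_0_iff power_eq_0_iff)
  next
    case False
    \<comment> \<open>With a single plane there is no second kind of point to use; u2 and u4,
      non-orthogonal points of the plane, span a secant line in it.\<close>
    hence d1: "d = 1" using d by simp
    have "rat_point Q \<in> rat_point ` {Q. full F Q}" using Q by blast
    hence eq: "rat_point ` {Q. full F Q} = {rat_point Q}"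
      using card_full_le d1 by (intro card_seteq[symmetric]) auto
    have "bf u2 P = 0 \<and> bf u4 P = 0" if P: "full F P" for P
    proof -
      have "rat_point P = rat_point Q" using eq P by blast
      then obtain k where "P = k *s Q"
        using rat_point_eqD[of Q P] P by (auto simp: full_def)
      thus ?thesis by (simp add: bf_simps hyperbolicD[OF h])
    qed
    moreover have "card (rat_point ` {Q. full F Q}) = d"
      using eq d1 by simp
    ultimately show ?thesis
      using hyperbolicD[OF h] by (metis zero_neq_one)
  qed
qed

end

end

end

section \<open>Tangent planes and secant lines over the algebraic closure\<close>

lemma partial_deriv_superset:
  assumes "finite S" "keys F \<subseteq> S"
  shows "partial_deriv i F = (\<Sum>\<kappa>\<in>S. Poly_Mapping.single (\<kappa> - Poly_Mapping.single i 1)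
    (of_nat (lookup \<kappa> i) * lookup F \<kappa>))"
  unfolding partial_deriv_def using assms
  by (intro sum.mono_neutral_left) (auto simp: in_keys_iff)

lemma partial_deriv_add: "partial_deriv i (F + G) = partial_deriv i F + partial_deriv i G"
proof -
  let ?S = "keys F \<union> keys G"
  have "keys (F + G) \<subseteq> ?S"
    by (rule Poly_Mapping.keys_add)
  thus ?thesis
    by (simp add: partial_deriv_superset[of ?S] lookup_add distrib_left single_add sum.distrib)
qed

lemma partial_deriv_sum: "partial_deriv i (\<Sum>j\<in>I. F j) = (\<Sum>j\<in>I. partial_deriv i (F j))"
proof (induction I rule: infinite_finite_induct)
  case (insert j I)
  thus ?case by (simp add: partial_deriv_add)
qed (simp_all add: partial_deriv_def)

lemma partial_deriv_single:
  "partial_deriv i (Poly_Mapping.single \<kappa> c) =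
    Poly_Mapping.single (\<kappa> - Poly_Mapping.single i 1) (of_nat (lookup \<kappa> i) * c)"
  by (simp add: partial_deriv_superset[of "{\<kappa>}"])

lemma proj_pointE:
  assumes "p \<in> proj_space"
  obtains x where "x \<noteq> 0" "p = vec.span {x}"
proof -
  have p: "vec.subspace p" "vec.dim p = 1"
    using assms by (auto simp: proj_space_def)
  obtain B where B: "B \<subseteq> p" "vec.independent B" "p \<subseteq> vec.span B" "card B = vec.dim p"
    using vec.basis_exists by blast
  then obtain x where x: "B = {x}"
    using p by (auto simp: card_1_singleton_iff)
  have "vec.span B \<subseteq> p"
    using B(1) p(1) by (rule vec.span_minimal)
  with B x that show thesis by auto
qed

lemma span_in_proj_space: "x \<noteq> 0 \<Longrightarrow> vec.span {x} \<in> proj_space"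
  by (simp add: proj_space_def)

lemma rat_point_in_proj_space: "v \<noteq> 0 \<Longrightarrow> rat_point v \<in> proj_space"
  by (simp add: rat_point_def span_in_proj_space)

lemma ac_vec_eq_iff [simp]: "ac_vec v = ac_vec w \<longleftrightarrow> v = w"
  by (simp add: vec_eq_iff)

context hermitian_surface
begin

abbreviation H_poly :: "(4, 'a) mpoly" where "H_poly \<equiv> hermitian_poly q A"

text \<open>The extension of \<open>bf\<close> to the closure. It is no longer Hermitian, since the
  q-power map is not an involution there; additivity and semilinear scaling remain.\<close>

definition kf :: "'a alg_closure ^ 4 \<Rightarrow> 'a alg_closure ^ 4 \<Rightarrow> 'a alg_closure" where
  "kf x y = (\<Sum>i\<in>UNIV. \<Sum>j\<in>UNIV. x $ i * to_ac (A $ i $ j) * (y $ j) ^ q)"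

lemma kf_add_left: "kf (x + y) z = kf x z + kf y z"
  by (simp add: kf_def algebra_simps sum.distrib)

lemma kf_add_right: "kf x (y + z) = kf x y + kf x z"
  by (simp add: kf_def add_power_q algebra_simps sum.distrib)

lemma kf_scale_left: "kf (k *s x) y = k * kf x y"
  by (simp add: kf_def sum_distrib_left mult_ac)

lemma kf_scale_right: "kf x (k *s y) = k ^ q * kf x y"
  by (simp add: kf_def sum_distrib_left power_mult_distrib mult_ac)

lemmas kf_simps = kf_add_left kf_add_right kf_scale_left kf_scale_right

lemma kf_ac_vec: "kf x (ac_vec Q) = tangent_form Q x"
  by (simp add: kf_def tangent_form_def tangent_coeffs_def to_ac_sum sum_distrib_left sum_distrib_right mult_ac)

lemma kf_ac_vec_ac_vec: "kf (ac_vec v) (ac_vec w) = to_ac (bf v w)"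
  by (simp add: kf_ac_vec tangent_form_ac_vec)

lemma eval_H_poly: "eval_mpoly H_poly x = kf x x"
  by (simp add: eval_hermitian_poly kf_def)

lemma tangent_form_add: "tangent_form Q (x + y) = tangent_form Q x + tangent_form Q y"
  by (simp add: tangent_form_def algebra_simps sum.distrib)

lemma tangent_form_scale: "tangent_form Q (k *s x) = k * tangent_form Q x"
  by (simp add: tangent_form_def sum_distrib_left mult_ac)

text \<open>The factor x_j^q has derivative 0 because q is 0 in the field, so only the linear factor
  is differentiated.\<close>

lemma eval_partial_deriv_H_poly:
  "eval_mpoly (partial_deriv i H_poly) x = (\<Sum>j\<in>UNIV. to_ac (A $ i $ j) * (x $ j) ^ q)"
proof -
  have q0: "(of_nat q :: 'a) = 0"
    by (rule of_nat_q_eq_0) simp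
  have "eval_mpoly (partial_deriv i (Poly_Mapping.single (Poly_Mapping.single a 1 + Poly_Mapping.single b q) (A $ a $ b))) x =
      (if a = i then to_ac (A $ i $ b) * (x $ b) ^ q else 0)" for a b
  proof (cases "a = i")
    case True
    have "Poly_Mapping.single i 1 + Poly_Mapping.single b q - Poly_Mapping.single i 1 = Poly_Mapping.single b q"
      by (rule add_diff_cancel_left')
    \<comment> \<open>For b = i the exponent is q + 1, which equals 1 in the field.\<close>
    moreover have "of_nat (lookup (Poly_Mapping.single i 1 + Poly_Mapping.single b q) i) = (1 :: 'a)"
      using q0 by (simp add: lookup_add lookup_single when_def)
    ultimately show ?thesis
      using True by (simp only: partial_deriv_single eval_mpoly_single prod_power_single) simp
  next
    case False
    hence "of_nat (lookup (Poly_Mapping.single a 1 + Poly_Mapping.single b q) i) = (0 :: 'a)"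
      using q0 by (simp add: lookup_add lookup_single when_def)
    thus ?thesis
      using False by (simp only: partial_deriv_single eval_mpoly_single) simp
  qed
  hence "eval_mpoly (partial_deriv i H_poly) x =
      (\<Sum>a\<in>UNIV. \<Sum>b\<in>UNIV. if a = i then to_ac (A $ i $ b) * (x $ b) ^ q else 0)"
    by (simp only: hermitian_poly_def partial_deriv_sum eval_mpoly_sum)
  also have "\<dots> = (\<Sum>a\<in>UNIV. if a = i then (\<Sum>b\<in>UNIV. to_ac (A $ i $ b) * (x $ b) ^ q) else 0)"
    by (intro sum.cong) auto
  finally show ?thesis by simp
qed

lemma tangent_space_eq: "tangent_space H_poly p = {r \<in> proj_space. \<forall>x\<in>p. \<forall>y\<in>r. kf y x = 0}"
proof -
  have "(\<Sum>i\<in>UNIV. eval_mpoly (partial_deriv i H_poly) x * y $ i) = kf y x" for x y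
    by (simp add: eval_partial_deriv_H_poly kf_def sum_distrib_left sum_distrib_right mult_ac)
  thus ?thesis by (simp add: tangent_space_def)
qed

definition tangent_at :: "'a ^ 4 \<Rightarrow> ('a alg_closure ^ 4) set set" where
  "tangent_at Q = {r \<in> proj_space. \<forall>y\<in>r. tangent_form Q y = 0}"

lemma tangent_space_rat_point: "tangent_space H_poly (rat_point Q) = tangent_at Q"
proof -
  have "(\<forall>x\<in>rat_point Q. kf y x = 0) \<longleftrightarrow> tangent_form Q y = 0" for y
  proof
    assume "\<forall>x\<in>rat_point Q. kf y x = 0"
    thus "tangent_form Q y = 0"
      by (auto simp: rat_point_def vec.span_base simp flip: kf_ac_vec)
  next
    assume "tangent_form Q y = 0"
    thus "\<forall>x\<in>rat_point Q. kf y x = 0"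
      by (auto simp: rat_point_def vec.span_singleton kf_scale_right kf_ac_vec)
  qed
  thus ?thesis
    unfolding tangent_space_eq tangent_at_def by blast
qed

lemma span_in_proj_zeros_iff:
  assumes "x \<noteq> 0"
  shows "vec.span {x} \<in> proj_zeros H_poly \<longleftrightarrow> kf x x = 0"
proof
  assume "vec.span {x} \<in> proj_zeros H_poly"
  thus "kf x x = 0"
    by (auto simp: proj_zeros_def vec.span_base simp flip: eval_H_poly)
next
  assume "kf x x = 0"
  thus "vec.span {x} \<in> proj_zeros H_poly"
    using assms span_in_proj_space[of x]
    by (auto simp: proj_zeros_def vec.span_singleton eval_H_poly kf_simps)
qed

lemma rat_point_in_proj_zeros_iff:
  assumes "v \<noteq> 0"
  shows "rat_point v \<in> proj_zeros H_poly \<longleftrightarrow> bf v v = 0"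
  using assms by (simp add: rat_point_def span_in_proj_zeros_iff kf_ac_vec_ac_vec)

lemma rat_point_in_tangent_at_iff:
  assumes "v \<noteq> 0"
  shows "rat_point v \<in> tangent_at Q \<longleftrightarrow> bf v Q = 0"
proof
  assume "rat_point v \<in> tangent_at Q"
  hence "tangent_form Q (ac_vec v) = 0"
    by (auto simp: tangent_at_def rat_point_def vec.span_base)
  thus "bf v Q = 0" by (simp add: tangent_form_ac_vec)
next
  assume "bf v Q = 0"
  thus "rat_point v \<in> tangent_at Q"
    using rat_point_in_proj_space[OF assms]
    by (auto simp: tangent_at_def rat_point_def vec.span_singleton tangent_form_scale tangent_form_ac_vec)
qed

lemma rational_points_alt: "rational_points Y = {p \<in> Y. \<exists>v. v \<noteq> 0 \<and> p = rat_point v}"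
  by (simp add: rational_points_def rat_point_def ac_vec_def)

lemma rational_points_zeros:
  assumes hom: "homogeneous d F"
  shows "rational_points (proj_zeros F \<inter> proj_zeros H_poly) = rat_point ` zero_vectors F"
proof -
  have "rat_point v \<in> proj_zeros F \<longleftrightarrow> ground_eval F v = 0" if "v \<noteq> 0" for v
  proof
    assume "rat_point v \<in> proj_zeros F"
    hence "eval_mpoly F (ac_vec v) = 0"
      by (auto simp: proj_zeros_def rat_point_def vec.span_base)
    thus "ground_eval F v = 0" by (simp add: eval_mpoly_ac_vec)
  next
    assume "ground_eval F v = 0"
    thus "rat_point v \<in> proj_zeros F"
      using rat_point_in_proj_space[OF that]
      by (auto simp: proj_zeros_def rat_point_def vec.span_singleton eval_mpoly_scale[OF hom] eval_mpoly_ac_vec)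
  qed
  thus ?thesis
    unfolding rational_points_alt zero_vectors_def using rat_point_in_proj_zeros_iff by blast
qed

text \<open>The inverse of the basis matrix has entries in the ground field, so a hyperbolic basis
  stays a basis over the closure; coordinates are read off with the tangent forms of the dual
  vectors.\<close>

lemma ac_coordinates:
  assumes h: "hyperbolic u1 u2 u3 u4"
  shows "x = comb (ac_vec u1) (ac_vec u2) (ac_vec u3) (ac_vec u4)
    (tangent_form u3 x) (tangent_form u4 x) (tangent_form u1 x) (tangent_form u2 x)"
proof -
  obtain N where N: "basis_mat u1 u2 u3 u4 ** N = mat 1"
    using basis_mat_inverse[OF h] by blast
  have m: "ac_mat (basis_mat u1 u2 u3 u4) = basis_mat (ac_vec u1) (ac_vec u2) (ac_vec u3) (ac_vec u4)"
    by (simp add: vec_eq_iff forall_4 ac_mat_def basis_mat_def)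
  define y where "y = ac_mat N *v x"
  have "x = ac_mat (basis_mat u1 u2 u3 u4) *v y"
    by (simp add: y_def matrix_vector_mul_assoc N ac_mat_1 flip: ac_mat_mult)
  hence x: "x = comb (ac_vec u1) (ac_vec u2) (ac_vec u3) (ac_vec u4) (y $ 1) (y $ 2) (y $ 3) (y $ 4)"
    by (simp only: m basis_mat_mult)
  have "tangent_form u3 x = y $ 1" "tangent_form u4 x = y $ 2" "tangent_form u1 x = y $ 3" "tangent_form u2 x = y $ 4"
    unfolding x comb_def
    by (simp_all add: tangent_form_add tangent_form_scale tangent_form_ac_vec hyperbolicD[OF h])
  thus ?thesis using x by simp
qed

lemma hyperbolic_distinct:
  assumes "hyperbolic u1 u2 u3 u4"
  shows "u1 \<noteq> u2" "u1 \<noteq> u3" "u1 \<noteq> u4" "u2 \<noteq> u3" "u2 \<noteq> u4" "u3 \<noteq> u4"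
  using hyperbolicD[OF assms] by auto

lemma ac_independent:
  assumes h: "hyperbolic u1 u2 u3 u4"
  shows "vec.independent {ac_vec u1, ac_vec u2, ac_vec u3, ac_vec u4}"
proof -
  let ?B = "{ac_vec u1, ac_vec u2, ac_vec u3, ac_vec u4}"
  have "x \<in> vec.span ?B" for x
    by (subst ac_coordinates[OF h, of x], unfold comb_def)
       (intro vec.span_add vec.span_scale vec.span_base, simp_all)
  hence span: "vec.span ?B = UNIV" by blast
  have dim: "vec.dim (UNIV :: ('a alg_closure ^ 4) set) = 4"
    using vec_dim_card[where ?'n = 4 and ?'a = "'a alg_closure"] by simp
  have le: "card ?B \<le> 4"
    by (simp add: card_insert_if)
  show "vec.independent ?B"
    by (rule vec.card_le_dim_spanning[of _ UNIV]) (use span dim le in simp_all)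
qed

lemma tangent_form_kernel_subspace:
  "vec.subspace {x. tangent_form Q x = 0}"
  by (rule vec.subspaceI) (simp_all add: tangent_form_add tangent_form_scale, simp add: tangent_form_def)

lemma tangent_plane_span:
  assumes h: "hyperbolic u1 u2 u3 u4"
  shows "{x. tangent_form u1 x = 0} = vec.span {ac_vec u1, ac_vec u2, ac_vec u4}"
    and "vec.dim {x. tangent_form u1 x = 0} = 3"
proof -
  let ?B = "{ac_vec u1, ac_vec u2, ac_vec u4}"
  have "x \<in> vec.span ?B" if "tangent_form u1 x = 0" for x
  proof -
    have "x = tangent_form u3 x *s ac_vec u1 + tangent_form u4 x *s ac_vec u2 + tangent_form u2 x *s ac_vec u4"
      using ac_coordinates[OF h, of x] that by (simp add: comb_def)
    also have "\<dots> \<in> vec.span ?B"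
      by (intro vec.span_add vec.span_scale vec.span_base) simp_all
    finally show ?thesis .
  qed
  moreover have "vec.span ?B \<subseteq> {x. tangent_form u1 x = 0}"
    by (rule vec.span_minimal[OF _ tangent_form_kernel_subspace])
       (auto simp: tangent_form_ac_vec hyperbolicD[OF h])
  ultimately show eq: "{x. tangent_form u1 x = 0} = vec.span ?B"
    by blast
  have "vec.independent ?B"
    by (rule contrapos_nn[OF ac_independent[OF h]], erule vec.dependent_mono) auto
  moreover have "card ?B = 3"
    using hyperbolic_distinct[OF h] by simp
  ultimately show "vec.dim {x. tangent_form u1 x = 0} = 3"
    unfolding eq by (simp add: vec.dim_eq_card_independent)
qed

lemma secant_span:
  assumes h: "hyperbolic u1 u2 u3 u4"
  shows "{x. tangent_form u1 x = 0 \<and> tangent_form u3 x = 0} = vec.span {ac_vec u2, ac_vec u4}"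
    and "vec.dim {x. tangent_form u1 x = 0 \<and> tangent_form u3 x = 0} = 2"
proof -
  let ?B = "{ac_vec u2, ac_vec u4}"
  have "x \<in> vec.span ?B" if "tangent_form u1 x = 0" "tangent_form u3 x = 0" for x
  proof -
    have "x = tangent_form u4 x *s ac_vec u2 + tangent_form u2 x *s ac_vec u4"
      using ac_coordinates[OF h, of x] that by (simp add: comb_def)
    also have "\<dots> \<in> vec.span ?B"
      by (intro vec.span_add vec.span_scale vec.span_base) simp_all
    finally show ?thesis .
  qed
  moreover have "vec.span ?B \<subseteq> {x. tangent_form u1 x = 0} \<inter> {x. tangent_form u3 x = 0}"
    by (rule vec.span_minimal[OF _ vec.subspace_inter])
       (auto simp: tangent_form_ac_vec hyperbolicD[OF h] intro: tangent_form_kernel_subspace)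
  ultimately show eq: "{x. tangent_form u1 x = 0 \<and> tangent_form u3 x = 0} = vec.span ?B"
    by blast
  have "vec.independent ?B"
    by (rule contrapos_nn[OF ac_independent[OF h]], erule vec.dependent_mono) auto
  moreover have "card ?B = 2"
    using hyperbolic_distinct[OF h] by simp
  ultimately show "vec.dim {x. tangent_form u1 x = 0 \<and> tangent_form u3 x = 0} = 2"
    unfolding eq by (simp add: vec.dim_eq_card_independent)
qed

text \<open>Used to exclude that two tangent planes through a secant line have orthogonal points of
  contact: they would meet in a generator.\<close>

lemma generator_span:
  assumes h: "hyperbolic u1 u2 u3 u4"
  shows "{x. tangent_form u1 x = 0 \<and> tangent_form u2 x = 0} = vec.span {ac_vec u1, ac_vec u2}"
    and "vec.dim {x. tangent_form u1 x = 0 \<and> tangent_form u2 x = 0} = 2"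
proof -
  let ?B = "{ac_vec u1, ac_vec u2}"
  have "x \<in> vec.span ?B" if "tangent_form u1 x = 0" "tangent_form u2 x = 0" for x
  proof -
    have "x = tangent_form u3 x *s ac_vec u1 + tangent_form u4 x *s ac_vec u2"
      using ac_coordinates[OF h, of x] that by (simp add: comb_def)
    also have "\<dots> \<in> vec.span ?B"
      by (intro vec.span_add vec.span_scale vec.span_base) simp_all
    finally show ?thesis .
  qed
  moreover have "vec.span ?B \<subseteq> {x. tangent_form u1 x = 0} \<inter> {x. tangent_form u2 x = 0}"
    by (rule vec.span_minimal[OF _ vec.subspace_inter])
       (auto simp: tangent_form_ac_vec hyperbolicD[OF h] intro: tangent_form_kernel_subspace)
  ultimately show eq: "{x. tangent_form u1 x = 0 \<and> tangent_form u2 x = 0} = vec.span ?B"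
    by blast
  have "vec.independent ?B"
    by (rule contrapos_nn[OF ac_independent[OF h]], erule vec.dependent_mono) auto
  moreover have "card ?B = 2"
    using hyperbolic_distinct[OF h] by simp
  ultimately show "vec.dim {x. tangent_form u1 x = 0 \<and> tangent_form u2 x = 0} = 2"
    unfolding eq by (simp add: vec.dim_eq_card_independent)
qed

lemma tangent_plane_tangent_at:
  assumes "Q \<noteq> 0" "bf Q Q = 0"
  shows "tangent_plane H_poly (tangent_at Q)"
proof -
  obtain u2 u3 u4 where h: "hyperbolic Q u2 u3 u4"
    using assms ex_hyperbolic_of_point by blast
  have "rational_proj_subspace 3 (tangent_at Q)"
    unfolding rational_proj_subspace_def
    by (intro exI[of _ "{tangent_coeffs Q}"] exI[of _ "{x. tangent_form Q x = 0}"])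
       (use tangent_plane_span(2)[OF h] in \<open>auto simp: tangent_form_def tangent_at_def\<close>)
  thus ?thesis
    unfolding tangent_plane_def
    using assms rat_point_in_proj_zeros_iff tangent_space_rat_point by blast
qed

text \<open>The polar of the line joining P and Q. For the pair \<open>(u1, u3)\<close> of a
  hyperbolic basis it is the line joining \<open>u2\<close> and \<open>u4\<close>.\<close>

definition polar_line :: "'a ^ 4 \<Rightarrow> 'a ^ 4 \<Rightarrow> ('a alg_closure ^ 4) set set" where
  "polar_line P Q = {p \<in> proj_space. p \<subseteq> {x. tangent_form P x = 0 \<and> tangent_form Q x = 0}}"

lemma rational_polar_line:
  assumes h: "hyperbolic u1 u2 u3 u4"
  shows "rational_proj_subspace 2 (polar_line u1 u3)"
  unfolding rational_proj_subspace_def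
  by (intro exI[of _ "{tangent_coeffs u1, tangent_coeffs u3}"]
        exI[of _ "{x. tangent_form u1 x = 0 \<and> tangent_form u3 x = 0}"])
     (use secant_span(2)[OF h] in \<open>auto simp: tangent_form_def polar_line_def\<close>)

lemma secant_vectors_nonzero:
  assumes h: "hyperbolic u1 u2 u3 u4"
  shows "u2 \<noteq> 0" "w *s u2 + u4 \<noteq> 0"
  using hyperbolicD[OF h] bf_add_left[of "w *s u2" u4 u2] by (auto simp: bf_scale_left)

text \<open>A point with coordinates b and e on u2 and u4 satisfies b e^q + e b^q = 0, so either e =
  0 or b / e is a root of t^q + t. All these roots lie in the ground field, hence so do all q + 1
  points.\<close>

lemma secant_points:
  assumes h: "hyperbolic u1 u2 u3 u4"
  shows "polar_line u1 u3 \<inter> proj_zeros H_poly = rat_point ` insert u2 ((\<lambda>w. w *s u2 + u4) ` W)"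
    and "card (polar_line u1 u3 \<inter> proj_zeros H_poly) = q + 1"
proof -
  let ?R = "insert u2 ((\<lambda>w. w *s u2 + u4) ` W)"
  \<comment> \<open>The set \<open>W\<close> already supplies q roots; one more would exceed the
    root bound in the closure.\<close>
  have roots: "t \<in> to_ac ` W" if t: "t ^ q + t = 0" for t :: "'a alg_closure"
  proof (rule ccontr)
    assume not: "t \<notin> to_ac ` W"
    have "card (insert t (to_ac ` W)) \<le> q"
    proof (rule W_root_bound)
      fix w assume "w \<in> insert t (to_ac ` W)"
      thus "w ^ q + w = 0"
      proof
        assume "w \<in> to_ac ` W"
        then obtain w' where "w = to_ac w'" "w' ^ q + w' = 0"
          by (auto simp: W_def)
        thus ?thesis by (metis to_ac_0 to_ac_add to_ac_power)
      qed (use t in simp)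
    qed
    moreover have "card (to_ac ` W) = q"
      using card_W by (simp add: card_image inj_on_def)
    ultimately show False using not by simp
  qed
  note u = secant_vectors_nonzero[OF h]
  have "p \<in> rat_point ` ?R" if p: "p \<in> polar_line u1 u3" "p \<in> proj_zeros H_poly" for p
  proof -
    obtain x where x: "x \<noteq> 0" "p = vec.span {x}"
      using p proj_pointE[of p] by (auto simp: polar_line_def)
    hence "x \<in> p" by (simp add: vec.span_base)
    hence tf: "tangent_form u1 x = 0" "tangent_form u3 x = 0"
      using p(1) by (auto simp: polar_line_def)
    define b where "b = tangent_form u4 x"
    define e where "e = tangent_form u2 x"
    have xc: "x = b *s ac_vec u2 + e *s ac_vec u4"
      using ac_coordinates[OF h, of x] by (simp add: comb_def tf b_def e_def)
    have "kf x x = 0"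
      using p(2) x span_in_proj_zeros_iff by simp
    hence eq: "b * e ^ q + e * b ^ q = 0"
      unfolding xc by (simp add: kf_simps kf_ac_vec_ac_vec hyperbolicD[OF h] algebra_simps)
    show ?thesis
    proof (cases "e = 0")
      case True
      hence "b \<noteq> 0" using x(1) xc by auto
      hence "p = rat_point u2"
        using True by (simp add: x(2) xc rat_point_def span_scale_eq)
      thus ?thesis by simp
    next
      case False
      have "(b / e) ^ q + b / e = (b * e ^ q + e * b ^ q) / (e * e ^ q)"
        using False by (simp add: power_divide add_divide_distrib)
      hence "(b / e) ^ q + b / e = 0" using eq by simp
      then obtain w where w: "w \<in> W" "b / e = to_ac w"
        using roots by blast
      have "x = e *s ((b / e) *s ac_vec u2 + ac_vec u4)"
        using False by (simp add: xc vec.scale_right_distrib)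
      also have "(b / e) *s ac_vec u2 + ac_vec u4 = ac_vec (w *s u2 + u4)"
        by (simp add: w(2) vec_eq_iff)
      finally have "p = rat_point (w *s u2 + u4)"
        using False by (simp add: x(2) rat_point_def span_scale_eq)
      thus ?thesis using w(1) by blast
    qed
  qed
  moreover have "rat_point v \<in> polar_line u1 u3 \<inter> proj_zeros H_poly" if "v \<in> ?R" for v
  proof -
    have v0: "v \<noteq> 0" using that u by auto
    have v: "bf v v = 0" "bf v u1 = 0" "bf v u3 = 0"
      using that by (auto simp: bf_simps hyperbolicD[OF h] W_iff)
    have "rat_point v \<in> tangent_at u1" "rat_point v \<in> tangent_at u3"
      using v v0 rat_point_in_tangent_at_iff by blast+
    hence "rat_point v \<in> polar_line u1 u3"
      by (auto simp: tangent_at_def polar_line_def)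
    thus ?thesis using v(1) v0 rat_point_in_proj_zeros_iff by blast
  qed
  ultimately show eq: "polar_line u1 u3 \<inter> proj_zeros H_poly = rat_point ` ?R"
    by blast
  have "inj_on rat_point ?R"
  proof (rule inj_onI)
    fix v v' assume v: "v \<in> ?R" "v' \<in> ?R" "rat_point v = rat_point v'"
    have "v' \<noteq> 0" using v(2) u by auto
    then obtain k where k: "v' = k *s v"
      using rat_point_eqD v(3) by blast
    have b: "bf v' u2 = k * bf v u2" "bf v' u4 = k * bf v u4"
      by (simp_all add: k bf_scale_left)
    have vals: "(v = u2 \<and> bf v u2 = 0 \<and> bf v u4 = 1) \<or> (v = bf v u4 *s u2 + u4 \<and> bf v u2 = 1)"
      "(v' = u2 \<and> bf v' u2 = 0 \<and> bf v' u4 = 1) \<or> (v' = bf v' u4 *s u2 + u4 \<and> bf v' u2 = 1)"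
      using v(1,2) by (auto simp: bf_simps hyperbolicD[OF h])
    show "v = v'"
      using vals b by auto
  qed
  moreover have "card ?R = q + 1"
  proof -
    have "inj_on (\<lambda>w. w *s u2 + u4) W"
      using u(1) by (intro inj_onI) simp
    moreover have "u2 \<notin> (\<lambda>w. w *s u2 + u4) ` W"
    proof
      assume "u2 \<in> (\<lambda>w. w *s u2 + u4) ` W"
      then obtain w where "u2 = w *s u2 + u4" by blast
      hence "bf u2 u2 = bf (w *s u2 + u4) u2" by simp
      thus False by (simp add: bf_simps hyperbolicD[OF h])
    qed
    ultimately show ?thesis by (simp add: card_image card_W)
  qed
  ultimately show "card (polar_line u1 u3 \<inter> proj_zeros H_poly) = q + 1"
    unfolding eq by (simp only: card_image)
qed

lemma secant_line_polar_line:
  assumes h: "hyperbolic u1 u2 u3 u4"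
  shows "secant_line q H_poly (polar_line u1 u3)"
  using rational_polar_line[OF h] secant_points(2)[OF h] by (simp add: secant_line_def)

end

section \<open>The extremal configurations\<close>

context hermitian_surface
begin

lemma tangent_form_diff_scale:
  "tangent_form (P - a *s Q) x = tangent_form P x - to_ac (a ^ q) * tangent_form Q x"
proof -
  have "ac_vec P = ac_vec (P - a *s Q) + to_ac a *s ac_vec Q"
    by (simp add: vec_eq_iff)
  hence "kf x (ac_vec P) = kf x (ac_vec (P - a *s Q)) + to_ac a ^ q * kf x (ac_vec Q)"
    by (simp only: kf_add_right kf_scale_right)
  thus ?thesis by (simp add: kf_ac_vec)
qed

lemma tangent_form_scale_point: "tangent_form (a *s Q) x = to_ac (a ^ q) * tangent_form Q x"
proof -
  have "kf x (ac_vec (a *s Q)) = to_ac a ^ q * kf x (ac_vec Q)"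
    by (simp only: ac_vec_scale kf_scale_right)
  thus ?thesis by (simp add: kf_ac_vec)
qed

text \<open>The coefficients of a tangent plane defined over the ground field are the \<open>q\<close>-th powers of
  the coordinates of the point of contact up to the invertible matrix \<open>A\<close>, and the \<open>q\<close>-power map is
  injective on points, so the point of contact is rational.\<close>
lemma tangent_plane_imp_tangent_at:
  assumes "tangent_plane H_poly H"
  shows "\<exists>Q. Q \<noteq> 0 \<and> bf Q Q = 0 \<and> H = tangent_at Q"
proof -
  obtain E :: "('a ^ 4) set" and T where T: "T = {x. \<forall>l\<in>E. (\<Sum>i\<in>UNIV. to_ac (l $ i) * x $ i) = 0}"
    and dim: "vec.dim T = 3" and H: "H = {p \<in> proj_space. p \<subseteq> T}"
    using assms unfolding tangent_plane_def rational_proj_subspace_def by blast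
  obtain p where p: "p \<in> proj_zeros H_poly" "H = tangent_space H_poly p"
    using assms unfolding tangent_plane_def by blast
  obtain x0 where x0: "x0 \<noteq> 0" "p = vec.span {x0}"
    using p(1) proj_pointE[of p] by (auto simp: proj_zeros_def)
  define n where "n i = (\<Sum>j\<in>UNIV. to_ac (A $ i $ j) * (x0 $ j) ^ q)" for i
  have kf_n: "kf y x0 = (\<Sum>i\<in>UNIV. n i * y $ i)" for y
    by (simp add: kf_def n_def sum_distrib_left sum_distrib_right mult_ac)
  have inT: "y \<in> T" if y: "kf y x0 = 0" for y
  proof (cases "y = 0")
    case True
    thus ?thesis by (simp add: T)
  next
    case False
    have "vec.span {y} \<in> tangent_space H_poly p"
      using y span_in_proj_space[OF False]
      by (auto simp: tangent_space_eq x0(2) vec.span_singleton kf_simps)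
    hence "vec.span {y} \<subseteq> T"
      using p(2) H by blast
    thus ?thesis using vec.span_base[of y "{y}"] by blast
  qed
  obtain l where l: "l \<in> E" "l \<noteq> 0"
  proof -
    have "\<exists>l\<in>E. l \<noteq> 0"
    proof (rule ccontr)
      assume "\<not> ?thesis"
      hence "T = UNIV" by (auto simp: T)
      hence "vec.dim T = 4"
        using vec_dim_card[where ?'n = 4 and ?'a = "'a alg_closure"] by simp
      with dim show False by simp
    qed
    thus ?thesis using that by blast
  qed
  have minors: "to_ac (l $ j) * n i = to_ac (l $ i) * n j" for i j
  proof (cases "i = j")
    case False
    \<comment> \<open>A vector in the kernel of n supported on the coordinates i and j; that l
      vanishes on it is the vanishing of a 2 x 2 minor, so n is proportional to l.\<close>
    define y :: "'a alg_closure ^ 4" where "y = axis j (n i) + axis i (- n j)"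
    have ax: "(\<Sum>k\<in>UNIV. c k * axis m t $ k) = c m * t" for c :: "4 \<Rightarrow> 'a alg_closure" and m t
    proof -
      have "(\<Sum>k\<in>UNIV. c k * axis m t $ k) = (\<Sum>k\<in>UNIV. if k = m then c m * t else 0)"
        by (intro sum.cong) (auto simp: axis_def)
      thus ?thesis by simp
    qed
    have dot: "(\<Sum>k\<in>UNIV. c k * y $ k) = c j * n i - c i * n j" for c
      by (simp add: y_def distrib_left sum.distrib ax)
    have "kf y x0 = 0"
      by (simp add: kf_n dot)
    hence "y \<in> T" by (rule inT)
    hence "(\<Sum>k\<in>UNIV. to_ac (l $ k) * y $ k) = 0"
      using l(1) by (simp add: T)
    thus ?thesis by (simp add: dot)
  qed simp
  obtain i0 where i0: "l $ i0 \<noteq> 0"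
    using l(2) by (auto simp: vec_eq_iff)
  define \<kappa> where "\<kappa> = n i0 / to_ac (l $ i0)"
  have n: "n i = \<kappa> * to_ac (l $ i)" for i
    using minors[of i0 i] i0 by (simp add: \<kappa>_def field_simps)
  obtain B where B: "B ** A = mat 1"
    using ex_right_inverse_A matrix_left_right_inverse by blast
  define b where "b = B *v l"
  have "(\<chi> i. n i) = ac_mat A *v (\<chi> j. (x0 $ j) ^ q)"
    by (simp add: vec_eq_iff matrix_vector_mult_def ac_mat_def n_def)
  hence "ac_mat B *v (\<chi> i. n i) = (\<chi> j. (x0 $ j) ^ q)"
    by (simp add: matrix_vector_mul_assoc B ac_mat_1 flip: ac_mat_mult)
  moreover have "(ac_mat B *v (\<chi> i. n i)) $ j = \<kappa> * to_ac (b $ j)" for j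
    by (simp add: matrix_vector_mult_def ac_mat_def n b_def to_ac_sum sum_distrib_left mult_ac)
  ultimately have x0q: "(x0 $ j) ^ q = \<kappa> * to_ac (b $ j)" for j
    by (metis vec_lambda_beta)
  \<comment> \<open>Since (b_j^q)^q = b_j on the ground field, c is the vector of the rational q-th
    roots of b.\<close>
  define c :: "'a ^ 4" where "c = (\<chi> j. (b $ j) ^ q)"
  have x0c: "(x0 $ j) ^ q = \<kappa> * to_ac (c $ j) ^ q" for j
    by (simp add: x0q c_def flip: to_ac_power)
  obtain j0 where j0: "x0 $ j0 \<noteq> 0"
    using x0(1) by (auto simp: vec_eq_iff)
  hence c0: "c $ j0 \<noteq> 0"
    using x0c[of j0] q_ge_2 by (auto simp: power_0_left)
  \<comment> \<open>Cross-multiplication eliminates \<open>\<kappa>\<close>, an element of the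
    closure, and the q-power map is injective.\<close>
  have "x0 $ j * to_ac (c $ j0) = x0 $ j0 * to_ac (c $ j)" for j
  proof -
    have "(x0 $ j * to_ac (c $ j0)) ^ q = (x0 $ j0 * to_ac (c $ j)) ^ q"
      by (simp add: power_mult_distrib x0c)
    thus ?thesis by (subst (asm) power_q_eq_iff) simp_all
  qed
  hence x0eq: "x0 = (x0 $ j0 / to_ac (c $ j0)) *s ac_vec c"
    using c0 by (simp add: vec_eq_iff field_simps)
  have "p = rat_point c"
    unfolding x0(2) rat_point_def by (subst x0eq, rule span_scale_eq) (use j0 c0 in simp)
  moreover have "c \<noteq> 0" using c0 by auto
  ultimately show ?thesis
    using p rat_point_in_proj_zeros_iff tangent_space_rat_point by blast
qed

section \<open>Counting points in unions of tangent planes\<close>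

definition plane_points :: "'a ^ 4 \<Rightarrow> ('a alg_closure ^ 4) set set" where
  "plane_points Q = rat_point ` {v. v \<noteq> 0 \<and> bf v v = 0 \<and> bf v Q = 0}"

lemma rational_points_tangent_at:
  "rational_points (tangent_at Q \<inter> proj_zeros H_poly) = plane_points Q"
  unfolding rational_points_alt plane_points_def
  using rat_point_in_proj_zeros_iff rat_point_in_tangent_at_iff by blast

text \<open>The section consists of the q + 1 generators through Q, each with q^2 further points.
  \<open>E2\<close> covers the generator through u2 and \<open>E3\<close> the other q.\<close>

lemma card_plane_points:
  assumes Q: "Q \<noteq> 0" "bf Q Q = 0"
  shows "card (plane_points Q) = q ^ 3 + q ^ 2 + 1"
proof -
  obtain u2 u3 u4 where h: "hyperbolic Q u2 u3 u4"
    using Q ex_hyperbolic_of_point by blast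
  let ?c = "comb Q u2 u3 u4"
  define E1 where "E1 = {?c 1 0 0 0}"
  define E2 where "E2 = range (\<lambda>s. ?c s 1 0 0)"
  define E3 where "E3 = (\<lambda>(r, w). ?c r w 0 1) ` (UNIV \<times> W)"
  note scale = scale_comb[of _ Q u2 u3 u4] and c0 = comb_eq_0_iff[OF h]
  \<comment> \<open>The last nonzero coordinate is normalised to 1, which makes the representatives
    unique.\<close>
  have form: "\<exists>a b e. v = ?c a b 0 e \<and> (e = 1 \<or> e = 0 \<and> b = 1 \<or> e = 0 \<and> b = 0 \<and> a = 1)"
    if "v \<in> E1 \<union> E2 \<union> E3" for v
    using that unfolding E1_def E2_def E3_def by auto
  have inj: "inj_on rat_point (E1 \<union> E2 \<union> E3)"
  proof (rule inj_onI)
    fix v v' assume v: "v \<in> E1 \<union> E2 \<union> E3" "v' \<in> E1 \<union> E2 \<union> E3" "rat_point v = rat_point v'"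
    obtain a b e where ab: "v = ?c a b 0 e" "e = 1 \<or> e = 0 \<and> b = 1 \<or> e = 0 \<and> b = 0 \<and> a = 1"
      using form[OF v(1)] by blast
    obtain a' b' e' where ab': "v' = ?c a' b' 0 e'" "e' = 1 \<or> e' = 0 \<and> b' = 1 \<or> e' = 0 \<and> b' = 0 \<and> a' = 1"
      using form[OF v(2)] by blast
    have "v' \<noteq> 0" using ab' by (auto simp: c0)
    then obtain k where "v' = k *s v"
      using rat_point_eqD[OF v(3)] by blast
    hence "a' = k * a" "b' = k * b" "e' = k * e"
      by (simp_all add: ab ab' scale comb_eq_iff[OF h])
    thus "v = v'"
      using ab ab' by auto
  qed
  have "plane_points Q = rat_point ` (E1 \<union> E2 \<union> E3)"
  proof
    show "plane_points Q \<subseteq> rat_point ` (E1 \<union> E2 \<union> E3)"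
    proof
      fix p assume "p \<in> plane_points Q"
      then obtain v where v: "p = rat_point v" "v \<noteq> 0" "bf v v = 0" "bf v Q = 0"
        by (auto simp: plane_points_def)
      obtain k where k: "k \<noteq> 0" and alt: "v = k *s ?c 1 0 0 0 \<or>
        (\<exists>s. v = k *s ?c s 1 0 0) \<or> (\<exists>w\<in>W. \<exists>r. v = k *s ?c r w 0 1) \<or>
        (\<exists>s. \<exists>w\<in>W. \<exists>r. v = k *s ?c (w + r * s) r 1 (- (s ^ q)))"
        using isotropic_normal_form[OF h v(2,3)] by blast
      from alt have "\<exists>v'\<in>E1 \<union> E2 \<union> E3. v = k *s v'"
      proof (elim disjE exE bexE)
        fix s w r assume "v = k *s ?c (w + r * s) r 1 (- (s ^ q))"
        hence "k = 0"
          using v(4) by (simp add: bf_scale_left bf_comb_basis[OF h])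
        with k show ?thesis by simp
      next
        fix w r assume "w \<in> W" "v = k *s ?c r w 0 1"
        moreover from this have "?c r w 0 1 \<in> E3"
          by (force simp: E3_def)
        ultimately show ?thesis by blast
      qed (auto simp: E1_def E2_def)
      thus "p \<in> rat_point ` (E1 \<union> E2 \<union> E3)"
        using v(1) rat_point_eqI[OF k] by auto
    qed
    show "rat_point ` (E1 \<union> E2 \<union> E3) \<subseteq> plane_points Q"
    proof
      fix p assume "p \<in> rat_point ` (E1 \<union> E2 \<union> E3)"
      then obtain v where v: "v \<in> E1 \<union> E2 \<union> E3" "p = rat_point v" by blast
      have "bf v v = 0"
        using v(1) q_ge_2 by (auto simp: E1_def E2_def E3_def bf_comb[OF h] power_0_left W_iff)
      moreover have "v \<noteq> 0" "bf v Q = 0"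
        using form[OF v(1)] by (auto simp: c0 bf_comb_basis[OF h])
      ultimately show "p \<in> plane_points Q"
        using v(2) by (auto simp: plane_points_def)
    qed
  qed
  hence "card (plane_points Q) = card (E1 \<union> E2 \<union> E3)"
    using inj by (simp add: card_image)
  also have "\<dots> = card E1 + card E2 + card E3"
    by (subst card_Un_disjoint, simp, simp,
        force simp: E1_def E2_def E3_def comb_eq_iff[OF h],
        subst card_Un_disjoint, simp, simp,
        force simp: E1_def E2_def comb_eq_iff[OF h], simp)
  also have "card E1 = 1" by (simp add: E1_def)
  also have "card E2 = q ^ 2"
    unfolding E2_def by (subst card_image) (auto intro!: injI simp: comb_eq_iff[OF h] card_field)
  also have "card E3 = q ^ 2 * q"
    unfolding E3_def
    by (subst card_image) (auto intro!: inj_onI simp: comb_eq_iff[OF h] card_cartesian_product card_field card_W)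
  finally show ?thesis by (simp add: power3_eq_cube power2_eq_square)
qed

text \<open>Once the points of contact are known not to be orthogonal, scaling makes them a
  hyperbolic pair. Then the planes meet in a polar line, which equals L by dimension.\<close>

lemma secant_in_two_planes:
  assumes Q: "Q \<noteq> 0" "bf Q Q = 0" and Q': "Q' \<noteq> 0" "bf Q' Q' = 0"
    and neq: "tangent_at Q \<noteq> tangent_at Q'" and L: "secant_line q H_poly L"
    and sub: "L \<subseteq> tangent_at Q" "L \<subseteq> tangent_at Q'"
  shows "plane_points Q \<inter> plane_points Q' = rational_points (L \<inter> proj_zeros H_poly)"
    and "card (rational_points (L \<inter> proj_zeros H_poly)) = q + 1"
proof -
  obtain E :: "('a ^ 4) set" and T where T: "T = {x. \<forall>l\<in>E. (\<Sum>i\<in>UNIV. to_ac (l $ i) * x $ i) = 0}"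
    and dim: "vec.dim T = 2" and LT: "L = {p \<in> proj_space. p \<subseteq> T}"
    and cardL: "card (L \<inter> proj_zeros H_poly) = q + 1"
    using L unfolding secant_line_def rational_proj_subspace_def by blast
  have T0: "(0 :: 'a alg_closure ^ 4) \<in> T" by (simp add: T)
  have Tsub: "vec.subspace T"
    by (rule vec.subspaceI)
       (auto simp: T distrib_left sum.distrib mult.left_commute simp flip: sum_distrib_left)
  have ker: "tangent_form Q y = 0 \<and> tangent_form Q' y = 0" if y: "y \<in> T" for y
  proof (cases "y = 0")
    case True
    thus ?thesis by (simp add: tangent_form_def)
  next
    case False
    have "vec.span {y} \<subseteq> T"
      using y by (intro vec.span_minimal Tsub) simp
    hence "vec.span {y} \<in> L"
      using span_in_proj_space[OF False] by (simp add: LT)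
    moreover have "y \<in> vec.span {y}" by (simp add: vec.span_base)
    ultimately show ?thesis
      using sub by (auto simp: tangent_at_def)
  qed
  have points: "rat_point Q \<noteq> rat_point Q'"
    using neq tangent_space_rat_point by metis
  \<comment> \<open>Orthogonal points of contact would make L a generator, with at least q^2 points
    on the surface, more than q + 1 since q >= 2.\<close>
  have nonzero: "bf Q Q' \<noteq> 0"
  proof
    assume orth: "bf Q Q' = 0"
    have "Q' \<noteq> k *s Q" for k
      using points Q'(1) rat_point_eqI[of k Q] by auto
    then obtain a u3 u4 where h: "hyperbolic Q (Q' - a *s Q) u3 u4"
      using ex_hyperbolic_of_generator[OF Q Q'(2)] orth bf_eq_0_commute by blast
    let ?u2 = "Q' - a *s Q"
    let ?Z = "{x. tangent_form Q x = 0 \<and> tangent_form ?u2 x = 0}"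
    have "vec.subspace ?Z"
      unfolding generator_span(1)[OF h] by (rule vec.subspace_span)
    moreover have "T \<subseteq> ?Z"
      using ker by (auto simp: tangent_form_diff_scale)
    ultimately have TZ: "T = ?Z"
      using Tsub dim generator_span(2)[OF h] by (intro vec.subspace_dim_equal) simp_all
    define f where "f s = s *s Q + ?u2" for s
    have f0: "f s \<noteq> 0" for s
    proof
      assume "f s = 0"
      hence "bf (f s) u4 = 0" by simp
      thus False by (simp add: f_def bf_add_left bf_scale_left hyperbolicD[OF h])
    qed
    have "rat_point (f s) \<in> L \<inter> proj_zeros H_poly" for s
    proof -
      have "bf (f s) (f s) = 0" "bf (f s) Q = 0" "bf (f s) ?u2 = 0"
        unfolding f_def by (simp_all add: bf_add_left bf_add_right bf_scale_left bf_scale_right hyperbolicD[OF h])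
      moreover from this have "rat_point (f s) \<in> tangent_at Q" "rat_point (f s) \<in> tangent_at ?u2"
        using rat_point_in_tangent_at_iff[OF f0] by blast+
      ultimately show ?thesis
        using f0 rat_point_in_proj_zeros_iff by (auto simp: LT TZ tangent_at_def)
    qed
    hence "range (\<lambda>s. rat_point (f s)) \<subseteq> L \<inter> proj_zeros H_poly" by blast
    moreover have "finite (L \<inter> proj_zeros H_poly)"
      by (rule card_ge_0_finite) (simp add: cardL)
    ultimately have "card (range (\<lambda>s. rat_point (f s))) \<le> q + 1"
      using cardL card_mono by metis
    moreover have "inj (\<lambda>s. rat_point (f s))"
    proof (rule injI)
      fix s t assume "rat_point (f s) = rat_point (f t)"
      then obtain k where k: "f t = k *s f s"
        using rat_point_eqD f0 by blast
      have "bf (f t) u4 = k * bf (f s) u4" "bf (f t) u3 = k * bf (f s) u3"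
        by (simp_all add: k bf_scale_left)
      thus "s = t"
        by (simp add: f_def bf_add_left bf_scale_left hyperbolicD[OF h])
    qed
    ultimately have "q * q \<le> q + 1"
      by (simp add: card_image card_field power2_eq_square)
    moreover have "2 * q \<le> q * q"
      using q_ge_2 by simp
    ultimately show False using q_ge_2 by linarith
  qed
  obtain c where c: "c ^ q = 1 / bf Q Q'"
    using ex_power_q_eq by blast
  hence c0: "c \<noteq> 0" using nonzero q_ge_2 by (auto simp: power_0_left)
  have "bf (c *s Q') (c *s Q') = 0" "bf Q (c *s Q') = 1"
    using Q' nonzero c by (simp_all add: bf_simps)
  then obtain u2 u4 where h: "hyperbolic Q u2 (c *s Q') u4"
    using ex_hyperbolic_of_pair[OF Q(2)] by blast
  have Z: "tangent_form (c *s Q') x = 0 \<longleftrightarrow> tangent_form Q' x = 0" for x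
    using c0 by (simp add: tangent_form_scale_point)
  let ?Z = "{x. tangent_form Q x = 0 \<and> tangent_form (c *s Q') x = 0}"
  have "vec.subspace ?Z"
    unfolding secant_span(1)[OF h] by (rule vec.subspace_span)
  moreover have "T \<subseteq> ?Z"
    using ker by (auto simp: Z)
  ultimately have TZ: "T = ?Z"
    using Tsub dim secant_span(2)[OF h] by (intro vec.subspace_dim_equal) simp_all
  hence Lp: "L = polar_line Q (c *s Q')"
    by (simp add: LT polar_line_def)
  have "tangent_at Q \<inter> tangent_at Q' = L"
    unfolding Lp by (auto simp: tangent_at_def polar_line_def Z)
  thus "plane_points Q \<inter> plane_points Q' = rational_points (L \<inter> proj_zeros H_poly)"
    unfolding rational_points_tangent_at[symmetric] by (auto simp: rational_points_def)
  have "rational_points (L \<inter> proj_zeros H_poly) = L \<inter> proj_zeros H_poly"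
  proof -
    have "v \<noteq> 0" if "v \<in> insert u2 ((\<lambda>w. w *s u2 + u4) ` W)" for v
      using that secant_vectors_nonzero[OF h] by auto
    hence "\<exists>v. v \<noteq> 0 \<and> p = rat_point v" if "p \<in> L \<inter> proj_zeros H_poly" for p
      using that unfolding Lp secant_points(1)[OF h] by (elim imageE) metis
    thus ?thesis
      unfolding rational_points_alt by blast
  qed
  thus "card (rational_points (L \<inter> proj_zeros H_poly)) = q + 1"
    using cardL by simp
qed

lemma finite_rational_points: "finite (rational_points Y :: ('a alg_closure ^ 4) set set)"
proof (rule finite_subset)
  show "rational_points Y \<subseteq> range (rat_point :: 'a ^ 4 \<Rightarrow> _)"
    by (auto simp: rational_points_alt)
qed simp

text \<open>Every plane has q^3 + q^2 + 1 rational points on the surface, of which q + 1 are on L;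
  any two planes share only those, so each adds q^3 + q^2 - q to the points of L.\<close>

lemma card_union_tangent_planes:
  assumes card: "card \<T> = d" and d: "1 \<le> d"
    and planes: "\<And>H. H \<in> \<T> \<Longrightarrow> tangent_plane H_poly H"
    and L: "secant_line q H_poly L" "\<And>H. H \<in> \<T> \<Longrightarrow> L \<subseteq> H"
  shows "card (rational_points (\<Union>\<T> \<inter> proj_zeros H_poly)) = max_count d"
proof -
  define P where "P H = rational_points (H \<inter> proj_zeros H_poly)" for H
  define PL where "PL = rational_points (L \<inter> proj_zeros H_poly)"
  have fin: "finite \<T>"
    by (rule card_ge_0_finite) (use card d in simp)
  have union: "rational_points (\<Union>\<T> \<inter> proj_zeros H_poly) = (\<Union>H\<in>\<T>. P H)"
    by (auto simp: P_def rational_points_def)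
  have cardP: "card (P H) = q ^ 3 + q ^ 2 + 1" if "H \<in> \<T>" for H
    using tangent_plane_imp_tangent_at[OF planes[OF that]] card_plane_points
    by (auto simp: P_def rational_points_tangent_at)
  have PL_sub: "PL \<subseteq> P H" if "H \<in> \<T>" for H
    using L(2)[OF that] by (auto simp: PL_def P_def rational_points_def)
  have pair: "P H \<inter> P H' = PL \<and> card PL = q + 1" if H: "H \<in> \<T>" "H' \<in> \<T>" "H \<noteq> H'" for H H'
  proof -
    obtain Q Q' where Q: "Q \<noteq> 0" "bf Q Q = 0" "H = tangent_at Q"
      and Q': "Q' \<noteq> 0" "bf Q' Q' = 0" "H' = tangent_at Q'"
      using tangent_plane_imp_tangent_at planes H by metis
    show ?thesis
      using secant_in_two_planes[OF Q(1,2) Q'(1,2) _ L(1)] L(2) H Q(3) Q'(3)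
      by (simp add: P_def PL_def rational_points_tangent_at)
  qed
  have q3: "q ^ 3 + q ^ 2 + 1 = (q ^ 3 + q ^ 2 - q) + (q + 1)"
  proof -
    have "q \<le> q ^ 3 + q ^ 2"
      using self_le_power[of q 2] q_ge_2 by simp
    thus ?thesis by simp
  qed
  show ?thesis
  \<comment> \<open>The size of \<open>PL\<close> is obtained from two different planes, so a single
    plane is counted directly.\<close>
  proof (cases "d = 1")
    case True
    then obtain H where "\<T> = {H}"
      using card by (auto simp: card_1_singleton_iff)
    thus ?thesis
      unfolding union using cardP[of H] q3 True by (simp add: max_count_def)
  next
    case False
    then obtain H1 H2 where "H1 \<in> \<T>" "H2 \<in> \<T>" "H1 \<noteq> H2"
      using card d card_le_Suc0_iff_eq[OF fin] by (metis One_nat_def le_antisym)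
    hence cPL: "card PL = q + 1" using pair by blast
    have finP: "finite (P H)" for H
      unfolding P_def by (rule finite_rational_points)
    have finPL: "finite PL"
      unfolding PL_def by (rule finite_rational_points)
    have ne: "\<T> \<noteq> {}" using card d by auto
    have split: "(\<Union>H\<in>\<T>. P H) = (\<Union>H\<in>\<T>. P H - PL) \<union> PL"
      using PL_sub ne by blast
    have "card (\<Union>H\<in>\<T>. P H) = card (\<Union>H\<in>\<T>. P H - PL) + card PL"
      unfolding split by (rule card_Un_disjoint) (use fin finP finPL in auto)
    also have "card (\<Union>H\<in>\<T>. P H - PL) = (\<Sum>H\<in>\<T>. card (P H - PL))"
      using fin finP pair by (intro card_UN_disjoint) auto
    also have "\<dots> = (\<Sum>H\<in>\<T>. q ^ 3 + q ^ 2 - q)"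
    proof (rule sum.cong)
      fix H assume "H \<in> \<T>"
      thus "card (P H - PL) = q ^ 3 + q ^ 2 - q"
        using cardP PL_sub cPL finPL q3 by (simp add: card_Diff_subset)
    qed simp
    finally show ?thesis
      unfolding union by (simp add: card cPL max_count_def)
  qed
qed

lemma tangent_at_eqD:
  assumes Q: "Q \<noteq> 0" and Q': "Q' \<noteq> 0" "bf Q' Q' = 0" and eq: "tangent_at Q = tangent_at Q'"
  shows "rat_point Q = rat_point Q'"
proof (rule rat_point_eq_of_perp_subset[OF Q Q'(2,1)])
  fix y assume "bf y Q' = 0"
  thus "bf y Q = 0"
    using eq rat_point_in_tangent_at_iff[of y] by (cases "y = 0") auto
qed

text \<open>The d full points give d linear factors, which exhaust the degree of F; its zero set
  over the closure is therefore the union of their tangent planes.\<close>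

lemma maximal_imp_tangent_planes:
  assumes F: "F \<noteq> 0" and hom: "homogeneous d F" and d: "1 \<le> d" "d \<le> q"
    and maximal: "point_count F = max_count d"
  shows "\<exists>\<T> L. card \<T> = d \<and> (\<forall>H\<in>\<T>. tangent_plane H_poly H) \<and>
    secant_line q H_poly L \<and> (\<forall>H\<in>\<T>. L \<subseteq> H) \<and> proj_zeros F = \<Union>\<T>"
proof -
  obtain R R' where R: "bf R R = 0" "bf R' R' = 0" "bf R R' \<noteq> 0"
    and perp: "\<And>Q. full F Q \<Longrightarrow> bf R Q = 0 \<and> bf R' Q = 0"
    and card: "card (rat_point ` {Q. full F Q}) = d"
    using maximal_structure[OF F hom d maximal] by blast
  obtain M where M: "M \<subseteq> {Q. full F Q}" "inj_on rat_point M" "rat_point ` {Q. full F Q} = rat_point ` M"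
    using subset_image_inj[of "rat_point ` {Q. full F Q}" rat_point "{Q. full F Q}"] by auto
  have cardM: "card M = d"
    using card M by (simp add: card_image)
  have full: "full F Q" if "Q \<in> M" for Q
    using M(1) that by blast
  have iso: "Q \<noteq> 0" "bf Q Q = 0" if "Q \<in> M" for Q
    using full[OF that] by (auto simp: full_def)
  have nz: "\<exists>v. ground_eval F v \<noteq> 0"
    by (rule ex_ground_eval_nonzero[OF F hom degree_less_card[OF F hom d]])
  obtain G where G: "homogeneous (d - card M) G"
    "\<And>x. eval_mpoly F x = (\<Prod>Q\<in>M. tangent_form Q x) * eval_mpoly G x"
    using factor_tangent_planes[OF finite M(2) _ hom degree_less_card[OF F hom d] nz]
      iso full full_vanishes_on_plane[OF _ hom d] by blast
  \<comment> \<open>The cofactor has degree 0, so scaling by 0 multiplies its value by 0^0 =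
    1.\<close>
  have const: "eval_mpoly G x = eval_mpoly G 0" for x
    using eval_mpoly_scale[OF G(1), of 0 x] by (simp add: cardM)
  obtain v where "ground_eval F v \<noteq> 0"
    using nz by blast
  hence "eval_mpoly F (ac_vec v) \<noteq> 0"
    by (simp add: eval_mpoly_ac_vec)
  hence G0: "eval_mpoly G 0 \<noteq> 0"
    using G(2)[of "ac_vec v"] const[of "ac_vec v"] by auto
  have F0: "eval_mpoly F x = 0 \<longleftrightarrow> (\<exists>Q\<in>M. tangent_form Q x = 0)" for x
    unfolding G(2)[of x] const[of x] using G0 by simp
  have zeros: "proj_zeros F = \<Union>(tangent_at ` M)"
  proof
    show "proj_zeros F \<subseteq> \<Union>(tangent_at ` M)"
    proof
      fix p assume p: "p \<in> proj_zeros F"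
      then obtain x where x: "x \<noteq> 0" "p = vec.span {x}"
        using proj_pointE[of p] by (auto simp: proj_zeros_def)
      hence "eval_mpoly F x = 0"
        using p by (auto simp: proj_zeros_def vec.span_base)
      then obtain Q where Q: "Q \<in> M" "tangent_form Q x = 0"
        using F0 by blast
      hence "p \<in> tangent_at Q"
        using p by (auto simp: tangent_at_def proj_zeros_def x(2) vec.span_singleton tangent_form_scale)
      with Q(1) show "p \<in> \<Union>(tangent_at ` M)" by blast
    qed
    show "\<Union>(tangent_at ` M) \<subseteq> proj_zeros F"
      using F0 by (auto simp: proj_zeros_def tangent_at_def)
  qed
  have "inj_on tangent_at M"
    using tangent_at_eqD iso M(2) by (meson inj_on_def)
  hence cardT: "card (tangent_at ` M) = d"
    using cardM by (simp add: card_image)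
  obtain c where c: "c ^ q = 1 / bf R R'"
    using ex_power_q_eq by blast
  have "bf (c *s R') (c *s R') = 0" "bf R (c *s R') = 1"
    using R c by (simp_all add: bf_simps)
  then obtain u2 u4 where "hyperbolic R u2 (c *s R') u4"
    using ex_hyperbolic_of_pair[OF R(1)] by blast
  \<comment> \<open>Exchanging the two pairs presents the line through R and R' as the polar line of
    u2 and u4, the form in which secant lines were analysed.\<close>
  hence h: "hyperbolic u2 R u4 (c *s R')"
    by (rule hyperbolic_swap)
  have "polar_line u2 u4 \<subseteq> tangent_at Q" if Q: "Q \<in> M" for Q
  proof
    fix p assume p: "p \<in> polar_line u2 u4"
    have "bf R Q = 0" "bf (c *s R') Q = 0"
      using perp[OF full[OF Q]] by (simp_all add: bf_scale_left)
    hence "vec.span {ac_vec R, ac_vec (c *s R')} \<subseteq> {x. tangent_form Q x = 0}"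
      by (intro vec.span_minimal tangent_form_kernel_subspace) (auto simp: tangent_form_ac_vec)
    thus "p \<in> tangent_at Q"
      using p secant_span(1)[OF h] by (auto simp: polar_line_def tangent_at_def)
  qed
  thus ?thesis
    using cardT zeros secant_line_polar_line[OF h] tangent_plane_tangent_at iso
    by (intro exI[of _ "tangent_at ` M"] exI[of _ "polar_line u2 u4"]) auto
qed

end

theorem corollary5p2:
  fixes q d :: nat
    and A :: "'a::{field,finite} ^ 4 ^ 4"
    and F :: "(4, 'a) mpoly"
  defines "V2 \<equiv> proj_zeros (hermitian_poly q A)"
  assumes "primepow q" and "CARD('a) = q ^ 2"
    and "hermitian_matrix q A" and "rank A = 4"
    and "F \<noteq> 0" and "homogeneous d F" and "1 \<le> d" and "d \<le> q"
  shows "card (rational_points (proj_zeros F \<inter> V2)) \<le> d * (q ^ 3 + q ^ 2 - q) + q + 1 \<and>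
    (card (rational_points (proj_zeros F \<inter> V2)) = d * (q ^ 3 + q ^ 2 - q) + q + 1 \<longleftrightarrow>
      (\<exists>\<T> L. card \<T> = d \<and> (\<forall>H\<in>\<T>. tangent_plane (hermitian_poly q A) H) \<and>
        secant_line q (hermitian_poly q A) L \<and> (\<forall>H\<in>\<T>. L \<subseteq> H) \<and>
        proj_zeros F = \<Union>\<T>))"
proof -
  interpret hermitian_surface q "TYPE('a)" A
    by unfold_locales (use assms in auto)
  have count: "card (rational_points (proj_zeros F \<inter> V2)) = point_count F"
    unfolding V2_def point_count_def rational_points_zeros[OF \<open>homogeneous d F\<close>] ..
  show ?thesis
    unfolding count max_count_def [symmetric]
  proof (intro conjI iffI)
    show "point_count F \<le> max_count d"
      by (rule point_count_bound) fact+
    show "\<exists>\<T> L. card \<T> = d \<and> (\<forall>H\<in>\<T>. tangent_plane H_poly H) \<and>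
        secant_line q H_poly L \<and> (\<forall>H\<in>\<T>. L \<subseteq> H) \<and> proj_zeros F = \<Union>\<T>"
      if "point_count F = max_count d"
      by (rule maximal_imp_tangent_planes) (fact | fact that)+
    assume "\<exists>\<T> L. card \<T> = d \<and> (\<forall>H\<in>\<T>. tangent_plane H_poly H) \<and>
        secant_line q H_poly L \<and> (\<forall>H\<in>\<T>. L \<subseteq> H) \<and> proj_zeros F = \<Union>\<T>"
    thus "point_count F = max_count d"
    proof (elim exE conjE)
      fix \<T> L assume "card \<T> = d" "\<forall>H\<in>\<T>. tangent_plane H_poly H"
        "secant_line q H_poly L" "\<forall>H\<in>\<T>. L \<subseteq> H" and zeros: "proj_zeros F = \<Union>\<T>"
      thus ?thesis
        unfolding count[symmetric] V2_def zeros using \<open>1 \<le> d\<close> by (intro card_union_tangent_planes) auto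
    qed
  qed
qed

end
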